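(* Let $a,b,c,n,x_0,y_0\in\mathbb{R}$ with $n\ne0$, $\Delta:=\sqrt{b^2-4ac}>0$ and $a,b,c,\Delta\in\mathbb{Z}$, let $h$ be the hyperbola $a(x-x_0)^2+b(x-x_0)(y-y_0)+c(y-y_0)^2=n$, and let $H$ be the closure of one of the convex connected components of $\mathbb{R}^2\setminus h$. There is an algorithm that, with input $a,b,c,n$ (together with $x_0,y_0$) and a vertex of $\mathrm{conv}(H\cap\mathbb{Z}^2)$, finds the next vertex of $\mathrm{conv}(H\cap\mathbb{Z}^2)$ (the adjacent vertex along the boundary in a fixed direction of traversal) using at most \[ O\big(\log(\max\{|n|,|a|,|b|,|c|\})\big) \] arithmetic operations.
   Context: Complexity is measured in the arithmetic (RAM) model: comparisons, additions, subtractions, multiplications, integer divisions $\lfloor b/a\rfloor$ and integer square roots $\lfloor\sqrt a\rfloor$ each cost $O(1)$. *)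

theory Defs
  imports "HOL-Analysis.Analysis"
begin

text \<open>
  Arithmetic RAM.  The hyperbola data \<open>n, x\<^sub>0, y\<^sub>0\<close> are arbitrary reals, so memory cells hold
  reals.  Program constants are integers only, so that no information can be hidden in a
  real constant.  Every executed instruction costs 1, and so does every evaluated test.
\<close>

type_synonym store = "nat \<Rightarrow> real"

datatype instr =
    Const nat int
  | Copy nat nat
  | Load nat nat
  | Store nat nat
  | Add nat nat nat
  | Sub nat nat nat
  | Mul nat nat nat
  | FloorDiv nat nat nat
  | FloorSqrt nat nat

text \<open>
  \<open>FloorDiv\<close> by zero and \<open>FloorSqrt\<close> of a negative number take the values of the total HOL
  functions \<open>(/)\<close> and \<open>sqrt\<close>; a program could compute those values itself with boundedly many
  other operations, so these conventions do not add power to the model.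
\<close>

fun effect :: "instr \<Rightarrow> store \<Rightarrow> store" where
  "effect (Const i z) s = s(i := of_int z)"
| "effect (Copy i j) s = s(i := s j)"
| "effect (Load i j) s = s(i := s (nat \<lfloor>s j\<rfloor>))"
| "effect (Store i j) s = s(nat \<lfloor>s i\<rfloor> := s j)"
| "effect (Add i j k) s = s(i := s j + s k)"
| "effect (Sub i j k) s = s(i := s j - s k)"
| "effect (Mul i j k) s = s(i := s j * s k)"
| "effect (FloorDiv i j k) s = s(i := of_int \<lfloor>s j / s k\<rfloor>)"
| "effect (FloorSqrt i j) s = s(i := of_int \<lfloor>sqrt (s j)\<rfloor>)"

datatype test = LT nat nat | LE nat nat | EQ nat nat | NE nat nat

fun holds :: "test \<Rightarrow> store \<Rightarrow> bool" where
  "holds (LT i j) s \<longleftrightarrow> s i < s j"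
| "holds (LE i j) s \<longleftrightarrow> s i \<le> s j"
| "holds (EQ i j) s \<longleftrightarrow> s i = s j"
| "holds (NE i j) s \<longleftrightarrow> s i \<noteq> s j"

datatype prog =
    Skip
  | Instr instr
  | Seq prog prog
  | Cond test prog prog
  | While test prog

text \<open>\<open>exec P s k t\<close>: started in \<open>s\<close>, the program \<open>P\<close> halts in \<open>t\<close> after exactly \<open>k\<close> operations.\<close>

inductive exec :: "prog \<Rightarrow> store \<Rightarrow> nat \<Rightarrow> store \<Rightarrow> bool" where
  exec_Skip: "exec Skip s 0 s"
| exec_Instr: "exec (Instr i) s 1 (effect i s)"
| exec_Seq: "exec P s k t \<Longrightarrow> exec Q t l u \<Longrightarrow> exec (Seq P Q) s (k + l) u"
| exec_CondT: "holds b s \<Longrightarrow> exec P s k t \<Longrightarrow> exec (Cond b P Q) s (1 + k) t"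
| exec_CondF: "\<not> holds b s \<Longrightarrow> exec Q s k t \<Longrightarrow> exec (Cond b P Q) s (1 + k) t"
| exec_WhileF: "\<not> holds b s \<Longrightarrow> exec (While b P) s 1 s"
| exec_WhileT: "holds b s \<Longrightarrow> exec P s k t \<Longrightarrow> exec (While b P) t l u
    \<Longrightarrow> exec (While b P) s (1 + k + l) u"

inductive_cases exec_SkipE: "exec Skip s k t"
inductive_cases exec_InstrE: "exec (Instr i) s k t"
inductive_cases exec_SeqE: "exec (Seq P Q) s k t"
inductive_cases exec_CondE: "exec (Cond b P Q) s k t"
inductive_cases exec_WhileE: "exec (While b P) s k t"

lemma exec_deterministic:
  "exec P s k t \<Longrightarrow> exec P s k' t' \<Longrightarrow> k' = k \<and> t' = t"
proof (induction arbitrary: k' t' rule: exec.induct)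
  case (exec_Skip s)
  then show ?case by (auto elim: exec_SkipE)
next
  case (exec_Instr i s)
  then show ?case by (auto elim: exec_InstrE)
next
  case (exec_Seq P s k t Q l u)
  from exec_Seq.prems obtain k1 l1 t1 where *: "exec P s k1 t1" "exec Q t1 l1 t'" "k' = k1 + l1"
    by (rule exec_SeqE)
  from exec_Seq.IH(1)[OF *(1)] * exec_Seq.IH(2)[of l1 t'] show ?case
    by simp
next
  case (exec_CondT b s P k t Q)
  from exec_CondT.prems exec_CondT.hyps(1) obtain k1 where *: "exec P s k1 t'" "k' = 1 + k1"
    by (auto elim: exec_CondE)
  from exec_CondT.IH[OF *(1)] * show ?case
    by simp
next
  case (exec_CondF b s Q k t P)
  from exec_CondF.prems exec_CondF.hyps(1) obtain k1 where *: "exec Q s k1 t'" "k' = 1 + k1"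
    by (auto elim: exec_CondE)
  from exec_CondF.IH[OF *(1)] * show ?case
    by simp
next
  case (exec_WhileF b s P)
  from exec_WhileF.prems exec_WhileF.hyps show ?case
    by (auto elim: exec_WhileE)
next
  case (exec_WhileT b s P k t l u)
  from exec_WhileT.prems exec_WhileT.hyps(1) obtain k1 l1 t1
    where *: "exec P s k1 t1" "exec (While b P) t1 l1 t'" "k' = 1 + k1 + l1"
    by (auto elim: exec_WhileE)
  from exec_WhileT.IH(1)[OF *(1)] * exec_WhileT.IH(2)[of l1 t'] show ?case
    by simp
qed

text \<open>Inputs are placed in the first cells; all other cells are initially 0.\<close>

definition input_store :: "real list \<Rightarrow> store" where
  "input_store xs = (\<lambda>i. if i < length xs then xs ! i else 0)"

definition hyperbola ::
    "real \<Rightarrow> real \<Rightarrow> real \<Rightarrow> real \<Rightarrow> real \<Rightarrow> real \<Rightarrow> (real \<times> real) set" where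
  "hyperbola a b c n x0 y0 =
    {(x, y). a * (x - x0)\<^sup>2 + b * (x - x0) * (y - y0) + c * (y - y0)\<^sup>2 = n}"

definition integer_hull :: "(real \<times> real) set \<Rightarrow> (real \<times> real) set" where
  "integer_hull H = convex hull (H \<inter> (\<int> \<times> \<int>))"

datatype orientation = Counterclockwise | Clockwise

text \<open>Positive iff \<open>p, q, r\<close> make a left turn.\<close>

definition turn :: "real \<times> real \<Rightarrow> real \<times> real \<Rightarrow> real \<times> real \<Rightarrow> real" where
  "turn p q r = (fst q - fst p) * (snd r - snd p) - (snd q - snd p) * (fst r - fst p)"

text \<open>
  Traversing the boundary of \<open>K\<close> counterclockwise means walking along its edges with \<open>K\<close> on the
  left-hand side; clockwise, on the right-hand side.
\<close>

definition next_vertex ::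
    "orientation \<Rightarrow> (real \<times> real) set \<Rightarrow> real \<times> real \<Rightarrow> real \<times> real \<Rightarrow> bool" where
  "next_vertex d K v w \<longleftrightarrow>
    v extreme_point_of K \<and> w extreme_point_of K \<and> closed_segment v w edge_of K \<and>
    (\<forall>p\<in>K. case d of Counterclockwise \<Rightarrow> turn v w p \<ge> 0 | Clockwise \<Rightarrow> turn v w p \<le> 0)"

end

theory Submission
  imports Defs
begin

text \<open>
  Since \<open>\<Delta>\<close> is an integer, a multiple of the quadratic form splits into two linear factors with
  integer coefficients, and after fixing signs \<open>H\<close> is the set where both factors are positive and
  their product is at least some \<open>N > 0\<close>.  The next edge at \<open>v\<close> points in the extremal direction \<open>f\<close>
  with \<open>v + f\<close> an integer point of \<open>H\<close>.  Keep a basis \<open>f, g\<close> of the lattice with \<open>v + f\<close> inside \<open>H\<close>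
  and \<open>v + g\<close> outside it, such that the wanted direction lies in the cone of \<open>f\<close> and \<open>g\<close>.  If no
  \<open>g + k f\<close> leads into \<open>H\<close>, convexity shows that \<open>f\<close> is the answer; otherwise take the least such
  \<open>k\<close>, replace \<open>g\<close> by \<open>g + (k - 1) f\<close> and \<open>f\<close> by \<open>g + k f\<close>, and push \<open>f\<close> along the new \<open>g\<close> as far as
  \<open>H\<close> permits.  Both step counts are roots of quadratic equations, hence found in constant time.
  An initial basis comes from the Euclidean algorithm.  The coordinates of \<open>f\<close> at least double in
  every round (one of them possibly only after a logarithmic number of rounds), and the smaller
  coordinate of a primitive edge vector is \<open>O(\<surd>N + D)\<close> with \<open>D\<close> the determinant of the two factors,
  wherever \<open>v\<close> lies; this bounds the number of rounds by \<open>O(log(N + D))\<close>.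
\<close>

section \<open>Bounded-time computations of the RAM\<close>

text \<open>The operation count may depend neither on \<open>x0\<close>, \<open>y0\<close> nor on
  \<open>v\<close>, yet the edge vector itself has no bound in terms of \<open>N\<close> and
  \<open>D\<close>: for (x + \<epsilon>)(y + \<epsilon>) \<ge> 1 with small \<epsilon> > 0 the hull
  has an edge from (1, 1) to a point (0, y) with y about 1/\<epsilon>. This is why both coordinates
  of \<open>f\<close> have to grow geometrically while only the smaller one is estimated.

  The doubling rests on the entry count \<open>k\<close> being at least 2, since neither
  \<open>g\<close> nor \<open>g + f\<close> leads into the branch; hence the new \<open>g\<close>
  contains at least one copy of \<open>f\<close>, and the new \<open>f\<close> contains one more.
  The first coordinate is the delicate one. While \<open>g\<close> points backwards there,
  \<open>f\<close> gets shorter in that coordinate. But \<open>f\<close> must keep a positive first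
  coordinate, which forces that of \<open>g\<close> to more than halve in absolute value each round.
  As it starts below \<open>D\<close>, this phase lasts only logarithmically many rounds.\<close>

definition agree :: "nat \<Rightarrow> store \<Rightarrow> store \<Rightarrow> bool" where
  "agree m s t \<longleftrightarrow> (\<forall>i<m. s i = t i)"

text \<open>The result cell \<open>r\<close> is arbitrary from \<open>m\<close> on, so nested
  expressions are evaluated as on a stack: the second operand goes to \<open>Suc r\<close> while
  \<open>r\<close> keeps the first. \<open>P\<close> and \<open>c\<close> are chosen before the
  stores, which makes the cost uniform. The actual store \<open>s'\<close> is compared with
  \<open>s\<close> only below \<open>m\<close>, because evaluations leave garbage above.\<close>

definition computable :: "nat \<Rightarrow> (store \<Rightarrow> real) \<Rightarrow> bool" where
  "computable m e \<longleftrightarrow> (\<forall>r\<ge>m. \<exists>P c. \<forall>s s'. agree m s' s \<longrightarrow>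
     (\<exists>k t. exec P s' k t \<and> k \<le> c \<and> t r = e s \<and> agree r t s'))"

lemma exec_boundedI:
  "exec P s k t \<Longrightarrow> k \<le> c \<Longrightarrow> Q t \<Longrightarrow> \<exists>k t. exec P s k t \<and> k \<le> c \<and> Q t"
  by blast

lemma computableE:
  assumes "computable m e" "m \<le> r"
  obtains P c where "\<And>s s'. agree m s' s \<Longrightarrow>
     \<exists>k t. exec P s' k t \<and> k \<le> c \<and> t r = e s \<and> agree r t s'"
  using assms unfolding computable_def by blast

lemma computable_cell: "i < m \<Longrightarrow> computable m (\<lambda>s. s i)"
  unfolding computable_def
proof (intro allI impI)
  fix r assume "m \<le> r" "i < m"
  then have "\<forall>s s'. agree m s' s \<longrightarrow>
     (\<exists>k t. exec (Instr (Copy r i)) s' k t \<and> k \<le> 1 \<and> t r = s i \<and> agree r t s')"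
    using exec_Instr[of "Copy r i"] by (fastforce simp: agree_def)
  then show "\<exists>P c. \<forall>s s'. agree m s' s \<longrightarrow>
     (\<exists>k t. exec P s' k t \<and> k \<le> c \<and> t r = s i \<and> agree r t s')" by blast
qed

lemma computable_of_int: "computable m (\<lambda>s. of_int z)"
  unfolding computable_def
proof (intro allI impI)
  fix r assume "m \<le> r"
  then have "\<forall>s s'. agree m s' s \<longrightarrow>
     (\<exists>k t. exec (Instr (Const r z)) s' k t \<and> k \<le> 1 \<and> t r = of_int z \<and> agree r t s')"
    using exec_Instr[of "Const r z"] by (fastforce simp: agree_def)
  then show "\<exists>P c. \<forall>s s'. agree m s' s \<longrightarrow>
     (\<exists>k t. exec P s' k t \<and> k \<le> c \<and> t r = of_int z \<and> agree r t s')" by blast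
qed

lemma computable_binop:
  assumes I: "\<And>i j l s. effect (I i j l) s = s(i := g (s j) (s l))"
    and "computable m e" "computable m e'"
  shows "computable m (\<lambda>s. g (e s) (e' s))"
  unfolding computable_def
proof (intro allI impI)
  fix r assume r: "m \<le> r"
  obtain P c where P: "\<And>s s'. agree m s' s \<Longrightarrow>
     \<exists>k t. exec P s' k t \<and> k \<le> c \<and> t r = e s \<and> agree r t s'"
    using computableE[OF assms(2) r] by blast
  obtain P' c' where P': "\<And>s s'. agree m s' s \<Longrightarrow>
     \<exists>k t. exec P' s' k t \<and> k \<le> c' \<and> t (Suc r) = e' s \<and> agree (Suc r) t s'"
    using computableE[OF assms(3), of "Suc r"] r by force
  let ?Q = "Seq P (Seq P' (Instr (I r r (Suc r))))"
  have "\<exists>k t. exec ?Q s' k t \<and> k \<le> c + (c' + 1) \<and> t r = g (e s) (e' s) \<and> agree r t s'"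
    if ag: "agree m s' s" for s s'
  proof -
    obtain k t where 1: "exec P s' k t" "k \<le> c" "t r = e s" "agree r t s'" using P[OF ag] by blast
    have "agree m t s" using ag 1(4) r by (auto simp: agree_def)
    then obtain k' t' where 2: "exec P' t k' t'" "k' \<le> c'" "t' (Suc r) = e' s" "agree (Suc r) t' t"
      using P' by blast
    have E: "exec ?Q s' (k + (k' + 1)) (effect (I r r (Suc r)) t')"
      by (rule exec_Seq[OF 1(1) exec_Seq[OF 2(1) exec_Instr]])
    have "t' r = e s" using 1 2 by (simp add: agree_def)
    then show ?thesis by (intro exec_boundedI[OF E]) (use 1 2 in \<open>auto simp: I agree_def\<close>)
  qed
  then show "\<exists>P c. \<forall>s s'. agree m s' s \<longrightarrow>
     (\<exists>k t. exec P s' k t \<and> k \<le> c \<and> t r = g (e s) (e' s) \<and> agree r t s')" by blast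
qed

lemma computable_floor_sqrt:
  assumes "computable m e"
  shows "computable m (\<lambda>s. of_int \<lfloor>sqrt (e s)\<rfloor>)"
  unfolding computable_def
proof (intro allI impI)
  fix r assume r: "m \<le> r"
  obtain P c where P: "\<And>s s'. agree m s' s \<Longrightarrow>
     \<exists>k t. exec P s' k t \<and> k \<le> c \<and> t r = e s \<and> agree r t s'"
    using computableE[OF assms r] by blast
  let ?Q = "Seq P (Instr (FloorSqrt r r))"
  have "\<exists>k t. exec ?Q s' k t \<and> k \<le> c + 1 \<and> t r = of_int \<lfloor>sqrt (e s)\<rfloor> \<and> agree r t s'"
    if ag: "agree m s' s" for s s'
  proof -
    obtain k t where 1: "exec P s' k t" "k \<le> c" "t r = e s" "agree r t s'" using P[OF ag] by blast
    have E: "exec ?Q s' (k + 1) (effect (FloorSqrt r r) t)"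
      by (rule exec_Seq[OF 1(1) exec_Instr])
    show ?thesis by (intro exec_boundedI[OF E]) (use 1 in \<open>auto simp: agree_def\<close>)
  qed
  then show "\<exists>P c. \<forall>s s'. agree m s' s \<longrightarrow>
     (\<exists>k t. exec P s' k t \<and> k \<le> c \<and> t r = of_int \<lfloor>sqrt (e s)\<rfloor> \<and> agree r t s')" by blast
qed

lemmas computable_add = computable_binop[of Add "(+)", simplified]
lemmas computable_diff = computable_binop[of Sub "(-)", simplified]
lemmas computable_mult = computable_binop[of Mul "(*)", simplified]
lemmas computable_floor_divide = computable_binop[of FloorDiv "\<lambda>x y. of_int \<lfloor>x / y\<rfloor>", simplified]

lemma computable_0: "computable m (\<lambda>s. 0)"
  using computable_of_int[of m 0] by simp

lemma computable_1: "computable m (\<lambda>s. 1)"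
  using computable_of_int[of m 1] by simp

lemma computable_numeral: "computable m (\<lambda>s. numeral n)"
  using computable_of_int[of m "numeral n"] by simp

lemma computable_uminus: "computable m e \<Longrightarrow> computable m (\<lambda>s. - e s)"
  using computable_diff[OF computable_0] by simp

lemma computable_power2: "computable m e \<Longrightarrow> computable m (\<lambda>s. (e s)\<^sup>2)"
  by (simp add: power2_eq_square computable_mult)

text \<open>Characterized by its use in conditionals rather than by a truth value kept in a cell; a
  conjunction is then just a nested conditional.\<close>

definition decidable :: "nat \<Rightarrow> (store \<Rightarrow> bool) \<Rightarrow> bool" where
  "decidable m b \<longleftrightarrow> (\<forall>x y. computable m x \<longrightarrow> computable m y \<longrightarrow>
     computable m (\<lambda>s. if b s then x s else y s))"

lemma decidable_test:
  assumes T: "\<And>i j s. holds (T i j) s \<longleftrightarrow> R (s i) (s j)"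
    and "computable m e" "computable m e'"
  shows "decidable m (\<lambda>s. R (e s) (e' s))"
  unfolding decidable_def computable_def[of m "\<lambda>s. if _ s then _ s else _ s"]
proof (intro allI impI)
  fix x y r assume x: "computable m x" and y: "computable m y" and r: "m \<le> r"
  obtain P c where P: "\<And>s s'. agree m s' s \<Longrightarrow>
     \<exists>k t. exec P s' k t \<and> k \<le> c \<and> t r = e s \<and> agree r t s'"
    using computableE[OF assms(2) r] by blast
  obtain P' c' where P': "\<And>s s'. agree m s' s \<Longrightarrow>
     \<exists>k t. exec P' s' k t \<and> k \<le> c' \<and> t (Suc r) = e' s \<and> agree (Suc r) t s'"
    using computableE[OF assms(3), of "Suc r"] r by force
  obtain X cx where X: "\<And>s s'. agree m s' s \<Longrightarrow>
     \<exists>k t. exec X s' k t \<and> k \<le> cx \<and> t r = x s \<and> agree r t s'"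
    using computableE[OF x r] by blast
  obtain Y cy where Y: "\<And>s s'. agree m s' s \<Longrightarrow>
     \<exists>k t. exec Y s' k t \<and> k \<le> cy \<and> t r = y s \<and> agree r t s'"
    using computableE[OF y r] by blast
  let ?Q = "Seq P (Seq P' (Cond (T r (Suc r)) X Y))"
  have "\<exists>k t. exec ?Q s' k t \<and> k \<le> c + (c' + (1 + (cx + cy)))
      \<and> t r = (if R (e s) (e' s) then x s else y s) \<and> agree r t s'"
    if ag: "agree m s' s" for s s'
  proof -
    obtain k t where 1: "exec P s' k t" "k \<le> c" "t r = e s" "agree r t s'" using P[OF ag] by blast
    have "agree m t s" using ag 1(4) r by (auto simp: agree_def)
    then obtain k' t' where 2: "exec P' t k' t'" "k' \<le> c'" "t' (Suc r) = e' s" "agree (Suc r) t' t"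
      using P' by blast
    have t': "t' r = e s" "agree r t' s'" "agree m t' s"
      using 1 2 ag r by (auto simp: agree_def)
    have "\<exists>k t. exec (Cond (T r (Suc r)) X Y) t' k t \<and> k \<le> 1 + (cx + cy)
      \<and> t r = (if R (e s) (e' s) then x s else y s) \<and> agree r t t'"
    proof (cases "R (e s) (e' s)")
      case True
      then have "holds (T r (Suc r)) t'" using t' 2 T by simp
      then show ?thesis using X[OF t'(3)] True by (fastforce intro!: exec_CondT)
    next
      case False
      then have "\<not> holds (T r (Suc r)) t'" using t' 2 T by simp
      then show ?thesis using Y[OF t'(3)] False by (fastforce intro!: exec_CondF)
    qed
    then obtain k'' t'' where 3: "exec (Cond (T r (Suc r)) X Y) t' k'' t''" "k'' \<le> 1 + (cx + cy)"
      "t'' r = (if R (e s) (e' s) then x s else y s)" "agree r t'' t'" by blast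
    have E: "exec ?Q s' (k + (k' + k'')) t''"
      by (rule exec_Seq[OF 1(1) exec_Seq[OF 2(1) 3(1)]])
    show ?thesis by (intro exec_boundedI[OF E]) (use 1 2 3 t' in \<open>auto simp: agree_def\<close>)
  qed
  then show "\<exists>P c. \<forall>s s'. agree m s' s \<longrightarrow>
     (\<exists>k t. exec P s' k t \<and> k \<le> c \<and> t r = (if R (e s) (e' s) then x s else y s) \<and> agree r t s')"
    by blast
qed

lemmas decidable_less = decidable_test[of LT "(<)", simplified]
lemmas decidable_le = decidable_test[of LE "(\<le>)", simplified]
lemmas decidable_eq = decidable_test[of EQ "(=)", simplified]

lemma computable_if:
  "decidable m b \<Longrightarrow> computable m x \<Longrightarrow> computable m y \<Longrightarrow> computable m (\<lambda>s. if b s then x s else y s)"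
  unfolding decidable_def by blast

lemma decidable_conj:
  assumes "decidable m b" "decidable m b'"
  shows "decidable m (\<lambda>s. b s \<and> b' s)"
proof -
  have "(if b s \<and> b' s then x s else y s) = (if b s then if b' s then x s else y s else y s)"
    for s :: store and x y :: "store \<Rightarrow> real" by simp
  then show ?thesis using assms unfolding decidable_def by simp
qed

lemmas computable_intros = computable_cell computable_0 computable_1 computable_numeral
  computable_add computable_diff computable_mult computable_floor_divide computable_floor_sqrt
  computable_uminus computable_power2 computable_if decidable_less decidable_le decidable_eq
  decidable_conj

section \<open>Simultaneous assignments and loops\<close>

definition stage :: "nat \<Rightarrow> (store \<Rightarrow> store) \<Rightarrow> bool" where
  "stage m F \<longleftrightarrow> (\<forall>i<m. computable m (\<lambda>s. F s i))"

lemma stage_id: "stage m (\<lambda>s. s)"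
  by (simp add: stage_def computable_cell)

lemma stage_upd: "stage m F \<Longrightarrow> computable m e \<Longrightarrow> stage m (\<lambda>s. (F s)(i := e s))"
  unfolding stage_def fun_upd_apply
proof (intro allI impI)
  fix j assume "\<forall>i<m. computable m (\<lambda>s. F s i)" "computable m e" "j < m"
  then show "computable m (\<lambda>s. if j = i then e s else F s j)" by (cases "j = i") auto
qed

lemma stage_if: "decidable m b \<Longrightarrow> stage m F \<Longrightarrow> stage m G \<Longrightarrow> stage m (\<lambda>s. if b s then F s else G s)"
  unfolding stage_def decidable_def by (simp add: if_distrib[of "\<lambda>f. f _"])

lemmas stage_intros = stage_id stage_upd stage_if computable_intros

text \<open>Only the first \<open>m\<close> cells of the abstract states are tracked; the cells
  above are scratch space in which actual and abstract store may differ.\<close>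

definition runs :: "nat \<Rightarrow> prog \<Rightarrow> store \<Rightarrow> nat \<Rightarrow> store \<Rightarrow> bool" where
  "runs m P s K s' \<longleftrightarrow> (\<forall>s0. agree m s0 s \<longrightarrow> (\<exists>k t. exec P s0 k t \<and> k \<le> K \<and> agree m t s'))"

lemma runs_Seq: "runs m P s K s' \<Longrightarrow> runs m Q s' L s'' \<Longrightarrow> runs m (Seq P Q) s (K + L) s''"
  unfolding runs_def by (meson add_mono exec_Seq)

text \<open>All new values must be computed from the old memory. They are therefore collected in the
  cells \<open>m\<close>, ..., \<open>2 * m - 1\<close> and copied down only when all of them are
  known.\<close>

lemma runs_stage:
  assumes "stage m F"
  shows "\<exists>P c. \<forall>s. runs m P s c (F s)"
proof -
  have "\<exists>P c. \<forall>s s'. agree m s' s \<longrightarrow>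
      (\<exists>k t. exec P s' k t \<and> k \<le> c \<and> agree m t s' \<and> (\<forall>i<n. t (m + i) = F s i))"
    if "n \<le> m" for n
    using that
  proof (induction n)
    case 0
    show ?case by (intro exI[of _ Skip] exI[of _ 0]) (force intro: exec_Skip simp: agree_def)
  next
    case (Suc n)
    then obtain P c where P: "\<And>s s'. agree m s' s \<Longrightarrow>
      \<exists>k t. exec P s' k t \<and> k \<le> c \<and> agree m t s' \<and> (\<forall>i<n. t (m + i) = F s i)" by auto
    have "computable m (\<lambda>s. F s n)" using assms Suc.prems by (simp add: stage_def)
    then obtain Q d where Q: "\<And>s s'. agree m s' s \<Longrightarrow>
      \<exists>k t. exec Q s' k t \<and> k \<le> d \<and> t (m + n) = F s n \<and> agree (m + n) t s'"
      using computableE[of m _ "m + n"] by (metis le_add1)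
    have "\<exists>k t. exec (Seq P Q) s' k t \<and> k \<le> c + d \<and> agree m t s' \<and> (\<forall>i<Suc n. t (m + i) = F s i)"
      if ag: "agree m s' s" for s s'
    proof -
      obtain k t where 1: "exec P s' k t" "k \<le> c" "agree m t s'" "\<forall>i<n. t (m + i) = F s i"
        using P[OF ag] by blast
      have "agree m t s" using ag 1 by (simp add: agree_def)
      then obtain k' t' where 2: "exec Q t k' t'" "k' \<le> d" "t' (m + n) = F s n" "agree (m + n) t' t"
        using Q by blast
      have E: "exec (Seq P Q) s' (k + k') t'" by (rule exec_Seq[OF 1(1) 2(1)])
      show ?thesis by (intro exec_boundedI[OF E]) (use 1 2 in \<open>auto simp: agree_def less_Suc_eq\<close>)
    qed
    then show ?case by blast
  qed
  from this[of m] obtain P c where P: "\<And>s s'. agree m s' s \<Longrightarrow>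
      \<exists>k t. exec P s' k t \<and> k \<le> c \<and> agree m t s' \<and> (\<forall>i<m. t (m + i) = F s i)" by auto
  have "\<exists>Q. \<forall>s. \<exists>t. exec Q s n t \<and> (\<forall>i. t i = (if i < n then s (m + i) else s i))"
    if "n \<le> m" for n
    using that
  proof (induction n)
    case 0
    show ?case by (intro exI[of _ Skip]) (auto intro: exec_Skip)
  next
    case (Suc n)
    then obtain Q where Q: "\<And>s. \<exists>t. exec Q s n t \<and> (\<forall>i. t i = (if i < n then s (m + i) else s i))"
      by auto
    have "\<exists>t. exec (Seq Q (Instr (Copy n (m + n)))) s (Suc n) t
        \<and> (\<forall>i. t i = (if i < Suc n then s (m + i) else s i))" for s
    proof -
      obtain t where t: "exec Q s n t" "\<forall>i. t i = (if i < n then s (m + i) else s i)"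
        using Q by blast
      have E: "exec (Seq Q (Instr (Copy n (m + n)))) s (n + 1) (effect (Copy n (m + n)) t)"
        by (rule exec_Seq[OF t(1) exec_Instr])
      show ?thesis by (rule exI, rule conjI[OF E[simplified]]) (use t Suc.prems in \<open>auto simp: less_Suc_eq\<close>)
    qed
    then show ?case by blast
  qed
  from this[of m] obtain Q where Q: "\<And>s. \<exists>t. exec Q s m t \<and> (\<forall>i. t i = (if i < m then s (m + i) else s i))"
    by auto
  have "runs m (Seq P Q) s (c + m) (F s)" for s
    unfolding runs_def
  proof (intro allI impI)
    fix s0 assume "agree m s0 s"
    then obtain k t where 1: "exec P s0 k t" "k \<le> c" "\<forall>i<m. t (m + i) = F s i" using P by blast
    obtain t' where 2: "exec Q t m t'" "\<forall>i. t' i = (if i < m then t (m + i) else t i)" using Q by blast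
    have E: "exec (Seq P Q) s0 (k + m) t'" by (rule exec_Seq[OF 1(1) 2(1)])
    show "\<exists>k t. exec (Seq P Q) s0 k t \<and> k \<le> c + m \<and> agree m t (F s)"
      by (intro exec_boundedI[OF E]) (use 1 2 in \<open>auto simp: agree_def\<close>)
  qed
  then show ?thesis by blast
qed

text \<open>Each of the \<open>n\<close> rounds costs at most \<open>c\<close> plus one test, and
  the failing test at the end costs one more.\<close>

lemma runs_While:
  assumes P: "\<And>s. runs m P s c (F s)" and ij: "i < m" "j < m"
    and "\<And>l. l < n \<Longrightarrow> (F ^^ l) s i \<noteq> (F ^^ l) s j" "(F ^^ n) s i = (F ^^ n) s j"
  shows "runs m (While (NE i j) P) s (Suc n * Suc c) ((F ^^ n) s)"
  using assms(4,5)
proof (induction n arbitrary: s)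
  case 0
  show ?case
    unfolding runs_def
  proof (intro allI impI)
    fix s0 assume s0: "agree m s0 s"
    then have "\<not> holds (NE i j) s0" using 0 ij by (simp add: agree_def)
    from exec_WhileF[OF this] show "\<exists>k t. exec (While (NE i j) P) s0 k t \<and> k \<le> Suc 0 * Suc c \<and> agree m t ((F ^^ 0) s)"
      by (rule exec_boundedI) (use s0 in auto)
  qed
next
  case (Suc n)
  have "runs m (While (NE i j) P) (F s) (Suc n * Suc c) ((F ^^ n) (F s))"
    using Suc.prems(1)[of "Suc _"] Suc.prems(2)
    by (intro Suc.IH) (auto simp: funpow_Suc_right simp del: funpow.simps)
  then have IH: "\<exists>k u. exec (While (NE i j) P) t k u \<and> k \<le> Suc n * Suc c \<and> agree m u ((F ^^ Suc n) s)"
    if "agree m t (F s)" for t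
    using that by (auto simp: runs_def funpow_Suc_right simp del: funpow.simps)
  show ?case
    unfolding runs_def
  proof (intro allI impI)
    fix s0 assume s0: "agree m s0 s"
    then obtain k t where 1: "exec P s0 k t" "k \<le> c" "agree m t (F s)"
      using P[of s] by (auto simp: runs_def)
    obtain l u where 2: "exec (While (NE i j) P) t l u" "l \<le> Suc n * Suc c" "agree m u ((F ^^ Suc n) s)"
      using IH[OF 1(3)] by blast
    have "s i \<noteq> s j" using Suc.prems(1)[of 0] by simp
    then have "holds (NE i j) s0" using s0 ij by (simp add: agree_def)
    from exec_WhileT[OF this 1(1) 2(1)] show "\<exists>k t. exec (While (NE i j) P) s0 k t \<and> k \<le> Suc (Suc n) * Suc c \<and> agree m t ((F ^^ Suc n) s)"
      by (rule exec_boundedI) (use 1 2 in auto)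
  qed
qed

section \<open>Lattice steps across a branch\<close>

text \<open>\<open>U\<close> and \<open>W\<close> are the values of the two linear factors at a base
  point. The opposite signs of \<open>x\<close> and \<open>y\<close> make both coordinates
  nonnegative for a displacement along the boundary in the direction of traversal.\<close>

definition in_branch :: "real \<Rightarrow> real \<Rightarrow> real \<Rightarrow> real \<Rightarrow> real \<Rightarrow> bool" where
  "in_branch N U W x y \<longleftrightarrow> 0 < U + x \<and> 0 < W - y \<and> N \<le> (U + x) * (W - y)"

lemma in_branch_shift: "in_branch N (U + a) (W - b) x y \<longleftrightarrow> in_branch N U W (a + x) (b + y)"
  by (simp add: in_branch_def algebra_simps)

text \<open>Expanding the product on the right leaves the mixed term \<open>a * y + b * x\<close>.
  By the inequality of arithmetic and geometric means it is at least twice the root of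
  \<open>(a * b) * (x * y)\<close>, hence at least \<open>2 * N\<close>, and the three weights then
  add up to 1.\<close>

lemma mult_ge_convex:
  fixes a b x y N t :: real
  assumes "0 < a" "0 < b" "0 < x" "0 < y" "N \<le> a * b" "N \<le> x * y" "0 \<le> t" "t \<le> 1"
  shows "N \<le> ((1 - t) * a + t * x) * ((1 - t) * b + t * y)"
proof (cases "0 < N")
  case False
  have "0 \<le> ((1 - t) * a + t * x) * ((1 - t) * b + t * y)"
    using assms by (intro mult_nonneg_nonneg add_nonneg_nonneg) auto
  then show ?thesis using False by linarith
next
  case True
  have "N\<^sup>2 \<le> (a * b) * (x * y)"
    using assms True by (simp add: power2_eq_square mult_mono)
  moreover have "(a * b) * (x * y) = (a * y) * (b * x)" by simp
  moreover have "4 * ((a * y) * (b * x)) \<le> (a * y + b * x)\<^sup>2"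
    using zero_le_power2[of "a * y - b * x"] by (simp add: power2_eq_square algebra_simps)
  ultimately have "(2 * N)\<^sup>2 \<le> (a * y + b * x)\<^sup>2" by (simp add: power_mult_distrib)
  then have cross: "2 * N \<le> a * y + b * x"
    using assms by (meson add_nonneg_nonneg less_imp_le mult_nonneg_nonneg power2_le_imp_le)
  have "((1 - t) * a + t * x) * ((1 - t) * b + t * y)
      = (1 - t)\<^sup>2 * (a * b) + t\<^sup>2 * (x * y) + (t * (1 - t)) * (a * y + b * x)"
    by (simp add: power2_eq_square algebra_simps)
  moreover have "(1 - t)\<^sup>2 * N \<le> (1 - t)\<^sup>2 * (a * b)" "t\<^sup>2 * N \<le> t\<^sup>2 * (x * y)"
    "(t * (1 - t)) * (2 * N) \<le> (t * (1 - t)) * (a * y + b * x)"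
    using assms cross by (auto intro!: mult_left_mono)
  moreover have "(1 - t)\<^sup>2 * N + t\<^sup>2 * N + (t * (1 - t)) * (2 * N) = N"
    by (simp add: power2_eq_square algebra_simps)
  ultimately show ?thesis by linarith
qed

lemma in_branch_convex:
  assumes "in_branch N U W x y" "in_branch N U W x' y'" "0 \<le> t" "t \<le> 1"
  shows "in_branch N U W ((1 - t) * x + t * x') ((1 - t) * y + t * y')"
proof -
  have eq: "U + ((1 - t) * x + t * x') = (1 - t) * (U + x) + t * (U + x')"
    "W - ((1 - t) * y + t * y') = (1 - t) * (W - y) + t * (W - y')"
    by (simp_all add: algebra_simps)
  have pos: "0 < (1 - t) * a + t * b" if "0 < a" "0 < b" for a b :: real
  proof (cases "t = 0")
    case False
    then show ?thesis using that assms by (intro add_nonneg_pos) auto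
  qed (use that in simp)
  show ?thesis
    unfolding in_branch_def eq
    using assms pos mult_ge_convex by (simp add: in_branch_def)
qed

lemma in_branch_convex3:
  assumes "in_branch N U W 0 0" "in_branch N U W x y" "in_branch N U W x' y'"
    and "0 \<le> p" "0 \<le> q" "p + q \<le> 1"
  shows "in_branch N U W (p * x + q * x') (p * y + q * y')"
proof (cases "p + q = 0")
  case True
  then show ?thesis using assms by (simp add: add_nonneg_eq_0_iff)
next
  case False
  define r where "r = p + q"
  have r: "0 < r" "r \<le> 1" using False assms by (auto simp: r_def)
  have "in_branch N U W ((1 - q / r) * x + (q / r) * x') ((1 - q / r) * y + (q / r) * y')"
    using assms r by (intro in_branch_convex) (auto simp: r_def)
  from in_branch_convex[OF assms(1) this, of r] r
  have "in_branch N U W (r * ((1 - q / r) * x + (q / r) * x')) (r * ((1 - q / r) * y + (q / r) * y'))"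
    by simp
  moreover have "r * ((1 - q / r) * a + (q / r) * b) = p * a + q * b" for a b
  proof -
    have "r * ((1 - q / r) * a + (q / r) * b) = (r - q) * a + q * b" using r by (simp add: field_simps)
    then show ?thesis by (simp add: r_def)
  qed
  ultimately show ?thesis by simp
qed

section \<open>Step counts as roots of quadratic equations\<close>

definition quad_root :: "real \<Rightarrow> real \<Rightarrow> real \<Rightarrow> real \<Rightarrow> real" where
  "quad_root e A B C = (if A = 0 then - C / B else (- B + e * sqrt (B\<^sup>2 - 4 * A * C)) / (2 * A))"

text \<open>What the machine can evaluate in place of \<open>quad_root\<close>. In all uses the
  quadratic is the expansion of \<open>(X + t * a) * (Y - t * b) - N\<close> in \<open>t\<close>,
  and \<open>e\<close> selects one of its two roots.\<close>

definition crossing :: "real \<Rightarrow> real \<Rightarrow> real \<Rightarrow> real \<Rightarrow> real" where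
  "crossing e A B C = (if A = 0 then of_int \<lfloor>- C / B\<rfloor>
     else of_int \<lfloor>(- B + e * of_int \<lfloor>sqrt (B\<^sup>2 - 4 * A * C)\<rfloor>) / (2 * A)\<rfloor>)"

text \<open>A nonzero integer \<open>A\<close> has absolute value at least 1, so division by
  \<open>2 * A\<close> shrinks the rounding error of the square root from below 1 to below 1/2. The
  outer floor then loses less than 1 on one side, which explains the asymmetric interval.\<close>

lemma crossing_near_quad_root:
  assumes "A \<in> \<int>" "e = 1 \<or> e = -1"
  obtains c :: int where "crossing e A B C = of_int c"
    "of_int c - 1 / 2 < quad_root e A B C" "quad_root e A B C < of_int c + 3 / 2"
proof (cases "A = 0")
  case True
  show ?thesis
    using True by (intro that[of "\<lfloor>- C / B\<rfloor>"]) (simp_all add: crossing_def quad_root_def; linarith)+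
next
  case False
  then have A: "1 \<le> \<bar>A\<bar>" using assms(1) by (metis Ints_nonzero_abs_ge1)
  define r where "r = sqrt (B\<^sup>2 - 4 * A * C)"
  define t where "t = (- B + e * of_int \<lfloor>r\<rfloor>) / (2 * A)"
  have "quad_root e A B C - t = e * (r - of_int \<lfloor>r\<rfloor>) / (2 * A)"
    using False by (simp add: quad_root_def t_def r_def field_simps)
  then have "\<bar>quad_root e A B C - t\<bar> = (r - of_int \<lfloor>r\<rfloor>) / (2 * \<bar>A\<bar>)"
    using assms(2) by (auto simp: abs_mult)
  also have "\<dots> < 1 / 2"
  proof -
    have "r - of_int \<lfloor>r\<rfloor> < \<bar>A\<bar>" using A by linarith
    then show ?thesis using A by (simp add: field_simps)
  qed
  finally have *: "\<bar>quad_root e A B C - t\<bar> < 1 / 2" .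
  show ?thesis
  proof (rule that[of "\<lfloor>t\<rfloor>"])
    show "crossing e A B C = of_int \<lfloor>t\<rfloor>" using False by (simp add: crossing_def t_def r_def)
  qed (use * in linarith)+
qed

text \<open>
  The integer square root shifts the root by less than \<open>1 / 2\<close>, so testing the integers next to the
  computed value recovers the exact step count.
\<close>

definition exit_steps :: "real \<Rightarrow> real \<Rightarrow> real \<Rightarrow> real \<Rightarrow> real \<Rightarrow> real" where
  "exit_steps N X Y a b =
    (let c = crossing (-1) (- (a * b)) (Y * a - X * b) (X * Y - N) in
     if in_branch N X Y ((c + 1) * a) ((c + 1) * b) then c + 1
     else if in_branch N X Y (c * a) (c * b) then c else c - 1)"

text \<open>The discriminant does not change when the argument is shifted: it equals
  \<open>q'\<^sup>2 - 4 * A * q\<close> with \<open>q\<close> and \<open>q'\<close> the value and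
  the derivative of the quadratic at \<open>j\<close>. Comparing \<open>j\<close> with a root thus
  becomes a question about the signs of \<open>q\<close> and \<open>q'\<close>. The choice
  \<open>e = -1\<close> gives the smaller root of a convex quadratic (\<open>a < 0\<close>) and the
  larger root of a concave one (\<open>a > 0\<close>), in both cases the point where the ray leaves
  the branch.\<close>

lemma in_branch_iff_le_quad_root:
  fixes a b :: real
  assumes N: "0 < N" and in0: "in_branch N X Y 0 0" and b: "0 < b" and j: "0 \<le> j"
  shows "in_branch N X Y (j * a) (j * b) \<longleftrightarrow> j \<le> quad_root (-1) (- (a * b)) (Y * a - X * b) (X * Y - N)"
proof -
  define A B C where "A = - (a * b)" and "B = Y * a - X * b" and "C = X * Y - N"
  define P R where "P = X + j * a" and "R = Y - j * b"
  define q q' where "q = P * R - N" and "q' = a * R - b * P"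
  define \<tau> where "\<tau> = quad_root (-1) A B C"
  have XY: "0 < X" "0 < Y" "N \<le> X * Y" using in0 by (auto simp: in_branch_def)
  have ins: "in_branch N X Y (j * a) (j * b) \<longleftrightarrow> 0 < P \<and> 0 < R \<and> 0 \<le> q"
    by (auto simp: in_branch_def P_def R_def q_def)
  have disc: "B\<^sup>2 - 4 * A * C = q'\<^sup>2 - 4 * A * q"
    by (simp add: A_def B_def C_def q'_def q_def P_def R_def power2_eq_square algebra_simps)
  have q': "q' = 2 * A * j + B" by (simp add: q'_def A_def B_def P_def R_def algebra_simps)
  have q: "q = A * j\<^sup>2 + B * j + C"
    by (simp add: q_def A_def B_def C_def P_def R_def power2_eq_square algebra_simps)
  have PR: "0 < P \<longleftrightarrow> 0 < R" if "0 \<le> q"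
  proof -
    have "0 < P * R" using that N by (simp add: q_def)
    then show ?thesis by (auto simp: zero_less_mult_iff)
  qed
  consider (z) "a = 0" | (neg) "a < 0" | (pos) "a > 0" by linarith
  then have "in_branch N X Y (j * a) (j * b) \<longleftrightarrow> j \<le> \<tau>"
  proof cases
    case z
    then have A: "A = 0" "B = - (X * b)" "P = X" by (auto simp: A_def B_def P_def)
    have Xb: "0 < X * b" using XY b by simp
    then have \<tau>: "\<tau> = C / (X * b)" using A by (simp add: \<tau>_def quad_root_def)
    have "j \<le> \<tau> \<longleftrightarrow> 0 \<le> q" using Xb \<tau> A by (simp add: q field_simps)
    then show ?thesis using ins PR A XY by auto
  next
    case neg
    then have A: "0 < A" using b by (simp add: A_def mult_neg_pos)
    have "\<tau> = (- B - sqrt (q'\<^sup>2 - 4 * A * q)) / (2 * A)" using A by (simp add: \<tau>_def quad_root_def disc)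
    then have "j \<le> \<tau> \<longleftrightarrow> j * (2 * A) \<le> - B - sqrt (q'\<^sup>2 - 4 * A * q)"
      using A by (simp add: pos_le_divide_eq)
    also have "\<dots> \<longleftrightarrow> sqrt (q'\<^sup>2 - 4 * A * q) \<le> - q'" by (auto simp: q' mult.commute)
    also have "\<dots> \<longleftrightarrow> 0 \<le> q \<and> q' \<le> 0"
    proof
      assume *: "sqrt (q'\<^sup>2 - 4 * A * q) \<le> - q'"
      have "0 \<le> q'\<^sup>2 - 4 * A * q"
      proof -
        have "B\<^sup>2 - 4 * A * C = (Y * a + X * b)\<^sup>2 + 4 * A * N"
          by (simp add: A_def B_def C_def power2_eq_square algebra_simps)
        then show ?thesis using A N disc by simp
      qed
      then have "0 \<le> sqrt (q'\<^sup>2 - 4 * A * q)" by (rule real_sqrt_ge_zero)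
      then have "q' \<le> 0" "q'\<^sup>2 - 4 * A * q \<le> q'\<^sup>2"
        using * sqrt_le_D[OF *] by (linarith, simp)
      then show "0 \<le> q \<and> q' \<le> 0" using A by (simp add: zero_le_mult_iff)
    next
      assume "0 \<le> q \<and> q' \<le> 0"
      then show "sqrt (q'\<^sup>2 - 4 * A * q) \<le> - q'" using A by (intro real_le_lsqrt) auto
    qed
    also have "\<dots> \<longleftrightarrow> 0 < P \<and> 0 < R \<and> 0 \<le> q"
    proof
      assume *: "0 \<le> q \<and> q' \<le> 0"
      \<comment> \<open>\<open>0 \<le> q\<close> holds on the opposite branch too, where
        \<open>P\<close> and \<open>R\<close> are both negative; there \<open>q'\<close> would be
        positive.\<close>
      have "0 < P"
      proof (rule ccontr)
        assume "\<not> 0 < P"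
        then have PR': "P \<le> 0" "R \<le> 0" using * PR by auto
        then have "0 \<le> a * R" "b * P \<le> 0" using neg b
          by (auto simp: mult_nonpos_nonpos mult_nonneg_nonpos)
        then have "a * R = 0" using * unfolding q'_def by linarith
        then have "R = 0" using neg by simp
        then show False using * N by (simp add: q_def)
      qed
      then show "0 < P \<and> 0 < R \<and> 0 \<le> q" using PR * by simp
    next
      assume *: "0 < P \<and> 0 < R \<and> 0 \<le> q"
      then have "a * R < 0" "0 < b * P" using neg b by (auto simp: mult_neg_pos)
      then show "0 \<le> q \<and> q' \<le> 0" using * by (simp add: q'_def)
    qed
    finally show ?thesis using ins by simp
  next
    case pos
    then have A: "A < 0" using b by (simp add: A_def)
    have P: "0 < P" using pos j XY by (simp add: P_def add_pos_nonneg)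
    have "\<tau> = (- B - sqrt (q'\<^sup>2 - 4 * A * q)) / (2 * A)" using A by (simp add: \<tau>_def quad_root_def disc)
    then have "j \<le> \<tau> \<longleftrightarrow> - B - sqrt (q'\<^sup>2 - 4 * A * q) \<le> j * (2 * A)"
      using A by (simp add: neg_le_divide_eq)
    also have "\<dots> \<longleftrightarrow> - q' \<le> sqrt (q'\<^sup>2 - 4 * A * q)" by (auto simp: q' mult.commute)
    also have "\<dots> \<longleftrightarrow> 0 \<le> q"
    proof
      assume *: "- q' \<le> sqrt (q'\<^sup>2 - 4 * A * q)"
      \<comment> \<open>If \<open>q < 0\<close>, the assumption puts \<open>j\<close> on the
        increasing side of the concave quadratic, to the left of its roots. Its value
        \<open>C\<close> at 0 would then be negative as well, although the ray starts in the
        branch.\<close>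
      show "0 \<le> q"
      proof (rule ccontr)
        assume "\<not> 0 \<le> q"
        then have "0 < A * q" using A by (simp add: mult_neg_neg)
        then have "q'\<^sup>2 - 4 * A * q < q'\<^sup>2" by simp
        then have "sqrt (q'\<^sup>2 - 4 * A * q) < \<bar>q'\<bar>" by (metis real_sqrt_abs real_sqrt_less_mono)
        then have "0 < q'" using * by linarith
        then have "0 \<le> j * q'" "A * j\<^sup>2 \<le> 0" using j A by (auto simp: mult_nonpos_nonneg)
        moreover have "C = q - j * q' + A * j\<^sup>2" by (simp add: q q' power2_eq_square algebra_simps)
        ultimately have "C < 0" using \<open>\<not> 0 \<le> q\<close> by linarith
        then show False using XY by (simp add: C_def)
      qed
    next
      assume "0 \<le> q"
      then have "q'\<^sup>2 \<le> q'\<^sup>2 - 4 * A * q" using A by (simp add: mult_nonpos_nonneg)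
      then have "\<bar>q'\<bar> \<le> sqrt (q'\<^sup>2 - 4 * A * q)" by (metis real_sqrt_abs real_sqrt_le_mono)
      then show "- q' \<le> sqrt (q'\<^sup>2 - 4 * A * q)" by linarith
    qed
    finally show ?thesis using ins P PR by auto
  qed
  then show ?thesis by (simp add: \<tau>_def A_def B_def C_def)
qed

lemma exit_steps:
  fixes a b :: int
  assumes N: "0 < N" and in0: "in_branch N X Y 0 0" and b: "0 < b"
  obtains j :: int where "exit_steps N X Y a b = of_int j" "0 \<le> j"
    "in_branch N X Y (of_int (j * a)) (of_int (j * b))"
    "\<not> in_branch N X Y (of_int ((j + 1) * a)) (of_int ((j + 1) * b))"
proof -
  define \<tau> where "\<tau> = quad_root (-1) (- (of_int a * of_int b)) (Y * of_int a - X * of_int b) (X * Y - N)"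
  obtain c :: int where c: "crossing (-1) (- (of_int a * of_int b)) (Y * of_int a - X * of_int b) (X * Y - N) = of_int c"
    "of_int c - 1 / 2 < \<tau>" "\<tau> < of_int c + 3 / 2"
    unfolding \<tau>_def by (rule crossing_near_quad_root[of "- (of_int a * of_int b)" "-1"]) auto
  have iff: "in_branch N X Y (of_int j * of_int a) (of_int j * of_int b) \<longleftrightarrow> of_int j \<le> \<tau>" if "0 \<le> j" for j :: int
    unfolding \<tau>_def by (rule in_branch_iff_le_quad_root[OF N in0]) (use that b in auto)
  have \<tau>0: "0 \<le> \<tau>" using iff[of 0] in0 by simp
  have "exit_steps N X Y a b = (if in_branch N X Y (of_int (c + 1) * of_int a) (of_int (c + 1) * of_int b) then of_int (c + 1)
     else if in_branch N X Y (of_int c * of_int a) (of_int c * of_int b) then of_int c else of_int (c - 1))"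
    by (simp add: exit_steps_def Let_def c(1))
  also have "\<dots> = of_int \<lfloor>\<tau>\<rfloor>"
  proof -
    \<comment> \<open>The root is nonnegative, but its computed approximation may be -1. This value
      is treated separately because the comparison with the root is available for nonnegative counts
      only.\<close>
    have "-1 \<le> c" using \<tau>0 c(3) by linarith
    then consider "c = -1" | "0 \<le> c" by linarith
    then show ?thesis
    proof cases
      case 1
      then have "\<lfloor>\<tau>\<rfloor> = 0" using \<tau>0 c(3) by (simp add: floor_eq_iff)
      then show ?thesis using 1 in0 by simp
    next
      case 2
      have "of_int (c - 1) \<le> \<tau>" "\<tau> < of_int (c + 2)" using c(2,3) by simp_all
      then have "c - 1 \<le> \<lfloor>\<tau>\<rfloor>" "\<lfloor>\<tau>\<rfloor> < c + 2" by (simp_all only: le_floor_iff floor_less_iff)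
      then consider "\<lfloor>\<tau>\<rfloor> = c - 1" | "\<lfloor>\<tau>\<rfloor> = c" | "\<lfloor>\<tau>\<rfloor> = c + 1" by linarith
      moreover have "in_branch N X Y (of_int c * of_int a) (of_int c * of_int b) \<longleftrightarrow> c \<le> \<lfloor>\<tau>\<rfloor>"
        "in_branch N X Y (of_int (c + 1) * of_int a) (of_int (c + 1) * of_int b) \<longleftrightarrow> c + 1 \<le> \<lfloor>\<tau>\<rfloor>"
        using iff[of c] iff[of "c + 1"] 2 by (simp_all only: le_floor_iff)
      ultimately show ?thesis by cases simp_all
    qed
  qed
  finally have eq: "exit_steps N X Y a b = of_int \<lfloor>\<tau>\<rfloor>" .
  show ?thesis
  proof (rule that[OF eq])
    show "0 \<le> \<lfloor>\<tau>\<rfloor>" using \<tau>0 by simp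
    then show "in_branch N X Y (of_int (\<lfloor>\<tau>\<rfloor> * a)) (of_int (\<lfloor>\<tau>\<rfloor> * b))"
      using iff[of "\<lfloor>\<tau>\<rfloor>"] by simp
    show "\<not> in_branch N X Y (of_int ((\<lfloor>\<tau>\<rfloor> + 1) * a)) (of_int ((\<lfloor>\<tau>\<rfloor> + 1) * b))"
      using iff[of "\<lfloor>\<tau>\<rfloor> + 1"] \<open>0 \<le> \<lfloor>\<tau>\<rfloor>\<close> floor_correct[of \<tau>] by (simp add: not_le)
  qed
qed

text \<open>The value 0 encodes that the ray never enters the branch; it cannot be confused with a
  count, since 0 and 1 steps are known to fail where this is applied. The entry count is the root
  rounded up, so by the error bound for \<open>crossing\<close> it is one of \<open>c\<close>,
  \<open>c + 1\<close>, \<open>c + 2\<close>; testing them in increasing order finds the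
  least.\<close>

definition entry_steps :: "real \<Rightarrow> real \<Rightarrow> real \<Rightarrow> real \<Rightarrow> real \<Rightarrow> real" where
  "entry_steps N X Y a b =
    (let c = crossing 1 (- (a * b)) (Y * a - X * b) (X * Y - N) in
     if 2 \<le> c \<and> in_branch N X Y (c * a) (c * b) then c
     else if 2 \<le> c + 1 \<and> in_branch N X Y ((c + 1) * a) ((c + 1) * b) then c + 1
     else if 2 \<le> c + 2 \<and> in_branch N X Y ((c + 2) * a) ((c + 2) * b) then c + 2 else 0)"

text \<open>In a direction with \<open>0 < a\<close> and \<open>0 \<le> b\<close> the quadratic is
  concave or linear, and \<open>e = 1\<close> selects its smaller root. Both factors have the same
  sign wherever the product is positive, so failure at \<open>k - 1\<close>, where the second factor
  is still positive, means a negative value there. The quadratic changes sign between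
  \<open>k - 1\<close> and \<open>k\<close> while increasing.\<close>

lemma quad_root_between:
  fixes a b :: real
  assumes N: "0 < N" and a: "0 < a" and b: "0 \<le> b"
    and k: "in_branch N X Y (k * a) (k * b)" and k1: "\<not> in_branch N X Y ((k - 1) * a) ((k - 1) * b)"
  defines "\<tau> \<equiv> quad_root 1 (- (a * b)) (Y * a - X * b) (X * Y - N)"
  shows "k - 1 < \<tau>" "\<tau> \<le> k"
proof -
  define A B C where "A = - (a * b)" and "B = Y * a - X * b" and "C = X * Y - N"
  define P R where "P j = X + j * a" and "R j = Y - j * b" for j
  define q q' where "q j = P j * R j - N" and "q' j = a * R j - b * P j" for j
  have ins: "in_branch N X Y (j * a) (j * b) \<longleftrightarrow> 0 < P j \<and> 0 < R j \<and> 0 \<le> q j" for j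
    by (auto simp: in_branch_def P_def R_def q_def)
  have disc: "B\<^sup>2 - 4 * A * C = (q' j)\<^sup>2 - 4 * A * q j" for j
    by (simp add: A_def B_def C_def q'_def q_def P_def R_def power2_eq_square algebra_simps)
  have q': "q' j = 2 * A * j + B" for j by (simp add: q'_def A_def B_def P_def R_def algebra_simps)
  have q: "q j = A * j\<^sup>2 + B * j + C" for j
    by (simp add: q_def A_def B_def C_def P_def R_def power2_eq_square algebra_simps)
  have "0 < R k" "0 \<le> q k" using k ins by auto
  moreover have "R (k - 1) = R k + b" by (simp add: R_def algebra_simps)
  ultimately have R1: "0 < R (k - 1)" using b by simp
  have q1: "q (k - 1) < 0"
  proof (rule ccontr)
    assume "\<not> q (k - 1) < 0"
    moreover from this have "0 < P (k - 1) * R (k - 1)" using N by (simp add: q_def)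
    ultimately show False using k1 ins R1 zero_less_mult_pos2 by auto
  qed
  have "k - 1 < \<tau> \<and> \<tau> \<le> k"
  proof (cases "b = 0")
    case True
    then have A: "A = 0" "B = Y * a" "R k = Y" by (auto simp: A_def B_def R_def)
    then have B: "0 < B" using \<open>0 < R k\<close> a by simp
    have "\<tau> = - C / B" using A by (simp add: \<tau>_def quad_root_def A_def B_def C_def)
    moreover have "- C \<le> k * B" "(k - 1) * B < - C"
      using \<open>0 \<le> q k\<close> q1 A(1) by (simp_all add: q algebra_simps)
    ultimately show ?thesis
      using B pos_less_divide_eq[of B "k - 1" "- C"] pos_divide_le_eq[of B "- C" k] by simp
  next
    case False
    then have A: "A < 0" using a b by (simp add: A_def)
    define S where "S = sqrt (B\<^sup>2 - 4 * A * C)"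
    have \<tau>: "\<tau> = (- B + S) / (2 * A)" using A by (simp add: \<tau>_def quad_root_def A_def[symmetric] B_def[symmetric] C_def[symmetric] S_def)
    have "(q' k)\<^sup>2 \<le> B\<^sup>2 - 4 * A * C"
      using A \<open>0 \<le> q k\<close> disc[of k] by (simp add: mult_nonpos_nonneg)
    then have "\<bar>q' k\<bar> \<le> S" unfolding S_def by (metis real_sqrt_abs real_sqrt_le_mono)
    then have "q' k \<le> S" by linarith
    then have "\<tau> \<le> k" using A by (simp add: \<tau> q' neg_divide_le_eq mult.commute)
    have "0 < A * q (k - 1)" using A q1 by (simp add: mult_neg_neg)
    then have "B\<^sup>2 - 4 * A * C < (q' (k - 1))\<^sup>2" using disc[of "k - 1"] by linarith
    then have *: "S < \<bar>q' (k - 1)\<bar>" unfolding S_def by (metis real_sqrt_abs real_sqrt_less_mono)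
    have "q k = q (k - 1) + q' (k - 1) + A"
      by (simp add: q q' power2_eq_square algebra_simps)
    then have "0 < q' (k - 1)" using \<open>0 \<le> q k\<close> q1 A by linarith
    then have "S < q' (k - 1)" using * by linarith
    then have "k - 1 < \<tau>" using A by (simp add: \<tau> q' neg_less_divide_eq mult.commute)
    then show ?thesis using \<open>\<tau> \<le> k\<close> by simp
  qed
  then show "k - 1 < \<tau>" "\<tau> \<le> k" by auto
qed

lemma entry_steps:
  fixes a b :: int
  assumes N: "0 < N" and a: "0 < a" and b: "0 \<le> b"
    and out: "\<not> in_branch N X Y 0 0" "\<not> in_branch N X Y (of_int a) (of_int b)"
  obtains (none) "entry_steps N X Y a b = 0"
      "\<And>k::int. 0 \<le> k \<Longrightarrow> \<not> in_branch N X Y (of_int (k * a)) (of_int (k * b))"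
  | (some) k :: int where "entry_steps N X Y a b = of_int k" "2 \<le> k"
      "in_branch N X Y (of_int (k * a)) (of_int (k * b))"
      "\<not> in_branch N X Y (of_int ((k - 1) * a)) (of_int ((k - 1) * b))"
proof (cases "\<exists>k::int. 0 \<le> k \<and> in_branch N X Y (of_int (k * a)) (of_int (k * b))")
  case False
  then have "entry_steps N X Y a b = 0"
  proof -
    obtain c :: int where c: "crossing 1 (- (of_int a * of_int b)) (Y * of_int a - X * of_int b) (X * Y - N) = of_int c"
      by (rule crossing_near_quad_root[of "- (of_int a * of_int b)" "1"]) auto
    \<comment> \<open>A successful test would itself exhibit a step count, so nothing has to be
      known about the roots when the ray misses the branch.\<close>
    have "\<not> (2 \<le> c + i \<and> in_branch N X Y ((of_int c + of_int i) * of_int a) ((of_int c + of_int i) * of_int b))" for i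
      using False[simplified, rule_format, of "c + i"] by auto
    from this[of 0] this[of 1] this[of 2] show ?thesis
      by (auto simp: entry_steps_def Let_def c(1))
  qed
  then show ?thesis using False none by blast
next
  case True
  define I where "I k \<longleftrightarrow> in_branch N X Y (of_int (k * a)) (of_int (k * b))" for k :: int
  obtain n :: nat where n: "I (int n)" using True nonneg_int_cases by (metis I_def)
  define m where "m = (LEAST n. I (int n))"
  have m: "I (int m)" "\<And>i. i < m \<Longrightarrow> \<not> I (int i)"
    unfolding m_def using LeastI[of "\<lambda>n. I (int n)", OF n] not_less_Least[of _ "\<lambda>n. I (int n)"] by auto
  have "\<not> I 0" "\<not> I 1" using out by (auto simp: I_def)
  then have m2: "2 \<le> m" using m(1) by (metis One_nat_def less_2_cases not_less of_nat_0 of_nat_1)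
  define k where "k = int m"
  have k: "I k" "\<not> I (k - 1)" "2 \<le> k" using m m2 m(2)[of "m - 1"] by (auto simp: k_def)
  have least: "\<not> (2 \<le> i \<and> I i)" if "i < k" for i
  proof
    assume "2 \<le> i \<and> I i"
    then show False using m(2)[of "nat i"] that by (simp add: k_def nat_less_iff)
  qed
  define \<tau> where "\<tau> = quad_root 1 (- (of_int a * of_int b)) (Y * of_int a - X * of_int b) (X * Y - N)"
  have \<tau>: "of_int k - 1 < \<tau>" "\<tau> \<le> of_int k"
    unfolding \<tau>_def using k a b quad_root_between[OF N, of "of_int a" "of_int b" X Y "of_int k"]
    by (simp_all add: I_def)
  obtain c :: int where c: "crossing 1 (- (of_int a * of_int b)) (Y * of_int a - X * of_int b) (X * Y - N) = of_int c"
    "of_int c - 1 / 2 < \<tau>" "\<tau> < of_int c + 3 / 2"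
    unfolding \<tau>_def by (rule crossing_near_quad_root[of "- (of_int a * of_int b)" "1"]) auto
  have "entry_steps N X Y a b = (if 2 \<le> c \<and> I c then of_int c else if 2 \<le> c + 1 \<and> I (c + 1) then of_int (c + 1)
     else if 2 \<le> c + 2 \<and> I (c + 2) then of_int (c + 2) else 0)"
    by (auto simp: entry_steps_def Let_def c(1) I_def)
  also have "\<dots> = of_int k"
  proof -
    have "c \<le> k" "k \<le> c + 2" using \<tau> c(2,3) by linarith+
    then consider "k = c" | "k = c + 1" | "k = c + 2" by linarith
    then show ?thesis using k least[of c] least[of "c + 1"] by cases auto
  qed
  finally have "entry_steps N X Y a b = of_int k" .
  then show ?thesis using k unfolding I_def by - (rule some[of k])
qed

lemma decidable_in_branch:
  assumes "computable m N" "computable m U" "computable m W" "computable m x" "computable m y"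
  shows "decidable m (\<lambda>s. in_branch (N s) (U s) (W s) (x s) (y s))"
  unfolding in_branch_def by (intro computable_intros assms)

lemma computable_crossing:
  assumes "computable m e" "computable m A" "computable m B" "computable m C"
  shows "computable m (\<lambda>s. crossing (e s) (A s) (B s) (C s))"
  unfolding crossing_def by (intro computable_intros assms)

lemma computable_exit_steps:
  assumes "computable m N" "computable m X" "computable m Y" "computable m a" "computable m b"
  shows "computable m (\<lambda>s. exit_steps (N s) (X s) (Y s) (a s) (b s))"
  unfolding exit_steps_def Let_def
  by (intro computable_intros decidable_in_branch computable_crossing assms)

lemma computable_entry_steps:
  assumes "computable m N" "computable m X" "computable m Y" "computable m a" "computable m b"
  shows "computable m (\<lambda>s. entry_steps (N s) (X s) (Y s) (a s) (b s))"
  unfolding entry_steps_def Let_def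
  by (intro computable_intros decidable_in_branch computable_crossing assms)

section \<open>Search for the edge direction\<close>

definition lattice_span :: "int \<Rightarrow> int \<Rightarrow> int \<Rightarrow> int \<Rightarrow> (int \<times> int) set" where
  "lattice_span fu fd gu gd = {(i * fu + j * gu, i * fd + j * gd) | i j. True}"

lemma lattice_span_iff:
  "(x, y) \<in> lattice_span fu fd gu gd \<longleftrightarrow> (\<exists>i j. x = i * fu + j * gu \<and> y = i * fd + j * gd)"
  by (auto simp: lattice_span_def)

lemma lattice_span_add_right: "lattice_span fu fd (gu + k * fu) (gd + k * fd) = lattice_span fu fd gu gd"
proof -
  have "(x, y) \<in> lattice_span fu fd (gu + k * fu) (gd + k * fd) \<longleftrightarrow> (x, y) \<in> lattice_span fu fd gu gd" for x y
  proof
    assume "(x, y) \<in> lattice_span fu fd (gu + k * fu) (gd + k * fd)"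
    then obtain i j where "x = i * fu + j * (gu + k * fu)" "y = i * fd + j * (gd + k * fd)"
      by (auto simp: lattice_span_iff)
    then have "x = (i + j * k) * fu + j * gu" "y = (i + j * k) * fd + j * gd"
      by (simp_all add: algebra_simps)
    then show "(x, y) \<in> lattice_span fu fd gu gd" unfolding lattice_span_iff by blast
  next
    assume "(x, y) \<in> lattice_span fu fd gu gd"
    then obtain i j where "x = i * fu + j * gu" "y = i * fd + j * gd"
      by (auto simp: lattice_span_iff)
    then have "x = (i - j * k) * fu + j * (gu + k * fu)" "y = (i - j * k) * fd + j * (gd + k * fd)"
      by (simp_all add: algebra_simps)
    then show "(x, y) \<in> lattice_span fu fd (gu + k * fu) (gd + k * fd)" unfolding lattice_span_iff by blast
  qed
  then show ?thesis by auto
qed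

lemma lattice_span_swap: "lattice_span gu gd fu fd = lattice_span fu fd gu gd"
  unfolding lattice_span_def by (subst ex_comm) (simp add: add.commute)

lemma lattice_span_add_left: "lattice_span (fu + k * gu) (fd + k * gd) gu gd = lattice_span fu fd gu gd"
  using lattice_span_add_right[of gu gd fu k fd] by (simp add: lattice_span_swap)

lemma lattice_span_minus_right: "lattice_span fu fd (- gu) (- gd) = lattice_span fu fd gu gd"
proof -
  have "(x, y) \<in> lattice_span fu fd (- gu) (- gd) \<longleftrightarrow> (x, y) \<in> lattice_span fu fd gu gd" for x y
    unfolding lattice_span_iff by (metis minus_mult_commute minus_minus)
  then show ?thesis by auto
qed

lemma lattice_span_minus_left: "lattice_span (- fu) (- fd) gu gd = lattice_span fu fd gu gd"
  using lattice_span_minus_right[of gu gd fu fd] by (simp add: lattice_span_swap)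

lemma lattice_span_diff:
  assumes "(x, y) \<in> lattice_span fu fd gu gd" "(x', y') \<in> lattice_span fu fd gu gd"
  shows "(x - x', y - y') \<in> lattice_span fu fd gu gd"
proof -
  obtain i j i' j' where "x = i * fu + j * gu" "y = i * fd + j * gd" "x' = i' * fu + j' * gu" "y' = i' * fd + j' * gd"
    using assms by (auto simp: lattice_span_iff)
  then have "x - x' = (i - i') * fu + (j - j') * gu" "y - y' = (i - i') * fd + (j - j') * gd"
    by (simp_all add: algebra_simps)
  then show ?thesis unfolding lattice_span_iff by blast
qed

text \<open>Cramer's rule. It supplies the lattice points on both coordinate axes that are used to
  shift points of the branch.\<close>

lemma lattice_span_det:
  fixes fu fd gu gd i j :: int
  defines "D \<equiv> fu * gd - fd * gu"
  shows "(i * D, j * D) \<in> lattice_span fu fd gu gd"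
proof -
  have "i * D = (i * gd - j * gu) * fu + (j * fu - i * fd) * gu"
    "j * D = (i * gd - j * gu) * fd + (j * fu - i * fd) * gd"
    by (simp_all add: D_def algebra_simps)
  then show ?thesis unfolding lattice_span_iff by blast
qed

lemma not_in_branchD:
  assumes "\<not> in_branch N U W x y" "0 < N" "0 < U + x \<or> 0 < W - y"
  shows "(U + x) * (W - y) < N"
proof (rule ccontr)
  assume "\<not> (U + x) * (W - y) < N"
  moreover from this have "0 < (U + x) * (W - y)" using assms(2) by linarith
  ultimately show False using assms(1,3) unfolding in_branch_def zero_less_mult_iff by auto
qed

text \<open>
  Displacements from the vertex \<open>v\<close> are written in the coordinates \<open>(u, d)\<close>, where \<open>u\<close> is the
  increase of the first linear factor and \<open>d\<close> the decrease of the second one; \<open>\<Lambda>\<close> is the image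
  of \<open>\<int>\<^sup>2\<close>.
\<close>

locale branch_search =
  fixes N U W :: real and \<Lambda> :: "(int \<times> int) set"
  assumes N: "0 < N" and in0: "in_branch N U W 0 0"
    and vertex: "(x, y) \<in> \<Lambda> \<Longrightarrow> in_branch N U W (of_int x) (of_int y) \<Longrightarrow> 0 < y \<Longrightarrow> 0 < x"
begin

abbreviation ins :: "int \<Rightarrow> int \<Rightarrow> bool" where
  "ins x y \<equiv> in_branch N U W (of_int x) (of_int y)"

lemma ins_between:
  assumes "ins (p + i * x) (q + i * y)" "ins (p + k * x) (q + k * y)" "i \<le> m" "m \<le> k"
  shows "ins (p + m * x) (q + m * y)"
proof (cases "i = k")
  case True
  then show ?thesis using assms by auto
next
  case False
  define t :: real where "t = (of_int m - of_int i) / (of_int k - of_int i)"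
  have t: "0 \<le> t" "t \<le> 1" "t * (of_int k - of_int i) = of_int m - of_int i"
    using False assms(3,4) by (auto simp: t_def field_simps)
  have "(1 - t) * of_int (p + i * x) + t * of_int (p + k * x) = of_int (p + m * x)" for p x
  proof -
    have "(1 - t) * of_int (p + i * x) + t * of_int (p + k * x)
        = of_int p + of_int i * of_int x + (t * (of_int k - of_int i)) * of_int x"
      by (simp add: algebra_simps)
    also have "\<dots> = of_int (p + m * x)" unfolding t(3) by (simp add: algebra_simps)
    finally show ?thesis .
  qed
  then show ?thesis using in_branch_convex[OF assms(1,2) t(1,2)] by simp
qed

text \<open>
  The triangle spanned by \<open>0\<close>, \<open>f\<close> and \<open>i f + j g\<close> cuts the line \<open>g + \<real> f\<close> in a segment of
  length \<open>1 - 1 / j\<close> starting at \<open>i / j\<close>, which always contains a lattice point.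
\<close>

lemma ins_slice:
  assumes f: "ins fu fd" and p: "ins (i * fu + j * gu) (i * fd + j * gd)" and j: "1 \<le> j"
  defines "m \<equiv> - ((- i) div j)"
  shows "ins (gu + m * fu) (gd + m * fd)"
proof -
  have "(- i) div j * j + (- i) mod j = - i" "0 \<le> (- i) mod j" "(- i) mod j < j" using j by auto
  moreover have "m * j = - ((- i) div j * j)" by (simp add: m_def)
  ultimately have mj: "i \<le> m * j" "m * j + 1 \<le> i + j" by linarith+
  define r :: real where "r = of_int m - of_int i / of_int j"
  have j0: "0 < (of_int j :: real)" using j by simp
  have "of_int i \<le> of_int m * (of_int j :: real)" "of_int m * of_int j + 1 \<le> of_int i + (of_int j :: real)"
    using mj by (metis of_int_le_iff of_int_mult, metis of_int_le_iff of_int_mult of_int_add of_int_1)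
  then have r: "0 \<le> r" "r + 1 / of_int j \<le> 1" using j0 by (simp_all add: r_def field_simps)
  have "r * of_int x + (1 / of_int j) * of_int (i * x + j * y) = of_int (y + m * x)" for x y
    using j0 by (simp add: r_def field_simps)
  then show ?thesis using in_branch_convex3[OF in0 f p r(1) _ r(2)] j0 by simp
qed

text \<open>
  The last conjunct says that a lattice point of the branch which lies below \<open>v\<close> and strictly to
  the right of \<open>f\<close> lies in the cone spanned by \<open>f\<close> and \<open>g\<close>.
\<close>

definition pre_invar :: "int \<Rightarrow> int \<Rightarrow> int \<Rightarrow> int \<Rightarrow> int \<Rightarrow> bool" where
  "pre_invar D fu fd gu gd \<longleftrightarrow> lattice_span fu fd gu gd = \<Lambda> \<and> fu * gd - fd * gu = D \<and> 0 < D \<and>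
     0 < fu \<and> 0 \<le> fd \<and> 0 < gd \<and> ins fu fd \<and> \<not> ins gu gd \<and>
     (\<forall>i j. i < 0 \<longrightarrow> 1 \<le> j \<longrightarrow> 0 < i * fd + j * gd \<longrightarrow> \<not> ins (i * fu + j * gu) (i * fd + j * gd))"

text \<open>The extra condition says that \<open>f\<close> cannot be pushed further along
  \<open>g\<close>. Together with \<open>\<not> ins gu gd\<close> it excludes the entry counts 0 and
  1.\<close>

definition invar :: "int \<Rightarrow> int \<Rightarrow> int \<Rightarrow> int \<Rightarrow> int \<Rightarrow> bool" where
  "invar D fu fd gu gd \<longleftrightarrow> pre_invar D fu fd gu gd \<and> \<not> ins (fu + gu) (fd + gd)"

text \<open>Moving along the axis \<open>d = 0\<close> never leaves the branch. With
  \<open>gu \<le> 0\<close>, the points excluded by the cone condition would have a negative first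
  and a positive second coordinate, and \<open>vertex\<close> rules these out.\<close>

lemma pre_invar_init:
  assumes "lattice_span fu 0 gu gd = \<Lambda>" "0 < fu" "gu \<le> 0" "0 < gd"
  shows "pre_invar (fu * gd) fu 0 gu gd"
proof -
  have in_\<Lambda>: "(i * fu + j * gu, i * 0 + j * gd) \<in> \<Lambda>" for i j
    unfolding assms(1)[symmetric] lattice_span_iff by blast
  have "ins fu 0"
  proof -
    have "0 \<le> W * of_int fu" using in0 assms by (simp add: in_branch_def)
    then have "U * W \<le> (U + of_int fu) * W" by (simp add: algebra_simps)
    moreover have "N \<le> U * W" using in0 by (simp add: in_branch_def)
    ultimately have "N \<le> (U + of_int fu) * W" by linarith
    then show ?thesis using in0 assms by (simp add: in_branch_def)
  qed
  moreover have "\<not> ins gu gd" using vertex[OF in_\<Lambda>[of 0 1]] assms by auto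
  moreover have "\<not> ins (i * fu + j * gu) (i * 0 + j * gd)" if "i < 0" "1 \<le> j" for i j
  proof
    assume *: "ins (i * fu + j * gu) (i * 0 + j * gd)"
    have "i * fu < 0" "j * gu \<le> 0" "0 < j * gd"
      using that assms by (auto simp: mult_neg_pos mult_nonneg_nonpos)
    then show False using vertex[OF in_\<Lambda> *] by linarith
  qed
  ultimately show ?thesis using assms by (auto simp: pre_invar_def)
qed

text \<open>A point with coordinates \<open>i\<close>, \<open>l\<close> in the new basis has
  coordinates \<open>i\<close>, \<open>i * j + l\<close> in the old one. For \<open>i < 0\<close> a
  positive second component forces \<open>1 \<le> i * j + l\<close>, so the old cone condition
  applies.\<close>

lemma invar_advance_f:
  assumes I: "pre_invar D fu fd gu gd" and j: "0 \<le> j"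
    and "ins (fu + j * gu) (fd + j * gd)" "\<not> ins (fu + (j + 1) * gu) (fd + (j + 1) * gd)"
  shows "invar D (fu + j * gu) (fd + j * gd) gu gd"
proof -
  have \<Lambda>: "lattice_span (fu + j * gu) (fd + j * gd) gu gd = \<Lambda>"
    using I by (simp add: pre_invar_def lattice_span_add_left)
  have nonneg: "0 \<le> fd" "0 < gd" "0 < fu" using I by (auto simp: pre_invar_def)
  have fd: "0 \<le> fd + j * gd" using nonneg j by simp
  have fu: "0 < fu + j * gu"
  proof (cases "j = 0")
    case False
    then have "0 < fd + j * gd" using nonneg j by (simp add: add_nonneg_pos)
    moreover have "(fu + j * gu, fd + j * gd) \<in> \<Lambda>"
      using \<Lambda> lattice_span_iff[of "fu + j * gu" "fd + j * gd"] by (metis add.right_neutral mult_1 mult_zero_left)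
    ultimately show ?thesis using vertex assms(3) by blast
  qed (use nonneg in simp)
  have "\<not> ins (i * (fu + j * gu) + l * gu) (i * (fd + j * gd) + l * gd)"
    if "i < 0" "1 \<le> l" "0 < i * (fd + j * gd) + l * gd" for i l
  proof -
    have eq: "i * (x + j * y) + l * y = i * x + (i * j + l) * y" for x y by (simp add: algebra_simps)
    have "1 \<le> i * j + l"
    proof (rule ccontr)
      assume "\<not> 1 \<le> i * j + l"
      then have "(i * j + l) * gd \<le> 0" "i * fd \<le> 0" using nonneg that
        by (auto simp: mult_nonpos_nonneg)
      then show False using that(3) unfolding eq by linarith
    qed
    then show ?thesis using I that unfolding eq pre_invar_def by blast
  qed
  moreover have "(fu + j * gu) * gd - (fd + j * gd) * gu = fu * gd - fd * gu" by (simp add: algebra_simps)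
  moreover have "\<not> ins (fu + j * gu + gu) (fd + j * gd + gd)" using assms(4) by (simp add: algebra_simps)
  ultimately show ?thesis
    using I assms(3) \<Lambda> fd fu unfolding invar_def pre_invar_def by blast
qed

text \<open>A point violating the new cone condition equals \<open>(i + J * (k - 1)) f + J g\<close>
  in the old basis, with \<open>i < 0\<close> and \<open>J = i + j \<ge> 1\<close>. Slicing its
  triangle yields some \<open>g + m f\<close> in the branch with \<open>m \<le> k - 1\<close>. By
  convexity with \<open>g + k f\<close>, the point \<open>g + (k - 1) f\<close> would lie in the
  branch as well, contrary to the choice of \<open>k\<close>.\<close>

lemma pre_invar_advance_g:
  assumes I: "invar D fu fd gu gd" and k: "2 \<le> k"
    and in_k: "ins (gu + k * fu) (gd + k * fd)" and out: "\<not> ins (gu + (k - 1) * fu) (gd + (k - 1) * fd)"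
  defines "gu' \<equiv> gu + (k - 1) * fu" and "gd' \<equiv> gd + (k - 1) * fd"
  shows "pre_invar D (fu + gu') (fd + gd') gu' gd'"
proof -
  have eq: "fu + gu' = gu + k * fu" "fd + gd' = gd + k * fd"
    by (simp_all add: gu'_def gd'_def algebra_simps)
  have nonneg: "0 \<le> fd" "0 < gd" "0 < fu" "ins fu fd" using I by (auto simp: invar_def pre_invar_def)
  have gd': "0 < gd'" using nonneg k by (simp add: gd'_def add_pos_nonneg)
  have \<Lambda>: "lattice_span (fu + gu') (fd + gd') gu' gd' = \<Lambda>"
    using I lattice_span_add_left[of fu 1 gu' fd gd'] by (simp add: gu'_def gd'_def lattice_span_add_right invar_def pre_invar_def)
  have fu: "0 < fu + gu'"
  proof -
    have "(fu + gu', fd + gd') \<in> \<Lambda>"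
      using \<Lambda> lattice_span_iff[of "fu + gu'" "fd + gd'"] by (metis add.right_neutral mult_1 mult_zero_left)
    then show ?thesis using vertex in_k nonneg gd' unfolding eq[symmetric] by (metis add_nonneg_pos)
  qed
  have "\<not> ins (i * (fu + gu') + j * gu') (i * (fd + gd') + j * gd')"
    if "i < 0" "1 \<le> j" "0 < i * (fd + gd') + j * gd'" for i j
  proof
    assume ins: "ins (i * (fu + gu') + j * gu') (i * (fd + gd') + j * gd')"
    define J where "J = i + j"
    have *: "i * (x + (y + (k - 1) * x)) + j * (y + (k - 1) * x) = (i + J * (k - 1)) * x + J * y" for x y
      by (simp add: J_def algebra_simps)
    have J: "1 \<le> J"
    proof (rule ccontr)
      assume J: "\<not> 1 \<le> J"
      have "J * gd' \<le> 0" "i * fd \<le> 0" using J gd' that nonneg by (auto simp: mult_nonpos_nonneg)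
      moreover have "i * (fd + gd') + j * gd' = i * fd + J * gd'" by (simp add: J_def algebra_simps)
      ultimately show False using that by linarith
    qed
    define m where "m = - ((- (i + J * (k - 1))) div J)"
    have in_m: "ins (gu + m * fu) (gd + m * fd)"
      unfolding m_def using ins J unfolding gu'_def gd'_def * by (intro ins_slice nonneg)
    have "m \<le> k - 1"
    proof -
      have "- (i + J * (k - 1)) = - i + (1 - k) * J" by (simp add: algebra_simps)
      moreover have "(- i + (1 - k) * J) div J = (1 - k) + (- i) div J" using J by (intro div_mult_self1) auto
      ultimately have "(- (i + J * (k - 1))) div J = (1 - k) + (- i) div J" by (simp only:)
      moreover have "0 \<le> (- i) div J" using that J by (simp add: pos_imp_zdiv_nonneg_iff)
      ultimately show ?thesis by (simp add: m_def)
    qed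
    from ins_between[OF in_m in_k this] show False using out by simp
  qed
  moreover have "(fu + gu') * gd' - (fd + gd') * gu' = fu * gd - fd * gu"
    by (simp add: gu'_def gd'_def algebra_simps)
  then have "(fu + gu') * gd' - (fd + gd') * gu' = D" "0 < D"
    using I by (simp_all only: invar_def pre_invar_def)
  moreover have "ins (fu + gu') (fd + gd')" unfolding eq by (rule in_k)
  moreover have "\<not> ins gu' gd'" unfolding gu'_def gd'_def by (rule out)
  moreover have "0 \<le> fd + gd'" using nonneg gd' by simp
  ultimately show ?thesis using \<Lambda> fu gd' unfolding pre_invar_def by blast
qed

text \<open>A point with coefficient \<open>j \<ge> 1\<close> of \<open>g\<close> would have
  \<open>i \<ge> 0\<close> by the cone condition, and its slice would be some \<open>g + k f\<close>
  with \<open>k \<ge> 0\<close> in the branch. So \<open>j \<le> 0\<close>, and \<open>j\<close>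
  times the determinant is exactly the difference of the two sides.\<close>

lemma right_of_terminal:
  assumes I: "invar D fu fd gu gd" and none: "\<And>k. 0 \<le> k \<Longrightarrow> \<not> ins (gu + k * fu) (gd + k * fd)"
    and "(x, y) \<in> \<Lambda>" "ins x y" "0 < y"
  shows "fu * y \<le> fd * x"
proof -
  obtain i j where ij: "x = i * fu + j * gu" "y = i * fd + j * gd"
    using I assms(3) by (auto simp: invar_def pre_invar_def lattice_span_iff)
  have "\<not> 1 \<le> j"
  proof
    assume j: "1 \<le> j"
    then have "0 \<le> i" using I assms(4,5) unfolding ij invar_def pre_invar_def by (meson not_le)
    then have "0 \<le> - ((- i) div j)" using j by (simp add: div_nonpos_pos_le0)
    moreover have "ins fu fd" using I by (simp add: invar_def pre_invar_def)
    ultimately show False using none ins_slice[of fu fd i j gu gd] assms(4) j unfolding ij by blast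
  qed
  then have "j * (fu * gd - fd * gu) \<le> 0" using I by (simp add: invar_def pre_invar_def mult_nonpos_nonneg)
  moreover have "fu * y - fd * x = j * (fu * gd - fd * gu)" by (simp add: ij algebra_simps)
  ultimately show ?thesis by linarith
qed

text \<open>
  An edge that is long in both coordinates would allow shifting one of its end points by multiples
  of \<open>(D, 0)\<close> and \<open>(0, D)\<close> to a lattice point of the branch on the wrong side of the edge.
\<close>

lemma min_coordinate_bound:
  fixes p q D :: int
  assumes D: "0 < D" and \<Lambda>D: "\<And>i j. (i * D, j * D) \<in> \<Lambda>" and f: "(p, q) \<in> \<Lambda>" "ins p q" "0 < p" "0 < q"
    and diff: "\<And>x y x' y'. (x, y) \<in> \<Lambda> \<Longrightarrow> (x', y') \<in> \<Lambda> \<Longrightarrow> (x - x', y - y') \<in> \<Lambda>"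
    and right: "\<And>x y. (x, y) \<in> \<Lambda> \<Longrightarrow> ins x y \<Longrightarrow> 0 < y \<Longrightarrow> p * y \<le> q * x"
  shows "(of_int (min p q))\<^sup>2 \<le> 16 * (of_int D)\<^sup>2 + 6 * N"
proof -
  \<comment> \<open>For \<open>d \<le> b / 4\<close> the hypotheses give
    \<open>3/16 * b\<^sup>2 \<le> N\<close>, hence \<open>b\<^sup>2 \<le> 16/3 * N\<close>; the
    constant 6 rounds this up.\<close>
  have key: "b\<^sup>2 \<le> 6 * N" if "4 * d \<le> b" "b < 2 * (w + d)" "b \<le> a" "(a - d) * w < N" "0 < d" for a b d w :: real
  proof -
    have "b / 4 \<le> w" "3 / 4 * b \<le> a - d" "0 < b" using that(1-3,5) by (simp_all add: field_simps)
    then have "(3 / 4 * b) * (b / 4) \<le> (a - d) * w" by (intro mult_mono) auto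
    then have "3 / 16 * b\<^sup>2 \<le> N" using that by (simp add: power2_eq_square)
    then show ?thesis using zero_le_power2[of b] by linarith
  qed
  have UW: "0 < U" "0 < W" "N \<le> U * W" using in0 by (auto simp: in_branch_def)
  define u w :: real where "u = U + of_int p" and "w = W - of_int q"
  have uw: "0 < u" "0 < w" "N \<le> u * w" using f(2) by (auto simp: in_branch_def u_def w_def)
  define d :: real where "d = of_int D"
  have d: "0 < d" using D by (simp add: d_def)
  have cross: "a * e < k * b * e + k * e\<^sup>2 \<Longrightarrow> 0 < e \<Longrightarrow> a < k * (b + e)" for a b e k :: real
    by (metis distrib_left mult.assoc mult.commute mult_less_cancel_right_pos power2_eq_square)
  show ?thesis
  \<comment> \<open>Short edges account for the summand \<open>16 * D\<^sup>2\<close>; the remaining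
    ones satisfy the first hypothesis of \<open>key\<close>.\<close>
  proof (cases "min p q < 4 * D")
    case True
    then have "(of_int (min p q) :: real)\<^sup>2 \<le> (4 * d)\<^sup>2" using f(3,4)
      by (intro power_mono) (auto simp: d_def)
    then show ?thesis using N by (simp add: power_mult_distrib d_def)
  next
    case False
    show ?thesis
    proof (cases "q \<le> p")
      case True
      \<comment> \<open>The least multiplier with \<open>p < i * q\<close>: subtracting
        \<open>(i * D, D)\<close> from the far end \<open>(p, q)\<close> tips it to the forbidden
        side of the edge.\<close>
      define i where "i = p div q + 1"
      have "p div q * q + p mod q = p" "0 \<le> p mod q" "p mod q < q" using f by auto
      moreover have "i * q = p div q * q + q" by (simp add: i_def algebra_simps)
      ultimately have i: "p < i * q" "i * q \<le> 2 * p" using True by linarith+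
      have q: "4 * D \<le> q" using False True by auto
      have "\<not> ins (p - i * D) (q - D)"
      proof
        assume "ins (p - i * D) (q - D)"
        moreover have "(p - i * D, q - D) \<in> \<Lambda>" using diff[OF f(1) \<Lambda>D[of i 1]] by simp
        ultimately have "p * (q - D) \<le> q * (p - i * D)" using right q D by auto
        then have "D * (i * q - p) \<le> 0" by (simp add: algebra_simps)
        then show False using D i by (simp add: mult_le_0_iff)
      qed
      then have "(u - of_int i * d) * (w + d) < N"
        using not_in_branchD[OF _ N, of U W "of_int (p - i * D)" "of_int (q - D)"] uw d
        by (simp add: u_def w_def d_def algebra_simps)
      then have "u * d < of_int i * w * d + of_int i * d\<^sup>2"
        using uw by (simp add: algebra_simps power2_eq_square)
      from cross[OF this d] have "u < of_int i * (w + d)" .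
      then have "of_int q * u < of_int q * (of_int i * (w + d))" using f by simp
      also have "\<dots> = of_int (i * q) * (w + d)" by simp
      also have "\<dots> \<le> of_int (2 * p) * (w + d)" using i uw d by (intro mult_right_mono) (simp_all only: of_int_le_iff add_nonneg_nonneg less_imp_le)
      also have "\<dots> = of_int p * (2 * (w + d))" by simp
      also have "\<dots> \<le> u * (2 * (w + d))" using UW uw d by (intro mult_right_mono) (auto simp: u_def)
      finally have 1: "of_int q < 2 * (w + d)" using uw by simp
      have "\<not> ins (p - D) q"
      proof
        assume "ins (p - D) q"
        moreover have "(p - D, q) \<in> \<Lambda>" using diff[OF f(1) \<Lambda>D[of 1 0]] by simp
        ultimately have "p * q \<le> q * (p - D)" using right f by auto
        then have "q * D \<le> 0" by (simp add: algebra_simps)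
        then show False using D f by (simp add: mult_le_0_iff)
      qed
      then have "(u - d) * w < N"
        using not_in_branchD[OF _ N, of U W "of_int (p - D)" "of_int q"] uw d
        by (simp add: u_def w_def d_def algebra_simps)
      moreover have "(of_int p - d) * w \<le> (u - d) * w" using UW uw by (intro mult_right_mono) (auto simp: u_def)
      ultimately have "(of_int p - d) * w < N" by simp
      from key[OF _ 1 _ this d] have "(of_int q)\<^sup>2 \<le> 6 * N" using q True by (simp add: d_def)
      then show ?thesis using True by (simp add: add_increasing)
    next
      case qp: False
      \<comment> \<open>For a steep edge the near end is shifted instead: \<open>j\<close> is the
        least multiplier for which \<open>(D, j * D)\<close> is steeper than
        \<open>(p, q)\<close>.\<close>
      define j where "j = q div p + 1"
      have "q div p * p + q mod p = q" "0 \<le> q mod p" "q mod p < p" using f by auto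
      moreover have "j * p = q div p * p + p" by (simp add: j_def algebra_simps)
      ultimately have j: "q < j * p" "j * p \<le> 2 * q" using qp by linarith+
      have "0 < j" using f by (simp add: j_def add_nonneg_pos pos_imp_zdiv_nonneg_iff)
      have p: "4 * D \<le> p" using False qp by auto
      have "\<not> ins D (j * D)"
      proof
        assume "ins D (j * D)"
        then have "p * (j * D) \<le> q * D" using right \<Lambda>D[of 1 j] D \<open>0 < j\<close> by auto
        then have "D * (j * p - q) \<le> 0" by (simp add: algebra_simps)
        then show False using D j by (simp add: mult_le_0_iff)
      qed
      then have "(U + d) * (W - of_int j * d) < N"
        using not_in_branchD[OF _ N, of U W "of_int D" "of_int (j * D)"] UW d
        by (simp add: d_def add_pos_pos)
      then have "W * d < of_int j * U * d + of_int j * d\<^sup>2"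
        using UW by (simp add: algebra_simps power2_eq_square)
      from cross[OF this d] have "W < of_int j * (U + d)" .
      then have "of_int p * W < of_int p * (of_int j * (U + d))" using f by simp
      also have "\<dots> = of_int (j * p) * (U + d)" by simp
      also have "\<dots> \<le> of_int (2 * q) * (U + d)" using j UW d by (intro mult_right_mono) (simp_all only: of_int_le_iff add_nonneg_nonneg less_imp_le)
      also have "\<dots> = of_int q * (2 * (U + d))" by simp
      also have "\<dots> \<le> W * (2 * (U + d))" using UW uw d by (intro mult_right_mono) (auto simp: w_def)
      finally have 1: "of_int p < 2 * (U + d)" using UW by simp
      have "\<not> ins 0 D"
      proof
        assume "ins 0 D"
        then have "p * D \<le> q * 0" using right[of 0 D] \<Lambda>D[of 0 1] D by simp
        then show False using D f by (simp add: mult_le_0_iff)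
      qed
      then have "U * (W - d) < N"
        using not_in_branchD[OF _ N, of U W "of_int 0" "of_int D"] UW d
        by (simp add: d_def)
      moreover have "U * (of_int q - d) \<le> U * (W - d)" using UW uw by (intro mult_left_mono) (auto simp: w_def)
      ultimately have "(of_int q - d) * U < N" by (simp add: mult.commute)
      from key[OF _ 1 _ this d] have "(of_int p)\<^sup>2 \<le> 6 * N" using p qp by (simp add: d_def)
      then show ?thesis using qp by (simp add: add_increasing)
    qed
  qed
qed

end

section \<open>Iteration of the search and the number of rounds\<close>

fun final_basis :: "real \<Rightarrow> real \<Rightarrow> real \<Rightarrow> int \<times> int \<times> int \<times> int \<Rightarrow> bool" where
  "final_basis N U W (fu, fd, gu, gd) \<longleftrightarrow>
     entry_steps N (U + of_int gu) (W - of_int gd) (of_int fu) (of_int fd) = 0"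

text \<open>The floors merely convert to type \<open>int\<close>: for bases that satisfy the
  invariant and are not final, both step counts are integers already.\<close>

fun next_basis :: "real \<Rightarrow> real \<Rightarrow> real \<Rightarrow> int \<times> int \<times> int \<times> int \<Rightarrow> int \<times> int \<times> int \<times> int" where
  "next_basis N U W (fu, fd, gu, gd) =
    (let k = \<lfloor>entry_steps N (U + of_int gu) (W - of_int gd) (of_int fu) (of_int fd)\<rfloor>;
         gu' = gu + (k - 1) * fu; gd' = gd + (k - 1) * fd;
         j = \<lfloor>exit_steps N (U + of_int (fu + gu')) (W - of_int (fd + gd')) (of_int gu') (of_int gd')\<rfloor>
     in (fu + gu' + j * gu', fd + gd' + j * gd', gu', gd'))"

context branch_search
begin

lemma exit_steps_invar:
  assumes "pre_invar D fu fd gu gd"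
  obtains j where "exit_steps N (U + of_int fu) (W - of_int fd) (of_int gu) (of_int gd) = of_int j"
    "0 \<le> j" "invar D (fu + j * gu) (fd + j * gd) gu gd"
proof -
  have "in_branch N (U + of_int fu) (W - of_int fd) 0 0" "0 < gd"
    using assms by (simp_all add: pre_invar_def in_branch_shift)
  from exit_steps[OF N this, of gu] obtain j where
    j: "exit_steps N (U + of_int fu) (W - of_int fd) (of_int gu) (of_int gd) = of_int j" "0 \<le> j"
      "ins (fu + j * gu) (fd + j * gd)" "\<not> ins (fu + (j + 1) * gu) (fd + (j + 1) * gd)"
    unfolding in_branch_shift of_int_add[symmetric] by blast
  then show ?thesis using invar_advance_f[OF assms j(2-4)] that by blast
qed

lemma final_basis_cases:
  assumes I: "invar D fu fd gu gd"
  obtains (final) "final_basis N U W (fu, fd, gu, gd)"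
      "\<And>k. 0 \<le> k \<Longrightarrow> \<not> ins (gu + k * fu) (gd + k * fd)"
  | (step) k j where "\<not> final_basis N U W (fu, fd, gu, gd)"
      "entry_steps N (U + of_int gu) (W - of_int gd) (of_int fu) (of_int fd) = of_int k" "2 \<le> k"
      "exit_steps N (U + of_int (fu + (gu + (k - 1) * fu))) (W - of_int (fd + (gd + (k - 1) * fd)))
         (of_int (gu + (k - 1) * fu)) (of_int (gd + (k - 1) * fd)) = of_int j" "0 \<le> j"
      "next_basis N U W (fu, fd, gu, gd) = (fu + (gu + (k - 1) * fu) + j * (gu + (k - 1) * fu),
         fd + (gd + (k - 1) * fd) + j * (gd + (k - 1) * fd), gu + (k - 1) * fu, gd + (k - 1) * fd)"
      "invar D (fu + (gu + (k - 1) * fu) + j * (gu + (k - 1) * fu))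
         (fd + (gd + (k - 1) * fd) + j * (gd + (k - 1) * fd)) (gu + (k - 1) * fu) (gd + (k - 1) * fd)"
proof -
  have I': "0 < fu" "0 \<le> fd" "\<not> ins gu gd" "\<not> ins (fu + gu) (fd + gd)"
    using I by (auto simp: invar_def pre_invar_def)
  have "\<not> in_branch N (U + of_int gu) (W - of_int gd) 0 0"
    "\<not> in_branch N (U + of_int gu) (W - of_int gd) (of_int fu) (of_int fd)"
    using I'(3,4) by (simp_all add: in_branch_shift add.commute)
  with N I'(1,2) show ?thesis
  proof (cases rule: entry_steps)
    case none
    then show ?thesis
      by (intro final) (auto simp: in_branch_shift)
  next
    case (some k)
    define gu' gd' where "gu' = gu + (k - 1) * fu" and "gd' = gd + (k - 1) * fd"
    have "pre_invar D (fu + gu') (fd + gd') gu' gd'"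
      unfolding gu'_def gd'_def
      by (rule pre_invar_advance_g[OF I some(2)]) (use some(3,4) in \<open>simp_all add: in_branch_shift\<close>)
    from exit_steps_invar[OF this] obtain j where
      j: "exit_steps N (U + of_int (fu + gu')) (W - of_int (fd + gd')) (of_int gu') (of_int gd') = of_int j"
        "0 \<le> j" "invar D (fu + gu' + j * gu') (fd + gd' + j * gd') gu' gd'" by blast
    have nb: "next_basis N U W (fu, fd, gu, gd) = (fu + gu' + j * gu', fd + gd' + j * gd', gu', gd')"
      unfolding next_basis.simps some(1) floor_of_int Let_def gu'_def[symmetric] gd'_def[symmetric] j(1) ..
    have nf: "\<not> final_basis N U W (fu, fd, gu, gd)" using some(1,2) by simp
    show ?thesis
      by (rule step[OF nf some(1,2)]) (use j nb in \<open>simp_all only: gu'_def gd'_def\<close>)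
  qed
qed

text \<open>\<open>2 \<le> k\<close> puts a full copy of \<open>f\<close> into \<open>g'\<close>,
  and \<open>f'\<close> contains both \<open>f\<close> and \<open>g'\<close>. The second coordinate
  of \<open>f\<close> may start at 0, so \<open>fd + 1\<close> is what doubles. While
  \<open>gu'\<close> is negative, \<open>fu\<close> shrinks; but \<open>fu'\<close> stays positive,
  so \<open>fu > - gu'\<close>, and since \<open>gu' - gu\<close> is at least \<open>fu\<close>, the
  absolute value of \<open>gu\<close> more than halves.\<close>

lemma next_basis_growth:
  assumes I: "invar D fu fd gu gd" and I': "invar D fu' fd' gu' gd'"
    and k: "2 \<le> k" and j: "0 \<le> j"
    and g': "gu' = gu + (k - 1) * fu" "gd' = gd + (k - 1) * fd"
    and f': "fu' = fu + gu' + j * gu'" "fd' = fd + gd' + j * gd'"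
  shows "2 * (fd + 1) \<le> fd' + 1" "0 \<le> gu \<Longrightarrow> 0 \<le> gu' \<and> 2 * fu \<le> fu'" "gu' < 0 \<Longrightarrow> gu < 2 * gu'"
proof -
  have pos: "0 < fu" "0 \<le> fd" "0 < gd" "0 < fu'" "0 < gd'"
    using I I' by (auto simp: invar_def pre_invar_def)
  have "fd \<le> (k - 1) * fd" "fu \<le> (k - 1) * fu" using k pos by (simp_all add: mult_le_cancel_right1)
  then have g: "gd + fd \<le> gd'" "gu + fu \<le> gu'" using g' by auto
  have "0 \<le> j * gd'" using j pos by simp
  then show "2 * (fd + 1) \<le> fd' + 1" using g(1) pos f'(2) unfolding distrib_left by linarith
  show "0 \<le> gu' \<and> 2 * fu \<le> fu'" if "0 \<le> gu"
  proof -
    have "0 \<le> gu'" using that g pos by linarith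
    moreover from this have "0 \<le> j * gu'" using j by simp
    ultimately show ?thesis using that g f'(1) by linarith
  qed
  show "gu < 2 * gu'" if "gu' < 0"
  proof -
    have "j * gu' \<le> 0" using j that by (simp add: mult_nonneg_nonpos)
    then have "0 < fu + gu'" using f'(1) pos by linarith
    then show ?thesis using g(2) by linarith
  qed
qed

text \<open>The induction measure uses that \<open>fd\<close> increases and stays below
  \<open>W\<close>. It depends on the position of \<open>v\<close> and only serves termination; the
  last three estimates carry the position-independent count. The one for \<open>gu < 0\<close>
  merges the rounds in which \<open>- gu\<close> halves with the later ones in which
  \<open>fu\<close> doubles.\<close>

lemma search_terminates:
  assumes "invar D fu fd gu gd"
  shows "\<exists>m fu' fd' gu' gd'. (next_basis N U W ^^ m) (fu, fd, gu, gd) = (fu', fd', gu', gd') \<and>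
    invar D fu' fd' gu' gd' \<and> final_basis N U W (fu', fd', gu', gd') \<and>
    (\<forall>l<m. \<exists>a b c d. (next_basis N U W ^^ l) (fu, fd, gu, gd) = (a, b, c, d) \<and>
       invar D a b c d \<and> \<not> final_basis N U W (a, b, c, d)) \<and>
    2 ^ m * (fd + 1) \<le> fd' + 1 \<and> (0 \<le> gu \<longrightarrow> 2 ^ m * fu \<le> fu') \<and> (gu < 0 \<longrightarrow> 2 ^ m \<le> 2 * (- gu) * fu')"
  using assms
proof (induction "nat (\<lceil>W\<rceil> - fd)" arbitrary: fu fd gu gd rule: less_induct)
  case less
  from less.prems show ?case
  proof (cases rule: final_basis_cases)
    case final
    have "1 \<le> fu" using less.prems by (auto simp: invar_def pre_invar_def)
    then have "gu < 0 \<Longrightarrow> 1 * 1 \<le> (- gu) * fu" by (intro mult_mono) auto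
    then have "2 ^ 0 * (fd + 1) \<le> fd + 1 \<and> (0 \<le> gu \<longrightarrow> 2 ^ 0 * fu \<le> fu) \<and> (gu < 0 \<longrightarrow> 2 ^ 0 \<le> 2 * (- gu) * fu)"
      by auto
    then show ?thesis using final(1) less.prems
      by (intro exI[of _ 0] exI[of _ fu] exI[of _ fd] exI[of _ gu] exI[of _ gd]) simp
  next
    case (step k j)
    define gu' gd' where g': "gu' = gu + (k - 1) * fu" "gd' = gd + (k - 1) * fd"
    define fu' fd' where f': "fu' = fu + gu' + j * gu'" "fd' = fd + gd' + j * gd'"
    have nb: "next_basis N U W (fu, fd, gu, gd) = (fu', fd', gu', gd')" and I': "invar D fu' fd' gu' gd'"
      using step(6,7) by (simp_all only: g' f')
    note grow = next_basis_growth[OF less.prems I' step(3,5) g' f']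
    have "of_int fd' < W" using I' by (simp add: invar_def pre_invar_def in_branch_def)
    then have "fd' < \<lceil>W\<rceil>" by linarith
    moreover have "0 \<le> fd" using less.prems by (simp add: invar_def pre_invar_def)
    ultimately have "nat (\<lceil>W\<rceil> - fd') < nat (\<lceil>W\<rceil> - fd)" using grow(1) by simp
    from less.hyps[OF this I'] obtain m pu pd ru rd where
      m: "(next_basis N U W ^^ m) (fu', fd', gu', gd') = (pu, pd, ru, rd)" "invar D pu pd ru rd"
      "final_basis N U W (pu, pd, ru, rd)"
      "\<forall>l<m. \<exists>a b c d. (next_basis N U W ^^ l) (fu', fd', gu', gd') = (a, b, c, d) \<and>
         invar D a b c d \<and> \<not> final_basis N U W (a, b, c, d)"
      "2 ^ m * (fd' + 1) \<le> pd + 1" "0 \<le> gu' \<longrightarrow> 2 ^ m * fu' \<le> pu" "gu' < 0 \<longrightarrow> 2 ^ m \<le> 2 * (- gu') * pu"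
      by blast
    have pu: "1 \<le> pu" "1 \<le> fu'" using m(2) I' by (auto simp: invar_def pre_invar_def)
    have "\<exists>a b c d. (next_basis N U W ^^ l) (fu, fd, gu, gd) = (a, b, c, d) \<and>
         invar D a b c d \<and> \<not> final_basis N U W (a, b, c, d)" if "l < Suc m" for l
    proof (cases l)
      case 0
      then show ?thesis using less.prems step(1) by auto
    next
      case (Suc l')
      then show ?thesis using m(4) that nb by (simp add: funpow_Suc_right del: funpow.simps next_basis.simps)
    qed
    moreover have "(next_basis N U W ^^ Suc m) (fu, fd, gu, gd) = (pu, pd, ru, rd)"
      using m(1) nb by (simp add: funpow_Suc_right del: funpow.simps next_basis.simps)
    moreover have "2 ^ Suc m * (fd + 1) \<le> pd + 1"
    proof -
      have "2 ^ m * (2 * (fd + 1)) \<le> 2 ^ m * (fd' + 1)" using grow(1) by (intro mult_left_mono) auto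
      moreover have "2 ^ Suc m * (fd + 1) = 2 ^ m * (2 * (fd + 1))" by simp
      ultimately show ?thesis using m(5) by linarith
    qed
    moreover have "2 ^ Suc m * fu \<le> pu" if "0 \<le> gu"
    proof -
      have "2 ^ m * (2 * fu) \<le> 2 ^ m * fu'" using grow(2)[OF that] by (intro mult_left_mono) auto
      moreover have "2 ^ Suc m * fu = 2 ^ m * (2 * fu)" by simp
      ultimately show ?thesis using m(6) grow(2)[OF that] by linarith
    qed
    moreover have "2 ^ Suc m \<le> 2 * (- gu) * pu" if "gu < 0"
    proof (cases "gu' < 0")
      case True
      then have "2 * (- gu') * pu \<le> (- gu) * pu" using grow(3) pu by (intro mult_right_mono) auto
      then show ?thesis using m(7) True by simp
    next
      case False
      have "2 ^ m * 1 \<le> 2 ^ m * fu'" using pu by (intro mult_left_mono) auto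
      then have "2 ^ m \<le> pu" using m(6) False by linarith
      moreover have "1 * pu \<le> (- gu) * pu" using that pu by (intro mult_right_mono) auto
      ultimately show ?thesis by simp
    qed
    ultimately show ?thesis using m(2,3) by blast
  qed
qed

text \<open>Each coordinate of the final \<open>f\<close>, increased by 1, is at least
  \<open>2 ^ m / (2 * D)\<close>; the factor \<open>D\<close> pays for the rounds with negative
  \<open>gu\<close>. This holds in particular for the smaller coordinate, which is bounded
  independently of the position of \<open>v\<close>.\<close>

lemma search_steps_bound:
  assumes I: "invar D fu fd gu gd" and gu: "- gu < D"
    and I': "invar D fu' fd' gu' gd'" and final: "final_basis N U W (fu', fd', gu', gd')"
    and grow: "2 ^ m * (fd + 1) \<le> fd' + 1" "0 \<le> gu \<longrightarrow> 2 ^ m * fu \<le> fu'" "gu < 0 \<longrightarrow> 2 ^ m \<le> 2 * (- gu) * fu'"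
  shows "(2::real) ^ (2 * m) \<le> 8 * (of_int D)\<^sup>2 * (16 * (of_int D)\<^sup>2 + 6 * N + 1)"
proof -
  have D: "1 \<le> D" "1 \<le> fu'" "0 \<le> fd'" "0 < fu" "0 \<le> fd" using I I' by (auto simp: invar_def pre_invar_def)
  have none: "\<not> ins (gu' + k * fu') (gd' + k * fd')" if "0 \<le> k" for k
    using final_basis_cases[OF I'] final that by metis
  have right: "fu' * y \<le> fd' * x" if "(x, y) \<in> \<Lambda>" "ins x y" "0 < y" for x y
    using right_of_terminal[OF I' none that] .
  have \<Lambda>: "\<Lambda> = lattice_span fu' fd' gu' gd'" "D = fu' * gd' - fd' * gu'" "ins fu' fd'"
    using I' by (auto simp: invar_def pre_invar_def)
  define b where "b = min fu' fd'"
  have b: "0 \<le> b" using D by (simp add: b_def)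
  have bound: "(of_int b)\<^sup>2 \<le> 16 * (of_int D)\<^sup>2 + 6 * N"
  \<comment> \<open>Here the boundary continues parallel to an asymptote and there is no next
    vertex; the rounds must be bounded all the same, and the smaller coordinate is 0.\<close>
  proof (cases "fd' = 0")
    case True
    then show ?thesis using D N by (simp add: b_def add_nonneg_pos less_imp_le)
  next
    case False
    show ?thesis
      unfolding b_def
    proof (rule min_coordinate_bound)
      show "(fu', fd') \<in> \<Lambda>" unfolding \<Lambda>(1) lattice_span_iff by (metis add.right_neutral mult_1 mult_zero_left)
      show "(i * D, j * D) \<in> \<Lambda>" for i j unfolding \<Lambda>(1,2) by (rule lattice_span_det)
      show "(x - x', y - y') \<in> \<Lambda>" if "(x, y) \<in> \<Lambda>" "(x', y') \<in> \<Lambda>" for x y x' y'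
        using that unfolding \<Lambda>(1) by (rule lattice_span_diff)
    qed (use D False \<Lambda>(3) right in auto)
  qed
  have "2 ^ m * 1 \<le> 2 ^ m * (fd + 1)" using D by (intro mult_left_mono) auto
  then have "2 ^ m \<le> fd' + 1" using grow(1) by linarith
  moreover have "2 ^ m \<le> 2 * D * fu'"
  proof (cases "gu < 0")
    case True
    have "2 * (- gu) * fu' \<le> 2 * D * fu'" using gu D by (intro mult_right_mono) auto
    then show ?thesis using grow(3) True by linarith
  next
    case False
    have "2 ^ m * 1 \<le> 2 ^ m * fu" using D by (intro mult_left_mono) auto
    moreover have "1 * fu' \<le> 2 * D * fu'" using D by (intro mult_right_mono) auto
    ultimately show ?thesis using grow(2) False by linarith
  qed
  moreover have "1 * (fd' + 1) \<le> 2 * D * (fd' + 1)" using D by (intro mult_right_mono) auto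
  moreover have "2 * D * fu' \<le> 2 * D * (fu' + 1)" using D by (intro mult_left_mono) auto
  ultimately have "2 ^ m \<le> 2 * D * (b + 1)" unfolding b_def by (cases "fu' \<le> fd'") auto
  then have "real_of_int (2 ^ m) \<le> real_of_int (2 * D * (b + 1))" by (simp only: of_int_le_iff)
  then have "(2::real) ^ m \<le> 2 * of_int D * (of_int b + 1)" by simp
  then have "((2::real) ^ m)\<^sup>2 \<le> (2 * of_int D * (of_int b + 1))\<^sup>2" by (intro power_mono) auto
  also have "\<dots> = 4 * (of_int D)\<^sup>2 * (of_int b + 1)\<^sup>2" by (simp add: power_mult_distrib)
  also have "\<dots> \<le> 4 * (of_int D)\<^sup>2 * (2 * (16 * (of_int D)\<^sup>2 + 6 * N + 1))"
  proof (intro mult_left_mono)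
    have "(of_int b + 1)\<^sup>2 + (of_int b - 1)\<^sup>2 = 2 * (of_int b)\<^sup>2 + (2::real)" by (simp add: power2_eq_square algebra_simps)
    moreover have "0 \<le> (of_int b - 1 :: real)\<^sup>2" by simp
    ultimately show "(of_int b + 1)\<^sup>2 \<le> 2 * (16 * (of_int D)\<^sup>2 + 6 * N + 1)"
      using bound unfolding distrib_left by linarith
  qed auto
  also have "\<dots> = 8 * (of_int D)\<^sup>2 * (16 * (of_int D)\<^sup>2 + 6 * N + 1)" by simp
  finally show ?thesis by (simp only: power_mult[symmetric] mult.commute)
qed

end

section \<open>Branches of the hyperbola\<close>

lemma connected_avoids_value:
  fixes f :: "'a::topological_space \<Rightarrow> real"
  assumes "connected C" "continuous_on C f" "\<And>z. z \<in> C \<Longrightarrow> f z \<noteq> r"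
  shows "(\<forall>z\<in>C. r < f z) \<or> (\<forall>z\<in>C. f z < r)"
proof (rule ccontr)
  assume "\<not> ?thesis"
  then obtain y z where yz: "y \<in> C" "z \<in> C" "f y \<le> r" "r \<le> f z" by (meson not_less)
  have "connected (f ` C)" using assms by (intro connected_continuous_image)
  then have "{f y..f z} \<subseteq> f ` C" using yz by (intro connected_contains_Icc) auto
  moreover have "r \<in> {f y..f z}" using yz by simp
  ultimately show False using assms(3) by (metis imageE subsetD)
qed

text \<open>The points with \<open>u z * w z < N\<close> form a set that is starlike about the
  center, hence connected and a single component, but not a convex one. On any other component the
  product exceeds \<open>N > 0\<close>, so \<open>u\<close> and \<open>w\<close> keep one common
  sign \<sigma>; the corresponding set is convex, hence connected, and maximality identifies it with
  \<open>C\<close>.\<close>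

lemma convex_component_complement_hyperbola:
  fixes p1 q1 p2 q2 x0 y0 N :: real
  defines "u \<equiv> \<lambda>z. p1 * (fst z - x0) + q1 * (snd z - y0)"
    and "w \<equiv> \<lambda>z. p2 * (fst z - x0) + q2 * (snd z - y0)"
  assumes det: "p1 * q2 - q1 * p2 \<noteq> 0" and N: "0 < N"
    and C: "C \<in> components (- {z. u z * w z = N})" "convex C"
  obtains \<sigma> :: real where "\<sigma> = 1 \<or> \<sigma> = -1"
    "closure C = {z. 0 < \<sigma> * u z \<and> 0 < \<sigma> * w z \<and> N \<le> u z * w z}"
proof -
  have cont: "continuous_on S u" "continuous_on S w" for S
    unfolding u_def w_def by (intro continuous_intros)+
  have affine: "u ((1 - t) *\<^sub>R y + t *\<^sub>R z) = (1 - t) * u y + t * u z"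
    "w ((1 - t) *\<^sub>R y + t *\<^sub>R z) = (1 - t) * w y + t * w z" for t y z
    by (simp_all add: u_def w_def algebra_simps)
  have Csub: "C \<subseteq> - {z. u z * w z = N}" and Cne: "C \<noteq> {}" and Ccon: "connected C"
    using C in_components_subset in_components_nonempty in_components_connected by blast+
  have avoid: "(\<forall>z\<in>C. N < u z * w z) \<or> (\<forall>z\<in>C. u z * w z < N)"
    using Csub by (intro connected_avoids_value Ccon continuous_intros cont) auto
  have maximal: "C = T" if "connected T" "T \<subseteq> - {z. u z * w z = N}" "C \<subseteq> T" for T
    using components_maximal[OF C(1) that(1,2)] that(3) Cne by blast
  have "\<not> (\<forall>z\<in>C. u z * w z < N)"
  proof
    assume less: "\<forall>z\<in>C. u z * w z < N"
    define M where "M = {z. u z * w z < N}"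
    have "starlike M"
      unfolding starlike_def
    proof (intro bexI[of _ "(x0, y0)"] ballI subsetI)
      show "(x0, y0) \<in> M" using N by (simp add: M_def u_def)
      fix z y assume z: "z \<in> M" and "y \<in> closed_segment (x0, y0) z"
      then obtain t where t: "0 \<le> t" "t \<le> 1" "y = (1 - t) *\<^sub>R (x0, y0) + t *\<^sub>R z"
        by (auto simp: in_segment)
      have 0: "u (x0, y0) = 0" "w (x0, y0) = 0" by (simp_all add: u_def w_def)
      have eq: "u y * w y = t\<^sup>2 * (u z * w z)"
        unfolding t(3) affine 0 by (simp add: power2_eq_square)
      have "t\<^sup>2 * (u z * w z) < N"
      proof (cases "u z * w z \<le> 0")
        case True
        then show ?thesis using N by (meson le_less_trans mult_nonneg_nonpos zero_le_power2)
      next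
        case False
        have "t\<^sup>2 \<le> 1" using t by (simp add: power_le_one)
        then have "t\<^sup>2 * (u z * w z) \<le> 1 * (u z * w z)" using False by (intro mult_right_mono) auto
        then show ?thesis using z by (simp add: M_def)
      qed
      then show "y \<in> M" using eq by (simp add: M_def)
    qed
    then have CM: "C = M"
      using less by (intro maximal starlike_imp_connected) (auto simp: M_def)
    define pt where "pt a b = (x0 + (q2 * a - q1 * b) / (p1 * q2 - q1 * p2),
      y0 + (p1 * b - p2 * a) / (p1 * q2 - q1 * p2))" for a b
    have pt: "u (pt a b) = a" "w (pt a b) = b" for a b
    proof -
      have "u (pt a b) = (p1 * (q2 * a - q1 * b) + q1 * (p1 * b - p2 * a)) / (p1 * q2 - q1 * p2)"
        by (simp add: u_def pt_def add_divide_distrib)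
      also have "\<dots> = (a * (p1 * q2 - q1 * p2)) / (p1 * q2 - q1 * p2)" by (simp add: algebra_simps)
      finally show "u (pt a b) = a" using det by simp
      have "w (pt a b) = (p2 * (q2 * a - q1 * b) + q2 * (p1 * b - p2 * a)) / (p1 * q2 - q1 * p2)"
        by (simp add: w_def pt_def add_divide_distrib)
      also have "\<dots> = (b * (p1 * q2 - q1 * p2)) / (p1 * q2 - q1 * p2)" by (simp add: algebra_simps)
      finally show "w (pt a b) = b" using det by simp
    qed
    \<comment> \<open>The points with factor values (0, s) and (s, 0) have product 0, but at their
      midpoint the product is \<open>(N + 1)\<^sup>2\<close>, which exceeds
      \<open>N\<close>.\<close>
    define s where "s = 2 * (N + 1)"
    have "pt 0 s \<in> C" "pt s 0 \<in> C" using N by (simp_all add: CM M_def pt)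
    from convexD_alt[OF C(2) this, of "1/2"] have "(1 - 1/2) *\<^sub>R pt 0 s + (1/2) *\<^sub>R pt s 0 \<in> C" by simp
    then have "(s / 2) * (s / 2) < N" unfolding CM M_def mem_Collect_eq affine pt by simp
    moreover have "N * 1 \<le> (N + 1) * (N + 1)" using N by (intro mult_mono) auto
    moreover have "s / 2 = N + 1" by (simp add: s_def)
    ultimately show False by simp
  qed
  then have gt: "\<forall>z\<in>C. N < u z * w z" using avoid by blast
  have "(\<forall>z\<in>C. 0 < u z) \<or> (\<forall>z\<in>C. u z < 0)"
    using gt N by (intro connected_avoids_value Ccon cont) auto
  then obtain \<sigma> :: real where \<sigma>: "\<sigma> = 1 \<or> \<sigma> = -1" "\<forall>z\<in>C. 0 < \<sigma> * u z"
  proof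
    assume "\<forall>z\<in>C. 0 < u z"
    then show ?thesis by (intro that[of 1]) auto
  next
    assume "\<forall>z\<in>C. u z < 0"
    then show ?thesis by (intro that[of "-1"]) auto
  qed
  have \<sigma>\<sigma>: "(\<sigma> * a) * (\<sigma> * b) = a * b" for a b using \<sigma>(1) by auto
  define B where "B = {z. 0 < \<sigma> * u z \<and> 0 < \<sigma> * w z \<and> N < u z * w z}"
  have "convex B"
    unfolding convex_alt
  proof (intro ballI allI impI)
    fix y z t assume yz: "y \<in> B" "z \<in> B" and t: "0 \<le> t \<and> t \<le> (1::real)"
    define N' where "N' = min (u y * w y) (u z * w z)"
    have "N' \<le> ((1 - t) * (\<sigma> * u y) + t * (\<sigma> * u z)) * ((1 - t) * (\<sigma> * w y) + t * (\<sigma> * w z))"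
      using yz t by (intro mult_ge_convex) (simp_all only: B_def mem_Collect_eq \<sigma>\<sigma>, simp_all add: N'_def)
    also have "\<dots> = (\<sigma> * u ((1 - t) *\<^sub>R y + t *\<^sub>R z)) * (\<sigma> * w ((1 - t) *\<^sub>R y + t *\<^sub>R z))"
      unfolding affine by (simp add: algebra_simps)
    finally have "N' \<le> u ((1 - t) *\<^sub>R y + t *\<^sub>R z) * w ((1 - t) *\<^sub>R y + t *\<^sub>R z)" unfolding \<sigma>\<sigma> .
    moreover have "N < N'" using yz by (simp add: N'_def B_def)
    moreover have "0 < (1 - t) * a + t * b" if "0 < a" "0 < b" for a b :: real
      using that t by (cases "t = 0") (auto intro: add_nonneg_pos)
    moreover have "\<sigma> * ((1 - t) * a + t * b) = (1 - t) * (\<sigma> * a) + t * (\<sigma> * b)" for a b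
      by (simp add: algebra_simps)
    ultimately show "(1 - t) *\<^sub>R y + t *\<^sub>R z \<in> B" using yz by (simp add: B_def affine)
  qed
  moreover have "0 < \<sigma> * w z" if "z \<in> C" for z
  proof -
    have "0 < (\<sigma> * u z) * (\<sigma> * w z)" using gt N that unfolding \<sigma>\<sigma> by (meson less_trans)
    then show ?thesis using \<sigma>(2) that zero_less_mult_pos by blast
  qed
  ultimately have CB: "C = B"
    using gt \<sigma>(2) by (intro maximal convex_connected) (auto simp: B_def)
  have "closure B = {z. 0 < \<sigma> * u z \<and> 0 < \<sigma> * w z \<and> N \<le> u z * w z}"
  proof (intro equalityI subsetI)
    define T where "T = {z. 0 \<le> \<sigma> * u z \<and> 0 \<le> \<sigma> * w z \<and> N \<le> u z * w z}"
    have "closed T"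
      unfolding T_def by (intro closed_Collect_conj closed_Collect_le continuous_intros cont)
    then have "closure B \<subseteq> T" by (intro closure_minimal) (auto simp: B_def T_def)
    moreover fix z assume "z \<in> closure B"
    ultimately have "z \<in> T" by blast
    moreover from this have "u z \<noteq> 0" "w z \<noteq> 0" using N by (auto simp: T_def)
    ultimately show "z \<in> {z. 0 < \<sigma> * u z \<and> 0 < \<sigma> * w z \<and> N \<le> u z * w z}"
      using \<sigma>(1) by (auto simp: T_def)
  next
    fix z assume "z \<in> {z. 0 < \<sigma> * u z \<and> 0 < \<sigma> * w z \<and> N \<le> u z * w z}"
    then have z: "0 < \<sigma> * u z" "0 < \<sigma> * w z" "N \<le> u z * w z" by auto
    \<comment> \<open>Dilating from the center by a factor above 1 makes the product strictly
      larger, so boundary points are limits of points of \<open>B\<close>.\<close>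
    define f where "f n = z + (1 / real (Suc n)) *\<^sub>R (z - (x0, y0))" for n
    have "f n \<in> B" for n
    proof -
      define r where "r = 1 + 1 / real (Suc n)"
      have r: "1 < r" by (simp add: r_def)
      have f: "u (f n) = r * u z" "w (f n) = r * w z"
        by (simp_all add: u_def w_def f_def r_def algebra_simps)
      have "1 < r * r" using r by (rule less_1_mult[OF _ r])
      then have "1 * (u z * w z) < (r * r) * (u z * w z)" using z N by (intro mult_strict_right_mono) auto
      then have "N < u (f n) * w (f n)" using z unfolding f by (simp add: algebra_simps)
      moreover have "0 < \<sigma> * u (f n)" "0 < \<sigma> * w (f n)"
        using r z(1,2) unfolding f mult.left_commute[of \<sigma> r] by simp_all
      ultimately show ?thesis by (simp add: B_def)
    qed
    moreover have "f \<longlonglongrightarrow> z"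
    proof -
      have "(\<lambda>n. z + (1 / real (Suc n)) *\<^sub>R (z - (x0, y0))) \<longlonglongrightarrow> z + 0 *\<^sub>R (z - (x0, y0))"
        by (intro tendsto_intros LIMSEQ_Suc lim_1_over_n)
      then show ?thesis by (simp add: f_def[abs_def])
    qed
    ultimately show "z \<in> closure B" unfolding closure_sequential by blast
  qed
  then show ?thesis using that[OF \<sigma>(1)] CB by blast
qed

text \<open>The component is not part of the input. It is recognized by the signs of the two factors
  at any one of its points, and the program knows such a point, the vertex. A negative
  \<open>\<kappa> * n\<close> is handled by negating the first factor.\<close>

lemma closure_convex_component_hyperbola:
  fixes a b c n x0 y0 \<kappa> p1 q1 p2 q2 :: real
  defines "u \<equiv> \<lambda>z. p1 * (fst z - x0) + q1 * (snd z - y0)"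
    and "w \<equiv> \<lambda>z. p2 * (fst z - x0) + q2 * (snd z - y0)"
  assumes factor: "\<And>x y. \<kappa> * (a * x\<^sup>2 + b * x * y + c * y\<^sup>2) = (p1 * x + q1 * y) * (p2 * x + q2 * y)"
    and det: "p1 * q2 - q1 * p2 \<noteq> 0" and n: "n \<noteq> 0" and \<kappa>: "\<kappa> \<noteq> 0"
    and C: "C \<in> components (- hyperbola a b c n x0 y0)" "convex C" and v: "v \<in> closure C"
  shows "u v \<noteq> 0" "w v \<noteq> 0"
    "closure C = {z. 0 < sgn (u v) * u z \<and> 0 < sgn (w v) * w z \<and> \<bar>\<kappa> * n\<bar> \<le> (sgn (u v) * u z) * (sgn (w v) * w z)}"
proof -
  define e where "e = sgn (\<kappa> * n)"
  have e: "e = 1 \<or> e = -1" "e * \<bar>\<kappa> * n\<bar> = \<kappa> * n" using n \<kappa> by (auto simp: e_def sgn_if abs_if)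
  define u' where "u' = (\<lambda>z. e * p1 * (fst z - x0) + e * q1 * (snd z - y0))"
  have u': "u' z = e * u z" for z by (simp add: u'_def u_def algebra_simps)
  have "hyperbola a b c n x0 y0 = {z. u' z * w z = \<bar>\<kappa> * n\<bar>}"
  proof -
    have "a * (x - x0)\<^sup>2 + b * (x - x0) * (y - y0) + c * (y - y0)\<^sup>2 = n \<longleftrightarrow> u' (x, y) * w (x, y) = \<bar>\<kappa> * n\<bar>" for x y
    proof -
      have "a * (x - x0)\<^sup>2 + b * (x - x0) * (y - y0) + c * (y - y0)\<^sup>2 = n \<longleftrightarrow> u (x, y) * w (x, y) = \<kappa> * n"
        using factor[of "x - x0" "y - y0", symmetric] \<kappa> by (simp add: u_def w_def)
      also have "\<dots> \<longleftrightarrow> u' (x, y) * w (x, y) = \<bar>\<kappa> * n\<bar>"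
        using e by (auto simp: u')
      finally show ?thesis .
    qed
    then show ?thesis by (auto simp: hyperbola_def)
  qed
  then have C': "C \<in> components (- {z. u' z * w z = \<bar>\<kappa> * n\<bar>})" using C by simp
  have det': "e * p1 * q2 - e * q1 * p2 \<noteq> 0" using det e by auto
  obtain \<sigma> where \<sigma>: "\<sigma> = 1 \<or> \<sigma> = -1"
    "closure C = {z. 0 < \<sigma> * u' z \<and> 0 < \<sigma> * w z \<and> \<bar>\<kappa> * n\<bar> \<le> u' z * w z}"
    using convex_component_complement_hyperbola[OF det' _ C'[unfolded u'_def w_def] C(2)] n \<kappa>
    unfolding u'_def w_def by auto
  have "0 < \<sigma> * u' v" "0 < \<sigma> * w v" using v \<sigma>(2) by auto
  then have s: "u v \<noteq> 0" "w v \<noteq> 0" "sgn (u v) = \<sigma> * e" "sgn (w v) = \<sigma>"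
    using \<sigma>(1) e(1) by (auto simp: u' sgn_if)
  then show "u v \<noteq> 0" "w v \<noteq> 0" by auto
  have "(\<sigma> * e * u z) * (\<sigma> * w z) = u' z * w z" "\<sigma> * e * u z = \<sigma> * u' z" for z
    using \<sigma>(1) by (auto simp: u')
  then show "closure C = {z. 0 < sgn (u v) * u z \<and> 0 < sgn (w v) * w z \<and> \<bar>\<kappa> * n\<bar> \<le> (sgn (u v) * u z) * (sgn (w v) * w z)}"
    unfolding s \<sigma>(2) by (simp only:)
qed

section \<open>Vertices of the integer hull\<close>

definition branch_region :: "real \<Rightarrow> real \<Rightarrow> real \<Rightarrow> real \<Rightarrow> real \<Rightarrow> real \<Rightarrow> real \<Rightarrow> (real \<times> real) set" where
  "branch_region p1 q1 p2 q2 x0 y0 N = {z.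
     0 < p1 * (fst z - x0) + q1 * (snd z - y0) \<and> 0 < p2 * (fst z - x0) + q2 * (snd z - y0) \<and>
     N \<le> (p1 * (fst z - x0) + q1 * (snd z - y0)) * (p2 * (fst z - x0) + q2 * (snd z - y0))}"

fun orientation_sign :: "orientation \<Rightarrow> int" where
  "orientation_sign Counterclockwise = 1"
| "orientation_sign Clockwise = -1"

lemma next_vertex_turn:
  "next_vertex d K v w \<Longrightarrow> p \<in> K \<Longrightarrow> 0 \<le> of_int (orientation_sign d) * turn v w p"
  unfolding next_vertex_def by (cases d) auto

lemma extreme_point_symmetric:
  assumes "e extreme_point_of K" "e + p \<in> K" "e - p \<in> K"
  shows "p = (0::'a::real_normed_vector)"
proof (rule ccontr)
  assume "p \<noteq> 0"
  have "e - p \<noteq> e + p"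
  proof
    assume "e - p = e + p"
    then have "2 *\<^sub>R p = 0" by (simp add: scaleR_2 algebra_simps)
    then show False using \<open>p \<noteq> 0\<close> by simp
  qed
  moreover have "midpoint (e - p) (e + p) = e" by (simp add: midpoint_def scaleR_2[symmetric])
  ultimately have "e \<in> open_segment (e - p) (e + p)" by (metis midpoint_in_open_segment)
  then show False using assms by (auto simp: extreme_point_of_def)
qed

lemma in_branch_mono:
  assumes "in_branch N U W x y" "x \<le> x'" "y' \<le> y"
  shows "in_branch N U W x' y'"
proof -
  have "(U + x) * (W - y) \<le> (U + x') * (W - y')"
    using assms by (intro mult_mono) (auto simp: in_branch_def)
  then show ?thesis using assms by (auto simp: in_branch_def)
qed

locale hyperbola_vertex =
  fixes p1 q1 p2 q2 vx vy :: int and x0 y0 N :: real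
  assumes N_pos: "0 < N" and det: "p1 * q2 - q1 * p2 \<noteq> 0"
    and extreme: "(of_int vx, of_int vy) extreme_point_of integer_hull (branch_region p1 q1 p2 q2 x0 y0 N)"
begin

abbreviation "R \<equiv> branch_region p1 q1 p2 q2 x0 y0 N"

definition "U = of_int p1 * (of_int vx - x0) + of_int q1 * (of_int vy - y0)"

definition "W = of_int p2 * (of_int vx - x0) + of_int q2 * (of_int vy - y0)"

abbreviation "\<Lambda> \<equiv> lattice_span p1 (- p2) q1 (- q2)"

lemma mem_region_iff:
  "(of_int (vx + x), of_int (vy + y)) \<in> R \<longleftrightarrow>
     in_branch N U W (of_int (x * p1 + y * q1)) (of_int (x * (- p2) + y * (- q2)))"
proof -
  have "of_int p1 * (of_int (vx + x) - x0) + of_int q1 * (of_int (vy + y) - y0) = U + of_int (x * p1 + y * q1)"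
    "of_int p2 * (of_int (vx + x) - x0) + of_int q2 * (of_int (vy + y) - y0) = W - of_int (x * (- p2) + y * (- q2))"
    by (simp_all add: U_def W_def algebra_simps)
  then show ?thesis by (simp only: branch_region_def in_branch_def mem_Collect_eq fst_conv snd_conv)
qed

lemma mem_hull:
  assumes "in_branch N U W (of_int (x * p1 + y * q1)) (of_int (x * (- p2) + y * (- q2)))"
  shows "(of_int (vx + x), of_int (vy + y)) \<in> integer_hull R"
proof -
  have "(of_int (vx + x), of_int (vy + y)) \<in> R \<inter> \<int> \<times> \<int>" using assms mem_region_iff by auto
  then show ?thesis unfolding integer_hull_def by (rule hull_inc)
qed

lemma extreme_imp_region: "e extreme_point_of integer_hull R \<Longrightarrow> e \<in> R \<inter> \<int> \<times> \<int>"
  unfolding integer_hull_def by (rule extreme_point_of_convex_hull)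

text \<open>For a displacement that decreases the second factor without increasing the first, the
  opposite displacement increases or keeps both factors and so stays in the branch. The vertex would
  be the midpoint of two other hull points.\<close>

sublocale branch_search N U W \<Lambda>
proof
  show "0 < N" by (rule N_pos)
  show in0: "in_branch N U W 0 0"
    using extreme_imp_region[OF extreme] mem_region_iff[of 0 0] by simp
  fix a b assume "(a, b) \<in> \<Lambda>" and ins: "in_branch N U W (of_int a) (of_int b)" and b: "0 < b"
  then obtain x y where ab: "a = x * p1 + y * q1" "b = x * (- p2) + y * (- q2)"
    by (auto simp: lattice_span_iff)
  show "0 < a"
  proof (rule ccontr)
    assume "\<not> 0 < a"
    then have "in_branch N U W (of_int (- a)) (of_int (- b))"
      using b by (intro in_branch_mono[OF in0]) auto
    moreover have "- a = (- x) * p1 + (- y) * q1" "- b = (- x) * (- p2) + (- y) * (- q2)"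
      by (simp_all add: ab)
    ultimately have "(of_int (vx + - x), of_int (vy + - y)) \<in> integer_hull R"
      by (intro mem_hull) (simp only:)
    moreover have "(of_int (vx + x), of_int (vy + y)) \<in> integer_hull R"
      using ins unfolding ab by (rule mem_hull)
    ultimately have "(of_int x, of_int y) = (0 :: real \<times> real)"
      by (intro extreme_point_symmetric[OF extreme]) auto
    then show False using b by (simp add: ab zero_prod_def)
  qed
qed

text \<open>The displacement \<open>p\<close> to the next vertex and the final \<open>f\<close> are
  each extremal: the hull lies on one side of the edge, and no branch point with positive second
  coordinate lies beyond \<open>f\<close>. The two inequalities make them parallel, and as
  \<open>f\<close> belongs to a basis, \<open>p\<close> is an integer multiple of it. Extremality of
  \<open>w\<close> makes this the last multiple inside the branch. The formula for \<open>w\<close>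
  inverts the coordinate change by Cramer's rule.\<close>

lemma next_vertex_eq:
  assumes nv: "next_vertex d (integer_hull R) (of_int vx, of_int vy) w"
    and orient: "0 < orientation_sign d * (p1 * q2 - q1 * p2)"
    and I: "invar D fu fd gu gd" and final: "final_basis N U W (fu, fd, gu, gd)"
  defines "J \<equiv> exit_steps N U W (of_int fu) (of_int fd)"
  shows "w = (of_int vx + of_int \<lfloor>J * (of_int q2 * of_int fu + of_int q1 * of_int fd) / of_int (p1 * q2 - q1 * p2)\<rfloor>,
     of_int vy + of_int \<lfloor>- (J * (of_int p1 * of_int fd + of_int p2 * of_int fu)) / of_int (p1 * q2 - q1 * p2)\<rfloor>)"
proof -
  define v :: "real \<times> real" where "v = (of_int vx, of_int vy)"
  have w: "w extreme_point_of integer_hull R" and edge: "closed_segment v w edge_of integer_hull R"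
    using nv by (auto simp: next_vertex_def v_def)
  obtain x y where xy: "w = (of_int (vx + x), of_int (vy + y))"
  proof -
    obtain x' y' :: int where "w = (of_int x', of_int y')"
      using extreme_imp_region[OF w] by (auto elim!: Ints_cases)
    then show ?thesis using that[of "x' - vx" "y' - vy"] by simp
  qed
  define pu pd where "pu = x * p1 + y * q1" and "pd = x * (- p2) + y * (- q2)"
  have p: "ins pu pd" "(pu, pd) \<in> \<Lambda>"
    using extreme_imp_region[OF w] mem_region_iff[of x y] unfolding xy pu_def pd_def lattice_span_iff by auto
  have "v \<noteq> w"
  proof
    assume "v = w"
    then show False using edge by (simp add: edge_of_def)
  qed
  then have xy0: "x \<noteq> 0 \<or> y \<noteq> 0" by (auto simp: v_def xy)
  have x_det: "q2 * pu + q1 * pd = x * (p1 * q2 - q1 * p2)" and y_det: "- (p1 * pd + p2 * pu) = y * (p1 * q2 - q1 * p2)"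
    by (simp_all add: pu_def pd_def algebra_simps)
  have p0: "\<not> (pu = 0 \<and> pd = 0)" using x_det y_det xy0 det by auto
  have left: "pu * b \<le> pd * a" if "(a, b) \<in> \<Lambda>" "ins a b" for a b
  proof -
    obtain x' y' where ab: "a = x' * p1 + y' * q1" "b = x' * (- p2) + y' * (- q2)"
      using \<open>(a, b) \<in> \<Lambda>\<close> by (auto simp: lattice_span_iff)
    have "turn v w (of_int (vx + x'), of_int (vy + y')) = of_int (x * y' - y * x')"
      by (simp add: turn_def v_def xy)
    moreover have "0 \<le> of_int (orientation_sign d) * turn v w (of_int (vx + x'), of_int (vy + y'))"
      using next_vertex_turn[OF nv mem_hull] that(2) unfolding ab v_def by blast
    ultimately have "0 \<le> orientation_sign d * (x * y' - y * x')"
      by (metis of_int_0_le_iff of_int_mult)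
    then have "0 \<le> (orientation_sign d * (p1 * q2 - q1 * p2)) * (orientation_sign d * (x * y' - y * x'))"
      using orient by (meson mult_nonneg_nonneg less_imp_le)
    also have "\<dots> = (p1 * q2 - q1 * p2) * (x * y' - y * x')" by (cases d) (simp_all add: algebra_simps)
    also have "\<dots> = pd * a - pu * b" by (simp add: pu_def pd_def ab algebra_simps)
    finally show ?thesis by simp
  qed
  define e where "e = \<bar>p1 * q2 - q1 * p2\<bar>"
  have e: "0 < e" using det by (simp add: e_def)
  have e\<Lambda>: "(i * e, j * e) \<in> \<Lambda>" for i j
  proof -
    define s where "s = - sgn (p1 * q2 - q1 * p2)"
    have "e = s * (p1 * (- q2) - (- p2) * q1)" by (simp add: e_def s_def abs_sgn algebra_simps)
    then show ?thesis using lattice_span_det[of "i * s" p1 "- q2" "- p2" q1 "j * s"] by (simp only: mult.assoc)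
  qed
  \<comment> \<open>These two axis points always belong to the branch; having them on the hull side
    of the edge fixes the signs of \<open>pu\<close> and \<open>pd\<close>.\<close>
  have "ins 0 (- e)" "ins e 0" using e in_branch_mono[OF in0] by simp_all
  then have "pu * (- e) \<le> pd * 0" "pu * 0 \<le> pd * e"
    using left[of 0 "- e"] left[of e 0] e\<Lambda>[of 0 "-1"] e\<Lambda>[of 1 0] by auto
  then have nonneg: "0 \<le> pu" "0 \<le> pd" using e by (auto simp: mult_le_0_iff zero_le_mult_iff)
  have between: False if "(a, b) \<in> \<Lambda>" "\<not> (a = 0 \<and> b = 0)" "ins (pu + a) (pd + b)" "ins (pu - a) (pd - b)" for a b
  proof -
    obtain x' y' where ab: "a = x' * p1 + y' * q1" "b = x' * (- p2) + y' * (- q2)"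
      using \<open>(a, b) \<in> \<Lambda>\<close> by (auto simp: lattice_span_iff)
    have "pu + a = (x + x') * p1 + (y + y') * q1" "pd + b = (x + x') * (- p2) + (y + y') * (- q2)"
      "pu - a = (x - x') * p1 + (y - y') * q1" "pd - b = (x - x') * (- p2) + (y - y') * (- q2)"
      by (simp_all add: pu_def pd_def ab algebra_simps)
    then have "(of_int (vx + (x + x')), of_int (vy + (y + y'))) \<in> integer_hull R"
      "(of_int (vx + (x - x')), of_int (vy + (y - y'))) \<in> integer_hull R"
      using that(3,4) by (auto intro!: mem_hull simp only:)
    then have "(of_int x', of_int y') = (0 :: real \<times> real)"
      by (intro extreme_point_symmetric[OF w]) (simp_all add: xy algebra_simps)
    then show False using that(2) by (simp add: ab zero_prod_def)
  qed
  \<comment> \<open>On the axis \<open>d = 0\<close> the branch is never left, so twice the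
    displacement also stays inside and \<open>w\<close> would be a midpoint.\<close>
  have "pd \<noteq> 0"
  proof
    assume "pd = 0"
    moreover have "ins (pu + pu) 0" using p(1) nonneg \<open>pd = 0\<close> in_branch_mono[OF in0] by simp
    ultimately show False using between[OF p(2) p0] in0 by simp
  qed
  then have pd: "0 < pd" using nonneg by simp
  have f: "lattice_span fu fd gu gd = \<Lambda>" "fu * gd - fd * gu = D" "0 < D" "0 < fu" "0 \<le> fd" "ins fu fd"
    using I by (auto simp: invar_def pre_invar_def)
  have f\<Lambda>: "(fu, fd) \<in> \<Lambda>" unfolding f(1)[symmetric] lattice_span_iff by (metis add.right_neutral mult_1 mult_zero_left)
  have none: "\<not> ins (gu + k * fu) (gd + k * fd)" if "0 \<le> k" for k
    using final_basis_cases[OF I] final that by metis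
  have "fu * pd \<le> fd * pu" by (rule right_of_terminal[OF I none p(2,1) pd])
  moreover have "pu * fd \<le> pd * fu" by (rule left[OF f\<Lambda> f(6)])
  ultimately have parallel: "fu * pd - fd * pu = 0" by (simp add: mult.commute)
  obtain i j where ij: "pu = i * fu + j * gu" "pd = i * fd + j * gd"
    using p(2) unfolding f(1)[symmetric] by (auto simp: lattice_span_iff)
  have "fu * pd - fd * pu = j * D" by (simp add: ij f(2)[symmetric] algebra_simps)
  then have "j = 0" using parallel f by simp
  then have pf: "pu = i * fu" "pd = i * fd" using ij by auto
  have i: "1 \<le> i" and fd: "0 < fd" using pd f(5) unfolding pf by (auto simp: zero_less_mult_iff)
  obtain m where m: "J = of_int m" "0 \<le> m" "ins (m * fu) (m * fd)" "\<not> ins ((m + 1) * fu) ((m + 1) * fd)"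
    using exit_steps[OF N_pos in0 fd, of fu] unfolding J_def by blast
  have "i \<le> m"
  proof (rule ccontr)
    assume "\<not> i \<le> m"
    then show False using ins_between[of 0 0 fu 0 fd i "m + 1"] m in0 p(1) pf by simp
  qed
  \<comment> \<open>For \<open>i < m\<close> the extreme point \<open>w\<close> would be the
    midpoint of the points reached by \<open>i - 1\<close> and \<open>i + 1\<close> copies of
    \<open>f\<close>.\<close>
  have "i = m"
  proof (rule ccontr)
    assume "i \<noteq> m"
    have "ins (0 + (i + 1) * fu) (0 + (i + 1) * fd)"
      by (rule ins_between[of 0 0 fu 0 fd m]) (use in0 m i \<open>i \<le> m\<close> \<open>i \<noteq> m\<close> in simp_all)
    moreover have "ins (0 + (i - 1) * fu) (0 + (i - 1) * fd)"
      by (rule ins_between[of 0 0 fu 0 fd m]) (use in0 m i \<open>i \<le> m\<close> in simp_all)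
    ultimately show False
      using between[OF f\<Lambda>] fd by (simp add: pf algebra_simps)
  qed
  then have "J * (of_int q2 * of_int fu + of_int q1 * of_int fd) = of_int (q2 * pu + q1 * pd)"
    "- (J * (of_int p1 * of_int fd + of_int p2 * of_int fu)) = of_int (- (p1 * pd + p2 * pu))"
    by (simp_all add: m(1) pf algebra_simps)
  \<comment> \<open>The divisions recover the integer displacement exactly, so the floors change
    nothing.\<close>
  moreover have "of_int (z * (p1 * q2 - q1 * p2)) / of_int (p1 * q2 - q1 * p2) = (of_int z :: real)" for z
    unfolding of_int_mult[of z] using det by (intro nonzero_mult_div_cancel_right) (simp only: of_int_eq_0_iff not_False_eq_True)
  ultimately show ?thesis unfolding x_det y_det xy by (simp only: floor_of_int of_int_add)
qed

end

section \<open>Euclidean reduction to a basis with one vector on an axis\<close>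

fun euclid_step :: "int \<times> int \<times> int \<times> int \<Rightarrow> int \<times> int \<times> int \<times> int" where
  "euclid_step (fu, fd, gu, gd) = (gu - gd div fd * fu, gd - gd div fd * fd, fu, fd)"

text \<open>Once \<open>fd \<le> gd\<close>, the quotient is at least 1, so \<open>gd\<close> is at
  least twice the remainder and the product of the second coordinates at least halves in each step.
  Initially \<open>gd\<close> may be smaller or negative; one division restores the order, which
  gives the unconditional bound \<open>4 * fd\<^sup>2\<close>.\<close>

lemma euclid_terminates:
  assumes "0 < fd"
  shows "\<exists>m fu' gu' gd'. (euclid_step ^^ m) (fu, fd, gu, gd) = (fu', 0, gu', gd') \<and>
    (\<forall>l<m. fst (snd ((euclid_step ^^ l) (fu, fd, gu, gd))) \<noteq> 0) \<and>
    lattice_span fu' 0 gu' gd' = lattice_span fu fd gu gd \<and> \<bar>fu' * gd'\<bar> = \<bar>fu * gd - fd * gu\<bar> \<and>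
    2 ^ m \<le> 4 * fd\<^sup>2 \<and> (fd \<le> gd \<longrightarrow> 2 ^ m \<le> 2 * (fd * gd))"
  using assms
proof (induction "nat fd" arbitrary: fu fd gu gd rule: less_induct)
  case less
  define k where "k = gd div fd"
  define hu hd where "hu = gu - k * fu" and "hd = gd - k * fd"
  have hd: "hd = gd mod fd" by (simp add: hd_def k_def minus_div_mult_eq_mod)
  then have hd_bounds: "0 \<le> hd" "hd < fd" using less.prems by auto
  have step: "euclid_step (fu, fd, gu, gd) = (hu, hd, fu, fd)" by (simp add: hu_def hd_def k_def)
  have \<Lambda>: "lattice_span hu hd fu fd = lattice_span fu fd gu gd"
    using lattice_span_add_right[of fu fd gu "- k" gd] by (simp add: hu_def hd_def lattice_span_swap)
  have det: "\<bar>hu * fd - hd * fu\<bar> = \<bar>fu * gd - fd * gu\<bar>"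
  proof -
    have "hu * fd - hd * fu = - (fu * gd - fd * gu)" by (simp add: hu_def hd_def algebra_simps)
    then show ?thesis by (simp only: abs_minus_cancel)
  qed
  have sq: "1 \<le> fd\<^sup>2" using less.prems by simp
  have prod: "1 \<le> fd * gd" if "fd \<le> gd"
    using less.prems that by (simp add: int_one_le_iff_zero_less)
  show ?case
  proof (cases "hd = 0")
    case True
    have "2 ^ 1 \<le> 4 * fd\<^sup>2 \<and> (fd \<le> gd \<longrightarrow> 2 ^ 1 \<le> 2 * (fd * gd))" using sq prod by auto
    moreover have "(euclid_step ^^ 1) (fu, fd, gu, gd) = (hu, 0, fu, fd)" using step True by simp
    moreover have "\<forall>l<1. fst (snd ((euclid_step ^^ l) (fu, fd, gu, gd))) \<noteq> 0" using less.prems by simp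
    moreover have "lattice_span hu 0 fu fd = lattice_span fu fd gu gd \<and> \<bar>hu * fd\<bar> = \<bar>fu * gd - fd * gu\<bar>"
      using \<Lambda> det True by simp
    ultimately show ?thesis by blast
  next
    case False
    then have "0 < hd" "nat hd < nat fd" using hd_bounds less.prems by auto
    from less.hyps[OF this(2,1), of hu fu fd] obtain m fu' gu' gd' where
      m: "(euclid_step ^^ m) (hu, hd, fu, fd) = (fu', 0, gu', gd')"
      "\<forall>l<m. fst (snd ((euclid_step ^^ l) (hu, hd, fu, fd))) \<noteq> 0"
      "lattice_span fu' 0 gu' gd' = lattice_span hu hd fu fd" "\<bar>fu' * gd'\<bar> = \<bar>hu * fd - hd * fu\<bar>"
      "hd \<le> fd \<longrightarrow> 2 ^ m \<le> 2 * (hd * fd)" by blast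
    have m2: "2 ^ m \<le> 2 * (hd * fd)" using m(5) hd_bounds by simp
    have "fst (snd ((euclid_step ^^ l) (fu, fd, gu, gd))) \<noteq> 0" if "l < Suc m" for l
    proof (cases l)
      case 0
      then show ?thesis using less.prems by simp
    next
      case (Suc l')
      then show ?thesis using m(2) that step by (simp add: funpow_Suc_right del: funpow.simps euclid_step.simps)
    qed
    moreover have "(euclid_step ^^ Suc m) (fu, fd, gu, gd) = (fu', 0, gu', gd')"
      using m(1) step by (simp add: funpow_Suc_right del: funpow.simps euclid_step.simps)
    moreover have "2 ^ Suc m \<le> 4 * fd\<^sup>2"
    proof -
      have "hd * fd \<le> fd * fd" using hd_bounds less.prems by (intro mult_right_mono) auto
      then show ?thesis using m2 by (simp add: power2_eq_square)
    qed
    moreover have "2 ^ Suc m \<le> 2 * (fd * gd)" if "fd \<le> gd"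
    proof -
      have "1 \<le> k" using that less.prems by (simp add: k_def pos_imp_zdiv_pos_iff int_one_le_iff_zero_less)
      then have "1 * fd \<le> k * fd" using less.prems by (intro mult_right_mono) auto
      then have "2 * hd \<le> gd" using hd_bounds unfolding hd_def right_diff_distrib by linarith
      then have "2 * hd * fd \<le> gd * fd" using less.prems by (intro mult_right_mono) auto
      then show ?thesis using m2 by (simp add: mult.commute)
    qed
    ultimately show ?thesis using m(3,4) \<Lambda> det by (intro exI[of _ "Suc m"] exI[of _ fu'] exI[of _ gu'] exI[of _ gd']) simp
  qed
qed

section \<open>The program\<close>

text \<open>Unlike \<open>sgn\<close> it is never 0, so multiplying a lattice vector by it preserves
  the span even when the tested number vanishes.\<close>

definition sign1 :: "real \<Rightarrow> real" where
  "sign1 x = (if x < 0 then -1 else 1)"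

lemma computable_sign1: "computable m e \<Longrightarrow> computable m (\<lambda>s. sign1 (e s))"
  unfolding sign1_def by (intro computable_intros)

lemma sign1_mult_self: "sign1 x * x = \<bar>x\<bar>"
  by (simp add: sign1_def)

lemma sign1_of_int: "sign1 (of_int i) = of_int (if i < 0 then -1 else 1)"
  by (simp add: sign1_def)

text \<open>
  Memory layout: cells 0--7 hold the input, 8 holds \<open>\<Delta>\<close>, 9--10 and 11--12 the coefficients of the two
  linear factors, 13 the constant \<open>N\<close>, 14 and 15 the values \<open>U\<close> and \<open>W\<close> of the factors at \<open>v\<close>,
  17--20 the basis \<open>f, g\<close>, and 21 the loop flag.  Cell 16 is never written and supplies the 0
  for the loop tests.
\<close>

definition load_discriminant :: "store \<Rightarrow> store" where
  "load_discriminant s = s(8 := of_int \<lfloor>sqrt ((s 1)\<^sup>2 - 4 * s 0 * s 2)\<rfloor>)"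

definition load_factors :: "store \<Rightarrow> store" where
  "load_factors s = s(9 := if s 0 = 0 then 0 else 2 * s 0, 10 := if s 0 = 0 then 1 else s 1 + s 8,
     11 := if s 0 = 0 then s 1 else 2 * s 0, 12 := if s 0 = 0 then s 2 else s 1 - s 8,
     13 := if s 0 = 0 then s 3 else 4 * s 0 * s 3)"

definition load_position :: "store \<Rightarrow> store" where
  "load_position s = s(14 := s 9 * (s 6 - s 4) + s 10 * (s 7 - s 5),
     15 := s 11 * (s 6 - s 4) + s 12 * (s 7 - s 5))"

definition normalize_signs :: "store \<Rightarrow> store" where
  "normalize_signs s = s(9 := sign1 (s 14) * s 9, 10 := sign1 (s 14) * s 10, 14 := sign1 (s 14) * s 14,
     11 := sign1 (s 15) * s 11, 12 := sign1 (s 15) * s 12, 15 := sign1 (s 15) * s 15,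
     13 := sign1 (s 13) * s 13)"

text \<open>Exchanging the two factors mirrors the coordinate system. Both orientations thereby
  reduce to the one search direction in which the second factor decreases.\<close>

definition orient_factors :: "orientation \<Rightarrow> store \<Rightarrow> store" where
  "orient_factors d s = (if of_int (orientation_sign d) * (s 9 * s 12 - s 10 * s 11) < 0
     then s(9 := s 11, 10 := s 12, 11 := s 9, 12 := s 10, 14 := s 15, 15 := s 14) else s)"

definition load_generators :: "store \<Rightarrow> store" where
  "load_generators s = s(17 := sign1 (- s 11) * s 9, 18 := sign1 (- s 11) * (- s 11), 19 := s 10, 20 := - s 12)"

definition euclid_body :: "store \<Rightarrow> store" where
  "euclid_body s = s(17 := s 19 - of_int \<lfloor>s 20 / s 18\<rfloor> * s 17, 18 := s 20 - of_int \<lfloor>s 20 / s 18\<rfloor> * s 18,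
     19 := s 17, 20 := s 18)"

definition normalize_basis :: "store \<Rightarrow> store" where
  "normalize_basis s = s(17 := sign1 (s 17) * s 17, 19 := sign1 (s 20) * s 19, 20 := sign1 (s 20) * s 20)"

text \<open>Brings the first coordinate of \<open>g\<close> into the interval from
  \<open>- fu\<close> (excluded) to 0. It has to be nonpositive for the initial invariant, and the
  lower end keeps its absolute value below \<open>D\<close>.\<close>

definition reduce_basis :: "store \<Rightarrow> store" where
  "reduce_basis s = s(19 := s 19 + of_int \<lfloor>- s 19 / s 17\<rfloor> * s 17)"

definition first_exit :: "store \<Rightarrow> store" where
  "first_exit s = s(17 := s 17 + exit_steps (s 13) (s 14 + s 17) (s 15 - s 18) (s 19) (s 20) * s 19,
     18 := s 18 + exit_steps (s 13) (s 14 + s 17) (s 15 - s 18) (s 19) (s 20) * s 20, 21 := 1)"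

definition search_body :: "store \<Rightarrow> store" where
  "search_body s =
    (let k = entry_steps (s 13) (s 14 + s 19) (s 15 - s 20) (s 17) (s 18);
         gu = s 19 + (k - 1) * s 17; gd = s 20 + (k - 1) * s 18;
         j = exit_steps (s 13) (s 14 + (s 17 + gu)) (s 15 - (s 18 + gd)) gu gd
     in if k = 0 then s(21 := 0)
        else s(17 := s 17 + gu + j * gu, 18 := s 18 + gd + j * gd, 19 := gu, 20 := gd))"

definition output_vertex :: "store \<Rightarrow> store" where
  "output_vertex s =
    (let j = exit_steps (s 13) (s 14) (s 15) (s 17) (s 18); e = s 9 * s 12 - s 10 * s 11
     in s(0 := s 6 + of_int \<lfloor>j * (s 12 * s 17 + s 10 * s 18) / e\<rfloor>,
          1 := s 7 + of_int \<lfloor>- (j * (s 9 * s 18 + s 11 * s 17)) / e\<rfloor>))"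

definition cells :: nat where "cells = 22"

lemmas program_intros = stage_intros computable_sign1 computable_exit_steps computable_entry_steps computable_of_int

lemma stages:
  "stage cells load_discriminant" "stage cells load_factors" "stage cells load_position"
  "stage cells normalize_signs" "stage cells (orient_factors d)" "stage cells load_generators"
  "stage cells euclid_body" "stage cells normalize_basis" "stage cells reduce_basis"
  "stage cells first_exit" "stage cells search_body" "stage cells output_vertex"
  unfolding load_discriminant_def load_factors_def load_position_def normalize_signs_def
    orient_factors_def load_generators_def euclid_body_def normalize_basis_def reduce_basis_def
    first_exit_def search_body_def output_vertex_def Let_def
  by ((intro program_intros; simp add: cells_def; fail)+)

text \<open>Completing the square factors \<open>4 * a\<close> times the form; for
  \<open>a = 0\<close> the form is \<open>y * (b * x + c * y)\<close>, where
  \<open>b \<noteq> 0\<close> because \<Delta> > 0. A nonzero integer among \<open>a\<close>,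
  \<open>b\<close> gives \<open>1 \<le> M\<close>. The bound 4M comes from
  \<open>\<Delta>\<^sup>2 \<le> 5 * M\<^sup>2\<close>, relaxed to \<Delta> \<le> 3M.\<close>

lemma rational_factorization:
  fixes a b c \<Delta> :: real
  assumes \<Delta>: "\<Delta> = sqrt (b\<^sup>2 - 4 * a * c)" "0 < \<Delta>"
    and ints: "a \<in> \<int>" "b \<in> \<int>" "c \<in> \<int>" "\<Delta> \<in> \<int>"
    and M: "\<bar>a\<bar> \<le> M" "\<bar>b\<bar> \<le> M" "\<bar>c\<bar> \<le> M"
  defines "p1 \<equiv> if a = 0 then 0 else 2 * a" and "q1 \<equiv> if a = 0 then 1 else b + \<Delta>"
    and "p2 \<equiv> if a = 0 then b else 2 * a" and "q2 \<equiv> if a = 0 then c else b - \<Delta>"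
    and "\<kappa> \<equiv> if a = 0 then 1 else 4 * a"
  shows "\<kappa> * (a * x\<^sup>2 + b * x * y + c * y\<^sup>2) = (p1 * x + q1 * y) * (p2 * x + q2 * y)"
    "p1 * q2 - q1 * p2 \<noteq> 0" "\<kappa> \<noteq> 0" "1 \<le> M" "\<bar>\<kappa>\<bar> \<le> 4 * M"
    "p1 \<in> \<int> \<and> \<bar>p1\<bar> \<le> 4 * M" "q1 \<in> \<int> \<and> \<bar>q1\<bar> \<le> 4 * M" "p2 \<in> \<int> \<and> \<bar>p2\<bar> \<le> 4 * M" "q2 \<in> \<int> \<and> \<bar>q2\<bar> \<le> 4 * M"
proof -
  have "0 < b\<^sup>2 - 4 * a * c" using \<Delta> by simp
  then have \<Delta>2: "\<Delta>\<^sup>2 = b\<^sup>2 - 4 * a * c" using \<Delta>(1) by simp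
  show factor: "\<kappa> * (a * x\<^sup>2 + b * x * y + c * y\<^sup>2) = (p1 * x + q1 * y) * (p2 * x + q2 * y)"
  proof (cases "a = 0")
    case False
    have "(2 * a * x + (b + \<Delta>) * y) * (2 * a * x + (b - \<Delta>) * y)
        = 4 * a\<^sup>2 * x\<^sup>2 + 4 * a * b * x * y + (b\<^sup>2 - \<Delta>\<^sup>2) * y\<^sup>2"
      by (simp add: power2_eq_square algebra_simps)
    also have "\<dots> = 4 * a * (a * x\<^sup>2 + b * x * y + c * y\<^sup>2)"
      unfolding \<Delta>2 by (simp add: power2_eq_square algebra_simps)
    finally show ?thesis using False by (simp add: p1_def q1_def p2_def q2_def \<kappa>_def)
  qed (simp add: p1_def q1_def p2_def q2_def \<kappa>_def power2_eq_square algebra_simps)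
  have b: "b \<noteq> 0" if "a = 0" using that \<Delta>2 \<Delta>(2) by auto
  show "p1 * q2 - q1 * p2 \<noteq> 0"
  proof (cases "a = 0")
    case False
    have "2 * a * (b - \<Delta>) - (b + \<Delta>) * (2 * a) = - 4 * a * \<Delta>" by (simp add: algebra_simps)
    then show ?thesis using False \<Delta>(2) by (simp add: p1_def q1_def p2_def q2_def)
  qed (use b in \<open>simp add: p1_def q1_def p2_def q2_def\<close>)
  show "\<kappa> \<noteq> 0" by (simp add: \<kappa>_def)
  show M1: "1 \<le> M"
  proof (cases "a = 0")
    case True
    then have "1 \<le> \<bar>b\<bar>" using b ints(2) by (metis Ints_nonzero_abs_ge1)
    then show ?thesis using M by linarith
  next
    case False
    then have "1 \<le> \<bar>a\<bar>" using ints(1) by (metis Ints_nonzero_abs_ge1)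
    then show ?thesis using M by linarith
  qed
  have "\<bar>a * c\<bar> \<le> M * M" unfolding abs_mult by (intro mult_mono M) (use M1 in simp_all)
  then have ac: "- (M * M) \<le> a * c" by (simp add: abs_le_iff)
  have "\<bar>b\<bar> * \<bar>b\<bar> \<le> M * M" by (intro mult_mono M) (use M1 in simp_all)
  then have bb: "b\<^sup>2 \<le> M * M" by (simp add: power2_eq_square)
  have "0 \<le> M * M" "(3 * M)\<^sup>2 = 9 * (M * M)" "\<Delta>\<^sup>2 = b\<^sup>2 - 4 * (a * c)"
    using \<Delta>2 by (simp_all add: power2_eq_square)
  then have "\<Delta>\<^sup>2 \<le> (3 * M)\<^sup>2" using ac bb by linarith
  then have \<Delta>M: "\<Delta> \<le> 3 * M" by (rule power2_le_imp_le) (use M1 in simp)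
  show "\<bar>\<kappa>\<bar> \<le> 4 * M" using M M1 by (simp add: \<kappa>_def abs_mult)
  show "p1 \<in> \<int> \<and> \<bar>p1\<bar> \<le> 4 * M" "p2 \<in> \<int> \<and> \<bar>p2\<bar> \<le> 4 * M"
    using M M1 ints by (auto simp: p1_def p2_def abs_mult)
  show "q1 \<in> \<int> \<and> \<bar>q1\<bar> \<le> 4 * M" "q2 \<in> \<int> \<and> \<bar>q2\<bar> \<le> 4 * M"
    using M M1 ints \<Delta>M \<Delta>(2) by (auto simp: q1_def q2_def)
qed

definition prologue :: "orientation \<Rightarrow> store \<Rightarrow> store" where
  "prologue d s = orient_factors d (normalize_signs (load_position (load_factors (load_discriminant s))))"

lemma branch_region_swap: "branch_region p2 q2 p1 q1 x0 y0 N = branch_region p1 q1 p2 q2 x0 y0 N"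
  unfolding branch_region_def by (auto simp: mult.commute)

lemma prologue:
  fixes d :: orientation and a b c n x0 y0 \<Delta> :: real and v :: "real \<times> real"
  assumes n: "n \<noteq> 0" and \<Delta>: "\<Delta> = sqrt (b\<^sup>2 - 4 * a * c)" "0 < \<Delta>"
    and ints: "a \<in> \<int>" "b \<in> \<int>" "c \<in> \<int>" "\<Delta> \<in> \<int>"
    and C: "C \<in> components (- hyperbola a b c n x0 y0)" "convex C"
    and v: "v extreme_point_of integer_hull (closure C)"
    and M: "\<bar>a\<bar> \<le> M" "\<bar>b\<bar> \<le> M" "\<bar>c\<bar> \<le> M" "\<bar>n\<bar> \<le> M"
  defines "s \<equiv> prologue d (input_store [a, b, c, n, x0, y0, fst v, snd v])"
  obtains p1 q1 p2 q2 vx vy :: int and N :: real where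
    "1 \<le> M" "closure C = branch_region p1 q1 p2 q2 x0 y0 N" "v = (of_int vx, of_int vy)"
    "hyperbola_vertex p1 q1 p2 q2 vx vy x0 y0 N" "0 < orientation_sign d * (p1 * q2 - q1 * p2)"
    "s 6 = of_int vx" "s 7 = of_int vy" "s 9 = of_int p1" "s 10 = of_int q1" "s 11 = of_int p2" "s 12 = of_int q2"
    "s 13 = N" "s 14 = of_int p1 * (of_int vx - x0) + of_int q1 * (of_int vy - y0)"
    "s 15 = of_int p2 * (of_int vx - x0) + of_int q2 * (of_int vy - y0)" "s 16 = 0"
    "\<bar>of_int p1\<bar> \<le> 4 * M" "\<bar>of_int q1\<bar> \<le> 4 * M" "\<bar>of_int p2\<bar> \<le> 4 * M" "\<bar>of_int q2\<bar> \<le> 4 * M" "N \<le> 4 * M\<^sup>2"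
proof -
  define P1 where "P1 = (if a = 0 then 0 else 2 * a)"
  define Q1 where "Q1 = (if a = 0 then 1 else b + \<Delta>)"
  define P2 where "P2 = (if a = 0 then b else 2 * a)"
  define Q2 where "Q2 = (if a = 0 then c else b - \<Delta>)"
  define \<kappa> where "\<kappa> = (if a = 0 then 1 else 4 * a)"
  note defs = P1_def Q1_def P2_def Q2_def \<kappa>_def
  note fac = rational_factorization[OF \<Delta> ints M(1-3), folded defs]
  have "v \<in> closure C \<inter> \<int> \<times> \<int>"
    using v unfolding integer_hull_def by (rule extreme_point_of_convex_hull)
  then obtain vx vy :: int where vxy: "v = (of_int vx, of_int vy)" and vC: "v \<in> closure C"
    by (auto elim!: Ints_cases)
  define U0 where "U0 = P1 * (of_int vx - x0) + Q1 * (of_int vy - y0)"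
  define W0 where "W0 = P2 * (of_int vx - x0) + Q2 * (of_int vy - y0)"
  have comp: "U0 \<noteq> 0" "W0 \<noteq> 0"
    "closure C = {z. 0 < sgn U0 * (P1 * (fst z - x0) + Q1 * (snd z - y0)) \<and>
       0 < sgn W0 * (P2 * (fst z - x0) + Q2 * (snd z - y0)) \<and>
       \<bar>\<kappa> * n\<bar> \<le> (sgn U0 * (P1 * (fst z - x0) + Q1 * (snd z - y0))) * (sgn W0 * (P2 * (fst z - x0) + Q2 * (snd z - y0)))}"
    using closure_convex_component_hyperbola[OF fac(1) fac(2) n fac(3) C vC]
    by (simp_all only: vxy U0_def W0_def fst_conv snd_conv not_False_eq_True)
  define e1 e2 where "e1 = sign1 U0" and "e2 = sign1 W0"
  have e: "e1 = sgn U0" "e2 = sgn W0" "e1 = 1 \<or> e1 = -1" "e2 = 1 \<or> e2 = -1"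
    using comp(1,2) by (auto simp: e1_def e2_def sign1_def sgn_if)
  have e_int: "e1 * x \<in> \<int> \<and> \<bar>e1 * x\<bar> \<le> 4 * M" "e2 * x \<in> \<int> \<and> \<bar>e2 * x\<bar> \<le> 4 * M" if "x \<in> \<int> \<and> \<bar>x\<bar> \<le> 4 * M" for x
    using that e(3,4) by auto
  obtain p1 q1 p2 q2 :: int where pq: "e1 * P1 = of_int p1" "e1 * Q1 = of_int q1" "e2 * P2 = of_int p2" "e2 * Q2 = of_int q2"
    using e_int fac(6-9) by (metis Ints_cases)
  have pq_bound: "\<bar>of_int p1\<bar> \<le> 4 * M" "\<bar>of_int q1\<bar> \<le> 4 * M" "\<bar>of_int p2\<bar> \<le> 4 * M" "\<bar>of_int q2\<bar> \<le> 4 * M"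
    using e_int fac(6-9) unfolding pq[symmetric] by blast+
  define N where "N = \<bar>\<kappa> * n\<bar>"
  have N: "0 < N" using n fac(3) by (simp add: N_def)
  have "\<bar>\<kappa>\<bar> * \<bar>n\<bar> \<le> (4 * M) * M" using fac(5) M(4) by (intro mult_mono) auto
  then have N_bound: "N \<le> 4 * M\<^sup>2" by (simp add: N_def abs_mult power2_eq_square)
  have region: "closure C = branch_region p1 q1 p2 q2 x0 y0 N"
    unfolding comp(3) branch_region_def pq[symmetric] N_def e by (simp only: distrib_left mult.assoc)
  have "(of_int (p1 * q2 - q1 * p2) :: real) = e1 * e2 * (P1 * Q2 - Q1 * P2)"
    by (simp add: pq[symmetric] algebra_simps)
  moreover have "e1 * e2 * (P1 * Q2 - Q1 * P2) \<noteq> 0" using e(3,4) fac(2) by auto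
  ultimately have det: "p1 * q2 - q1 * p2 \<noteq> 0" by (metis of_int_0)
  define t where "t = normalize_signs (load_position (load_factors (load_discriminant (input_store [a, b, c, n, x0, y0, fst v, snd v]))))"
  \<comment> \<open>This is where the integrality of \<Delta> enters the program: the integer square
    root is exact.\<close>
  have sqrt: "of_int \<lfloor>sqrt (b\<^sup>2 - 4 * a * c)\<rfloor> = \<Delta>" using \<Delta>(1) ints(4) by (metis Ints_cases floor_of_int)
  define t0 where "t0 = load_position (load_factors (load_discriminant (input_store [a, b, c, n, x0, y0, fst v, snd v])))"
  have t0: "t0 6 = of_int vx" "t0 7 = of_int vy" "t0 9 = P1" "t0 10 = Q1" "t0 11 = P2" "t0 12 = Q2"
    "t0 13 = \<kappa> * n" "t0 16 = 0" "t0 14 = U0" "t0 15 = W0"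
    by (simp_all add: t0_def load_position_def load_factors_def load_discriminant_def input_store_def
        sqrt vxy defs U0_def W0_def)
  have t: "t 6 = of_int vx" "t 7 = of_int vy" "t 9 = of_int p1" "t 10 = of_int q1" "t 11 = of_int p2" "t 12 = of_int q2"
    "t 13 = N" "t 16 = 0" "t 14 = e1 * U0" "t 15 = e2 * W0"
    unfolding t_def t0_def[symmetric] normalize_signs_def
    by (simp_all add: t0 e1_def[symmetric] e2_def[symmetric] pq sign1_mult_self N_def)
  have UW: "e1 * U0 = of_int p1 * (of_int vx - x0) + of_int q1 * (of_int vy - y0)"
    "e2 * W0 = of_int p2 * (of_int vx - x0) + of_int q2 * (of_int vy - y0)"
    by (simp_all only: U0_def W0_def pq[symmetric] distrib_left mult.assoc)
  have s: "s = orient_factors d t" by (simp add: s_def prologue_def t_def)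
  have dets: "of_int (orientation_sign d) * (t 9 * t 12 - t 10 * t 11) = (of_int (orientation_sign d * (p1 * q2 - q1 * p2)) :: real)"
    by (simp add: t)
  have sign0: "orientation_sign d \<noteq> 0" by (cases d) auto
  show ?thesis
  proof (cases "orientation_sign d * (p1 * q2 - q1 * p2) < 0")
    case False
    then have st: "s = t" unfolding s orient_factors_def dets by (simp only: of_int_less_0_iff if_False)
    have orient: "0 < orientation_sign d * (p1 * q2 - q1 * p2)" using False det sign0
      by (metis linorder_neqE mult_eq_0_iff)
    have hv: "hyperbola_vertex p1 q1 p2 q2 vx vy x0 y0 N"
      using N det v unfolding region vxy by unfold_locales
    show ?thesis
      by (rule that[OF fac(4) region vxy hv orient]) (simp_all only: st t UW pq_bound N_bound)
  next
    case True
    then have s': "s = t(9 := t 11, 10 := t 12, 11 := t 9, 12 := t 10, 14 := t 15, 15 := t 14)"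
      unfolding s orient_factors_def dets by (simp only: of_int_less_0_iff if_True)
    have st: "s 6 = t 6" "s 7 = t 7" "s 9 = t 11" "s 10 = t 12" "s 11 = t 9" "s 12 = t 10" "s 13 = t 13"
      "s 14 = t 15" "s 15 = t 14" "s 16 = t 16"
      by (simp_all add: s')
    have orient: "0 < orientation_sign d * (p2 * q1 - q2 * p1)" using True by (simp add: algebra_simps)
    have region': "closure C = branch_region p2 q2 p1 q1 x0 y0 N"
      unfolding region by (rule branch_region_swap)
    have "p2 * q1 - q2 * p1 \<noteq> 0" using det by (simp add: algebra_simps)
    then have hv: "hyperbola_vertex p2 q2 p1 q1 vx vy x0 y0 N"
      using N v unfolding region' vxy by unfold_locales
    show ?thesis
      by (rule that[OF fac(4) region' vxy hv orient]) (simp_all only: st t UW pq_bound N_bound)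
  qed
qed

section \<open>Simulation of the integer bases in memory\<close>

fun represents :: "store \<Rightarrow> int \<times> int \<times> int \<times> int \<Rightarrow> bool" where
  "represents s (fu, fd, gu, gd) \<longleftrightarrow>
     s 17 = of_int fu \<and> s 18 = of_int fd \<and> s 19 = of_int gu \<and> s 20 = of_int gd"

lemma euclid_body_iterate:
  assumes "represents s st"
  shows "represents ((euclid_body ^^ m) s) ((euclid_step ^^ m) st)"
    "i < 17 \<Longrightarrow> (euclid_body ^^ m) s i = s i"
proof (induction m)
  case (Suc m)
  obtain fu fd gu gd where st: "(euclid_step ^^ m) st = (fu, fd, gu, gd)" by (metis prod_cases4)
  have "represents ((euclid_body ^^ m) s) (fu, fd, gu, gd)" using Suc.IH(1) st by simp
  then show "represents ((euclid_body ^^ Suc m) s) ((euclid_step ^^ Suc m) st)"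
    using st by (simp add: euclid_body_def[of "(euclid_body ^^ m) s"] floor_divide_of_int_eq)
  show "i < 17 \<Longrightarrow> (euclid_body ^^ Suc m) s i = s i" using Suc.IH(2) by (simp add: euclid_body_def[of "(euclid_body ^^ m) s"])
qed (use assms in auto)

text \<open>The summand 1 covers \<open>fd = 0\<close>, where the loop body is not executed and
  \<open>4 * fd\<^sup>2\<close> vanishes.\<close>

lemma euclid_phase:
  assumes "represents s (fu, fd, gu, gd)" "0 \<le> fd"
  obtains m fu' gu' gd' where "represents ((euclid_body ^^ m) s) (fu', 0, gu', gd')"
    "\<And>i. i < 17 \<Longrightarrow> (euclid_body ^^ m) s i = s i" "\<And>l. l < m \<Longrightarrow> (euclid_body ^^ l) s 18 \<noteq> 0"
    "lattice_span fu' 0 gu' gd' = lattice_span fu fd gu gd" "\<bar>fu' * gd'\<bar> = \<bar>fu * gd - fd * gu\<bar>"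
    "2 ^ m \<le> 4 * fd\<^sup>2 + 1"
proof (cases "fd = 0")
  case True
  then show ?thesis using assms by (intro that[of 0 fu gu gd]) auto
next
  case False
  then obtain m fu' gu' gd' where m: "(euclid_step ^^ m) (fu, fd, gu, gd) = (fu', 0, gu', gd')"
    "\<forall>l<m. fst (snd ((euclid_step ^^ l) (fu, fd, gu, gd))) \<noteq> 0"
    "lattice_span fu' 0 gu' gd' = lattice_span fu fd gu gd" "\<bar>fu' * gd'\<bar> = \<bar>fu * gd - fd * gu\<bar>"
    "2 ^ m \<le> 4 * fd\<^sup>2"
    using euclid_terminates[of fd fu gu gd] assms(2) by auto
  show ?thesis
  proof (rule that[of m fu' gu' gd'])
    show "represents ((euclid_body ^^ m) s) (fu', 0, gu', gd')"
      using euclid_body_iterate(1)[OF assms(1), of m] m(1) by simp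
    show "(euclid_body ^^ l) s 18 \<noteq> 0" if "l < m" for l
    proof -
      obtain a b c d where st: "(euclid_step ^^ l) (fu, fd, gu, gd) = (a, b, c, d)" by (metis prod_cases4)
      then have "represents ((euclid_body ^^ l) s) (a, b, c, d)"
        using euclid_body_iterate(1)[OF assms(1), of l] by simp
      moreover have "b \<noteq> 0" using m(2) that st by force
      ultimately show ?thesis by simp
    qed
    show "(euclid_body ^^ m) s i = s i" if "i < 17" for i
      using euclid_body_iterate(2)[OF assms(1) that] .
  qed (use m in auto)
qed

context branch_search
begin

lemma search_body_step:
  assumes s: "s 13 = N" "s 14 = U" "s 15 = W" and r: "represents s (fu, fd, gu, gd)"
    and I: "invar D fu fd gu gd" and nf: "\<not> final_basis N U W (fu, fd, gu, gd)"
  shows "represents (search_body s) (next_basis N U W (fu, fd, gu, gd))"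
    "search_body s 21 = s 21" "i < 17 \<Longrightarrow> search_body s i = s i"
proof -
  have "represents (search_body s) (next_basis N U W (fu, fd, gu, gd)) \<and> search_body s 21 = s 21 \<and>
      (i < 17 \<longrightarrow> search_body s i = s i)"
    using I
  proof (cases rule: final_basis_cases)
    case final
    then show ?thesis using nf by simp
  next
    case (step k j)
    define gu' gd' where g': "gu' = gu + (k - 1) * fu" "gd' = gd + (k - 1) * fd"
    have g'_real: "of_int gu' = of_int gu + (of_int k - 1) * (of_int fu :: real)"
      "of_int gd' = of_int gd + (of_int k - 1) * (of_int fd :: real)"
      by (simp_all add: g')
    have k: "entry_steps N (U + of_int gu) (W - of_int gd) (of_int fu) (of_int fd) = of_int k" by (rule step(2))
    have j: "exit_steps N (U + (of_int fu + of_int gu')) (W - (of_int fd + of_int gd')) (of_int gu') (of_int gd') = of_int j"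
      using step(4) unfolding g'[symmetric] of_int_add .
    have k0: "of_int k \<noteq> (0::real)" using step(3) by simp
    have r': "s 17 = of_int fu" "s 18 = of_int fd" "s 19 = of_int gu" "s 20 = of_int gd" using r by auto
    have body: "search_body s = s(17 := of_int (fu + gu' + j * gu'), 18 := of_int (fd + gd' + j * gd'),
        19 := of_int gu', 20 := of_int gd')"
      unfolding search_body_def Let_def s r' k g'_real[symmetric] j using k0 by simp
    show ?thesis unfolding step(6) g'[symmetric] body by simp
  qed
  then show "represents (search_body s) (next_basis N U W (fu, fd, gu, gd))"
    "search_body s 21 = s 21" "i < 17 \<Longrightarrow> search_body s i = s i" by auto
qed

lemma search_phase:
  assumes s: "s 13 = N" "s 14 = U" "s 15 = W" "s 21 = 1" and r: "represents s (fu, fd, gu, gd)"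
    and I: "invar D fu fd gu gd" and gu: "- gu < D"
  obtains m fu' fd' gu' gd' where "represents ((search_body ^^ Suc m) s) (fu', fd', gu', gd')"
    "\<And>i. i < 17 \<Longrightarrow> (search_body ^^ Suc m) s i = s i" "\<And>l. l < Suc m \<Longrightarrow> (search_body ^^ l) s 21 = 1"
    "(search_body ^^ Suc m) s 21 = 0"
    "invar D fu' fd' gu' gd'" "final_basis N U W (fu', fd', gu', gd')"
    "(2::real) ^ (2 * m) \<le> 8 * (of_int D)\<^sup>2 * (16 * (of_int D)\<^sup>2 + 6 * N + 1)"
proof -
  let ?st = "(fu, fd, gu, gd)"
  obtain m fu' fd' gu' gd' where m: "(next_basis N U W ^^ m) ?st = (fu', fd', gu', gd')"
    "invar D fu' fd' gu' gd'" "final_basis N U W (fu', fd', gu', gd')"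
    "\<forall>l<m. \<exists>a b c d. (next_basis N U W ^^ l) ?st = (a, b, c, d) \<and> invar D a b c d \<and> \<not> final_basis N U W (a, b, c, d)"
    "2 ^ m * (fd + 1) \<le> fd' + 1" "0 \<le> gu \<longrightarrow> 2 ^ m * fu \<le> fu'" "gu < 0 \<longrightarrow> 2 ^ m \<le> 2 * (- gu) * fu'"
    using search_terminates[OF I] by blast
  have iter: "represents ((search_body ^^ l) s) ((next_basis N U W ^^ l) ?st) \<and> (search_body ^^ l) s 21 = 1 \<and>
      (\<forall>i<17. (search_body ^^ l) s i = s i)" if "l \<le> m" for l
    using that
  proof (induction l)
    case 0
    then show ?case using r s by simp
  next
    case (Suc l)
    define t where "t = (search_body ^^ l) s"
    obtain a b c d where st: "(next_basis N U W ^^ l) ?st = (a, b, c, d)" "invar D a b c d"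
      "\<not> final_basis N U W (a, b, c, d)" using m(4) Suc.prems by (meson Suc_le_lessD)
    have t: "represents t (a, b, c, d)" "t 21 = 1" "\<forall>i<17. t i = s i"
      using Suc.IH Suc.prems st(1) by (auto simp: t_def)
    have t': "t 13 = N" "t 14 = U" "t 15 = W" using t(3) s by auto
    note step = search_body_step[OF t' t(1) st(2,3)]
    show ?case
      using step t by (simp add: st(1) t_def[symmetric] del: represents.simps next_basis.simps)
  qed
  define t where "t = (search_body ^^ m) s"
  have t: "represents t (fu', fd', gu', gd')" "t 21 = 1" "\<forall>i<17. t i = s i"
    using iter[of m] m(1) by (auto simp: t_def)
  \<comment> \<open>One further round detects that the basis is final and only clears the flag,
    whence \<open>Suc m\<close>.\<close>
  have "search_body t = t(21 := 0)"
    using m(3) t s by (simp add: search_body_def)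
  then have last: "(search_body ^^ Suc m) s = t(21 := 0)" by (simp add: t_def)
  show ?thesis
  proof (rule that[of m fu' fd' gu' gd'])
    show "(search_body ^^ l) s 21 = 1" if "l < Suc m" for l using iter[of l] that by simp
    show "(2::real) ^ (2 * m) \<le> 8 * (of_int D)\<^sup>2 * (16 * (of_int D)\<^sup>2 + 6 * N + 1)"
      by (rule search_steps_bound[OF I gu m(2,3,5-7)])
  qed (unfold last, use t m in auto)
qed

end

text \<open>Taking logarithms, with the crude estimates 1/2 for \<open>ln 2\<close> from below and
  \<open>A\<close> for \<open>ln A\<close> from above; writing \<open>1 + ln M\<close> keeps the
  bound meaningful for \<open>M = 1\<close>.\<close>

lemma exponent_le_log:
  fixes A M :: real
  assumes "2 ^ m \<le> (A * M) ^ r" "1 \<le> A" "1 \<le> M"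
  shows "real m \<le> 2 * real r * A * (1 + ln M)"
proof -
  have "real m * ln 2 = ln (2 ^ m)" by (simp add: ln_realpow)
  also have "\<dots> \<le> ln ((A * M) ^ r)" using assms by (intro ln_mono) auto
  also have "\<dots> = real r * (ln A + ln M)" using assms by (simp add: ln_realpow ln_mult)
  finally have *: "real m * ln 2 \<le> real r * (ln A + ln M)" .
  have "real m * (1 / 2) \<le> real m * ln 2" using ln2_ge_two_thirds by (intro mult_left_mono) auto
  then have "real m \<le> 2 * (real r * (ln A + ln M))" using * by linarith
  also have "\<dots> \<le> 2 * (real r * (A * (1 + ln M)))"
  proof (intro mult_left_mono)
    have "ln A \<le> A" using assms ln_le_minus_one[of A] by linarith
    moreover have "1 * ln M \<le> A * ln M" using assms by (intro mult_right_mono) auto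
    ultimately show "ln A + ln M \<le> A * (1 + ln M)" by (simp add: distrib_left)
  qed auto
  finally show ?thesis by (simp add: mult.assoc)
qed

lemma runs_prologue: "\<exists>P c. \<forall>s. runs cells P s c (prologue d s)"
proof -
  obtain P1 c1 P2 c2 P3 c3 P4 c4 P5 c5 where
    "\<forall>s. runs cells P1 s c1 (load_discriminant s)" "\<forall>s. runs cells P2 s c2 (load_factors s)"
    "\<forall>s. runs cells P3 s c3 (load_position s)" "\<forall>s. runs cells P4 s c4 (normalize_signs s)"
    "\<forall>s. runs cells P5 s c5 (orient_factors d s)"
    using stages(1-5)[THEN runs_stage] by metis
  then have "runs cells (Seq P1 (Seq P2 (Seq P3 (Seq P4 P5)))) s (c1 + (c2 + (c3 + (c4 + c5)))) (prologue d s)" for s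
    unfolding prologue_def by (intro runs_Seq) auto
  then show ?thesis by blast
qed

context hyperbola_vertex
begin

text \<open>The Euclidean loop leaves a triangular basis, whose determinant is the product
  \<open>F * H\<close> of the diagonal entries after the signs are fixed. Since
  \<open>H \<ge> 1\<close>, the reduction modulo \<open>F\<close> also gives
  \<open>- gu < D\<close>, as the round count requires.\<close>

lemma initial_basis:
  assumes s: "s 9 = of_int p1" "s 10 = of_int q1" "s 11 = of_int p2" "s 12 = of_int q2"
    "s 13 = N" "s 14 = U" "s 15 = W"
  defines "s1 \<equiv> load_generators s"
  obtains m D fu fd gu gd where
    "\<And>l. l < m \<Longrightarrow> (euclid_body ^^ l) s1 18 \<noteq> 0" "(euclid_body ^^ m) s1 18 = 0" "2 ^ m \<le> 4 * p2\<^sup>2 + 1"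
    "represents (first_exit (reduce_basis (normalize_basis ((euclid_body ^^ m) s1)))) (fu, fd, gu, gd)"
    "\<And>i. i < 17 \<Longrightarrow> first_exit (reduce_basis (normalize_basis ((euclid_body ^^ m) s1))) i = s i"
    "first_exit (reduce_basis (normalize_basis ((euclid_body ^^ m) s1))) 21 = 1"
    "invar D fu fd gu gd" "- gu < D" "D = \<bar>p1 * q2 - q1 * p2\<bar>"
proof -
  define e :: int where "e = (if - p2 < 0 then -1 else 1)"
  have e: "e = 1 \<or> e = -1" "e * (- p2) = \<bar>p2\<bar>" by (auto simp: e_def)
  have sign: "sign1 (- of_int p2) = of_int e" using sign1_of_int[of "- p2"] by (simp add: e_def)
  have r1: "represents s1 (e * p1, e * (- p2), q1, - q2)" and s1: "\<And>i. i < 17 \<Longrightarrow> s1 i = s i"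
    by (simp_all add: s1_def load_generators_def s sign)
  have span1: "lattice_span (e * p1) (e * (- p2)) q1 (- q2) = \<Lambda>"
    using e(1) lattice_span_minus_left[of p1 "- p2"] by auto
  have det1: "\<bar>e * p1 * (- q2) - e * (- p2) * q1\<bar> = \<bar>p1 * q2 - q1 * p2\<bar>"
  proof -
    have "e * p1 * (- q2) - e * (- p2) * q1 = - (e * (p1 * q2 - q1 * p2))" by (simp add: algebra_simps)
    moreover have "\<bar>e\<bar> = 1" using e(1) by auto
    ultimately show ?thesis by (simp only: abs_minus_cancel abs_mult mult_1)
  qed
  have "0 \<le> e * (- p2)" unfolding e(2) by simp
  from euclid_phase[OF r1 this] obtain m fu' gu' gd' where
    m: "represents ((euclid_body ^^ m) s1) (fu', 0, gu', gd')" "\<And>i. i < 17 \<Longrightarrow> (euclid_body ^^ m) s1 i = s1 i"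
    "\<And>l. l < m \<Longrightarrow> (euclid_body ^^ l) s1 18 \<noteq> 0" "lattice_span fu' 0 gu' gd' = \<Lambda>"
    "\<bar>fu' * gd'\<bar> = \<bar>p1 * q2 - q1 * p2\<bar>" "2 ^ m \<le> 4 * p2\<^sup>2 + 1"
    unfolding span1 det1 unfolding e(2) power2_abs by metis
  define s2 where "s2 = (euclid_body ^^ m) s1"
  have nz: "fu' \<noteq> 0" "gd' \<noteq> 0" using m(5) det by auto
  define \<epsilon> \<delta> :: int where "\<epsilon> = (if fu' < 0 then -1 else 1)" and "\<delta> = (if gd' < 0 then -1 else 1)"
  define F G H where "F = \<epsilon> * fu'" and "G = \<delta> * gu'" and "H = \<delta> * gd'"
  have FH: "0 < F" "0 < H" using nz by (auto simp: F_def H_def \<epsilon>_def \<delta>_def)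
  have span2: "lattice_span F 0 G H = \<Lambda>"
    using m(4) lattice_span_minus_left[of fu' 0] lattice_span_minus_right[of _ 0 gu' gd']
    by (auto simp: F_def G_def H_def \<epsilon>_def \<delta>_def)
  have D: "F * H = \<bar>p1 * q2 - q1 * p2\<bar>"
    using m(5)[symmetric] by (auto simp: F_def H_def \<epsilon>_def \<delta>_def abs_mult)
  define s3 where "s3 = normalize_basis s2"
  have r3: "represents s3 (F, 0, G, H)" and s3: "\<And>i. i < 17 \<Longrightarrow> s3 i = s2 i"
    using m(1) by (auto simp: s3_def s2_def[symmetric] normalize_basis_def sign1_of_int F_def G_def H_def \<epsilon>_def \<delta>_def)
  define k where "k = (- G) div F"
  define G' where "G' = G + k * F"
  have "- G' = (- G) mod F" by (simp add: G'_def k_def minus_div_mult_eq_mod[symmetric])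
  then have G': "G' \<le> 0" "- G' < F" using FH pos_mod_bound[of F "- G"] pos_mod_sign[of F "- G"] by linarith+
  define s4 where "s4 = reduce_basis s3"
  have "\<lfloor>- of_int G / (of_int F :: real)\<rfloor> = k"
    using floor_divide_of_int_eq[of "- G" F, where 'a = real] by (simp add: k_def)
  then have r4: "represents s4 (F, 0, G', H)" and s4: "\<And>i. i < 17 \<Longrightarrow> s4 i = s3 i"
    using r3 by (auto simp: s4_def reduce_basis_def G'_def)
  have "lattice_span F 0 G' H = \<Lambda>" using span2 lattice_span_add_right[of F 0 G k H] by (simp add: G'_def)
  from pre_invar_init[OF this FH(1) G'(1) FH(2)] have I: "pre_invar (F * H) F 0 G' H" .
  from exit_steps_invar[OF I] obtain j where
    j: "exit_steps N (U + of_int F) (W - of_int 0) (of_int G') (of_int H) = of_int j" "0 \<le> j"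
      "invar (F * H) (F + j * G') (0 + j * H) G' H" by blast
  have cells4: "s4 13 = N" "s4 14 = U" "s4 15 = W" using s s1 m(2) s3 s4 by (simp_all add: s2_def)
  have "F * 1 \<le> F * H" using FH by (intro mult_left_mono) auto
  then have bound: "- G' < F * H" using G' by linarith
  show ?thesis
  proof (rule that[of m "F + j * G'" "0 + j * H" G' H "F * H"])
    show "(euclid_body ^^ m) s1 18 = 0" using m(1) by simp
    show "represents (first_exit (reduce_basis (normalize_basis ((euclid_body ^^ m) s1)))) (F + j * G', 0 + j * H, G', H)"
      unfolding s2_def[symmetric] s3_def[symmetric] s4_def[symmetric]
      using r4 j(1) cells4 by (simp add: first_exit_def)
    show "first_exit (reduce_basis (normalize_basis ((euclid_body ^^ m) s1))) i = s i" if "i < 17" for i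
      unfolding s2_def[symmetric] s3_def[symmetric] s4_def[symmetric]
      using that s4 s3 m(2) s1 by (simp add: first_exit_def s2_def)
    show "first_exit (reduce_basis (normalize_basis ((euclid_body ^^ m) s1))) 21 = 1"
      by (simp add: first_exit_def)
  qed (use m(3,6) j(3) bound D in auto)
qed

lemma output_vertex_correct:
  assumes s: "s 6 = of_int vx" "s 7 = of_int vy" "s 9 = of_int p1" "s 10 = of_int q1" "s 11 = of_int p2" "s 12 = of_int q2"
    "s 13 = N" "s 14 = U" "s 15 = W" and r: "represents s (fu, fd, gu, gd)"
    and "next_vertex d (integer_hull R) (of_int vx, of_int vy) w"
    and "0 < orientation_sign d * (p1 * q2 - q1 * p2)" "invar D fu fd gu gd" "final_basis N U W (fu, fd, gu, gd)"
  shows "w = (output_vertex s 0, output_vertex s 1)"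
proof -
  have r': "s 17 = of_int fu" "s 18 = of_int fd" using r by auto
  have e: "of_int p1 * of_int q2 - of_int q1 * of_int p2 = (of_int (p1 * q2 - q1 * p2) :: real)" by simp
  show ?thesis
    unfolding next_vertex_eq[OF assms(11-14)] output_vertex_def Let_def s r' e by simp
qed

end

theorem theorem1p5:
  fixes d :: orientation
  shows "\<exists>(P :: prog) (C :: real).
    \<forall>(a :: real) (b :: real) (c :: real) (n :: real) (x0 :: real) (y0 :: real) (\<Delta> :: real)
     (U :: (real \<times> real) set) (H :: (real \<times> real) set) (v :: real \<times> real).
      n \<noteq> 0 \<longrightarrow>
      \<Delta> = sqrt (b\<^sup>2 - 4 * a * c) \<longrightarrow> \<Delta> > 0 \<longrightarrow>
      a \<in> \<int> \<longrightarrow> b \<in> \<int> \<longrightarrow> c \<in> \<int> \<longrightarrow> \<Delta> \<in> \<int> \<longrightarrow>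
      U \<in> components (- hyperbola a b c n x0 y0) \<longrightarrow> convex U \<longrightarrow> H = closure U \<longrightarrow>
      v extreme_point_of integer_hull H \<longrightarrow>
      (\<exists>(k :: nat) (t :: store).
         exec P (input_store [a, b, c, n, x0, y0, fst v, snd v]) k t \<and>
         real k \<le> C * (1 + ln (Max {\<bar>n\<bar>, \<bar>a\<bar>, \<bar>b\<bar>, \<bar>c\<bar>})) \<and>
         (\<forall>w. next_vertex d (integer_hull H) v w \<longrightarrow> w = (t 0, t 1)))"
proof -
  obtain Pp cp where Pp: "\<And>s. runs cells Pp s cp (prologue d s)" using runs_prologue by metis
  obtain Pg cg where Pg: "\<And>s. runs cells Pg s cg (load_generators s)" using runs_stage[OF stages(6)] by metis
  obtain Pe ce where Pe: "\<And>s. runs cells Pe s ce (euclid_body s)" using runs_stage[OF stages(7)] by metis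
  obtain Pn cn where Pn: "\<And>s. runs cells Pn s cn (normalize_basis s)" using runs_stage[OF stages(8)] by metis
  obtain Pr cr where Pr: "\<And>s. runs cells Pr s cr (reduce_basis s)" using runs_stage[OF stages(9)] by metis
  obtain Px cx where Px: "\<And>s. runs cells Px s cx (first_exit s)" using runs_stage[OF stages(10)] by metis
  obtain Ps cs where Ps: "\<And>s. runs cells Ps s cs (search_body s)" using runs_stage[OF stages(11)] by metis
  obtain Po co where Po: "\<And>s. runs cells Po s co (output_vertex s)" using runs_stage[OF stages(12)] by metis
  define P where "P = Seq Pp (Seq Pg (Seq (While (NE 18 16) Pe) (Seq Pn (Seq Pr (Seq Px (Seq (While (NE 21 16) Ps) Po))))))"
  \<comment> \<open>37 is 36 + 1 and 178 is 176 + 2, with 36 and 176 the factors in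
    \<open>m1_bound\<close> and \<open>m2_bound\<close>: each loop has a failing final test, and the
    search has one extra round that clears its flag.\<close>
  define C where "C = real (cp + cg + cn + cr + cx + co) + 37 * real (Suc ce) + 178 * real (Suc cs)"
  show ?thesis
  proof (rule exI[of _ P], rule exI[of _ C], intro allI impI)
    fix a b c n x0 y0 \<Delta> :: real and V H :: "(real \<times> real) set" and v :: "real \<times> real"
    assume hyps: "n \<noteq> 0" "\<Delta> = sqrt (b\<^sup>2 - 4 * a * c)" "\<Delta> > 0" "a \<in> \<int>" "b \<in> \<int>" "c \<in> \<int>" "\<Delta> \<in> \<int>"
      "V \<in> components (- hyperbola a b c n x0 y0)" "convex V" and H: "H = closure V"
      and v: "v extreme_point_of integer_hull H"
    define M where "M = Max {\<bar>n\<bar>, \<bar>a\<bar>, \<bar>b\<bar>, \<bar>c\<bar>}"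
    have M: "\<bar>a\<bar> \<le> M" "\<bar>b\<bar> \<le> M" "\<bar>c\<bar> \<le> M" "\<bar>n\<bar> \<le> M" unfolding M_def by (intro Max_ge; simp)+
    define s where "s = input_store [a, b, c, n, x0, y0, fst v, snd v]"
    define s0 where "s0 = prologue d s"
    from prologue[OF hyps v[unfolded H] M, of d, folded s_def, folded s0_def]
    obtain p1 q1 p2 q2 vx vy :: int and N :: real where M1: "1 \<le> M" and
      region: "closure V = branch_region p1 q1 p2 q2 x0 y0 N" and vxy: "v = (of_int vx, of_int vy)" and
      hv: "hyperbola_vertex p1 q1 p2 q2 vx vy x0 y0 N" and orient: "0 < orientation_sign d * (p1 * q2 - q1 * p2)" and
      s0: "s0 6 = of_int vx" "s0 7 = of_int vy" "s0 9 = of_int p1" "s0 10 = of_int q1" "s0 11 = of_int p2" "s0 12 = of_int q2"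
      "s0 13 = N" "s0 14 = of_int p1 * (of_int vx - x0) + of_int q1 * (of_int vy - y0)"
      "s0 15 = of_int p2 * (of_int vx - x0) + of_int q2 * (of_int vy - y0)" "s0 16 = 0" and
      pq: "\<bar>of_int p1\<bar> \<le> 4 * M" "\<bar>of_int q1\<bar> \<le> 4 * M" "\<bar>of_int p2\<bar> \<le> 4 * M" "\<bar>of_int q2\<bar> \<le> 4 * M" and NM: "N \<le> 4 * M\<^sup>2"
      by metis
    interpret hyperbola_vertex p1 q1 p2 q2 vx vy x0 y0 N by (rule hv)
    note s0' = s0(1-7) s0(8)[folded U_def] s0(9)[folded W_def]
    obtain m1 D fu fd gu gd where
      euclid: "\<And>l. l < m1 \<Longrightarrow> (euclid_body ^^ l) (load_generators s0) 18 \<noteq> 0"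
        "(euclid_body ^^ m1) (load_generators s0) 18 = 0" "2 ^ m1 \<le> 4 * p2\<^sup>2 + 1"
      and r: "represents (first_exit (reduce_basis (normalize_basis ((euclid_body ^^ m1) (load_generators s0))))) (fu, fd, gu, gd)"
      and keep: "\<And>i. i < 17 \<Longrightarrow> first_exit (reduce_basis (normalize_basis ((euclid_body ^^ m1) (load_generators s0)))) i = s0 i"
      and flag: "first_exit (reduce_basis (normalize_basis ((euclid_body ^^ m1) (load_generators s0)))) 21 = 1"
      and I: "invar D fu fd gu gd" "- gu < D" "D = \<bar>p1 * q2 - q1 * p2\<bar>"
      using initial_basis[OF s0'(3-9)] by metis
    define s1 where "s1 = load_generators s0"
    define s2 where "s2 = (euclid_body ^^ m1) s1"
    define s3 where "s3 = first_exit (reduce_basis (normalize_basis s2))"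
    note folds = s1_def[symmetric] s2_def[symmetric] s3_def[symmetric]
    note s3 = r[unfolded folds] flag[unfolded folds]
    have s3_keep: "s3 i = s0 i" if "i < 17" for i using keep[OF that] unfolding folds .
    have "s3 13 = N" "s3 14 = U" "s3 15 = W" using s3_keep s0' by simp_all
    from search_phase[OF this s3(2,1) I(1,2)] obtain m2 fu' fd' gu' gd' where
      search: "represents ((search_body ^^ Suc m2) s3) (fu', fd', gu', gd')"
        "\<And>i. i < 17 \<Longrightarrow> (search_body ^^ Suc m2) s3 i = s3 i"
        "\<And>l. l < Suc m2 \<Longrightarrow> (search_body ^^ l) s3 21 = 1" "(search_body ^^ Suc m2) s3 21 = 0"
      and fin: "invar D fu' fd' gu' gd'" "final_basis N U W (fu', fd', gu', gd')"
      and m2: "(2::real) ^ (2 * m2) \<le> 8 * (of_int D)\<^sup>2 * (16 * (of_int D)\<^sup>2 + 6 * N + 1)"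
      by metis
    define s4 where "s4 = (search_body ^^ Suc m2) s3"
    have s4_keep: "s4 i = s0 i" if "i < 17" for i
      using search(2)[OF that] s3_keep[OF that] by (simp add: s4_def del: funpow.simps)
    have euclid_zero: "(euclid_body ^^ l) s1 16 = 0" for l
    proof (induction l)
      case 0
      then show ?case by (simp add: s1_def load_generators_def s0)
    next
      case (Suc l)
      then show ?case by (simp add: euclid_body_def[of "(euclid_body ^^ l) s1"])
    qed
    have search_zero: "(search_body ^^ l) s3 16 = 0" for l
    proof (induction l)
      case 0
      then show ?case using s3_keep[of 16] s0 by simp
    next
      case (Suc l)
      then show ?case by (simp add: search_body_def[of "(search_body ^^ l) s3"] Let_def)
    qed
    have run_euclid: "runs cells (While (NE 18 16) Pe) s1 (Suc m1 * Suc ce) s2"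
      unfolding s2_def by (rule runs_While[OF Pe])
        (use euclid(1,2) euclid_zero in \<open>simp_all add: s1_def[symmetric] cells_def\<close>)
    have run_search: "runs cells (While (NE 21 16) Ps) s3 (Suc (Suc m2) * Suc cs) s4"
      unfolding s4_def by (rule runs_While[OF Ps])
        (use search(3,4) search_zero in \<open>simp_all add: cells_def del: funpow.simps\<close>)
    have "runs cells P s (cp + (cg + (Suc m1 * Suc ce + (cn + (cr + (cx + (Suc (Suc m2) * Suc cs + co))))))) (output_vertex s4)"
      unfolding P_def
      by (rule runs_Seq[OF Pp[of s, folded s0_def]], rule runs_Seq[OF Pg[of s0, folded s1_def]],
          rule runs_Seq[OF run_euclid], rule runs_Seq[OF Pn], rule runs_Seq[OF Pr],
          rule runs_Seq[OF Px[of "reduce_basis (normalize_basis s2)", folded s3_def]],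
          rule runs_Seq[OF run_search Po])
    then obtain k t where k: "exec P s k t"
      "k \<le> cp + (cg + (Suc m1 * Suc ce + (cn + (cr + (cx + (Suc (Suc m2) * Suc cs + co))))))"
      "agree cells t (output_vertex s4)"
      unfolding runs_def agree_def by blast
    have L: "0 \<le> ln M" using M1 by simp
    have D: "of_int D \<le> 32 * M\<^sup>2"
    proof -
      have "\<bar>of_int p1 * of_int q2\<bar> \<le> (4 * M) * (4 * M)" "\<bar>of_int q1 * of_int p2\<bar> \<le> (4 * M) * (4 * M)"
        unfolding abs_mult using pq M1 by (intro mult_mono; simp)+
      then show ?thesis by (simp add: I(3) power2_eq_square)
    qed
    have D0: "0 \<le> (of_int D :: real)" by (simp add: I(3))
    have m1_bound: "real m1 \<le> 36 * (1 + ln M)"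
    proof -
      have "(of_int (2 ^ m1) :: real) \<le> of_int (4 * p2\<^sup>2 + 1)" using euclid(3) by (simp only: of_int_le_iff)
      then have "2 ^ m1 \<le> 4 * (of_int p2)\<^sup>2 + (1::real)" by simp
      moreover have "(of_int p2)\<^sup>2 \<le> (4 * M)\<^sup>2" using pq(3) M1 by (intro abs_le_square_iff[THEN iffD1]) simp
      moreover have "1 \<le> M\<^sup>2" using M1 by (simp add: one_le_power)
      \<comment> \<open>The left side is at most \<open>65 * M\<^sup>2\<close>, and 9 is the least
        integer whose square reaches 65. The factor 36 is then 2 * 2 * 9.\<close>
      ultimately have "2 ^ m1 \<le> (9 * M) ^ 2" by (simp add: power_mult_distrib)
      from exponent_le_log[OF this] show ?thesis using M1 by simp
    qed
    have m2_bound: "real m2 \<le> 176 * (1 + ln M)"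
    proof -
      have "M ^ 2 \<le> M ^ 4" "1 \<le> M ^ 4" using M1 by (auto intro: power_increasing one_le_power)
      have D2: "(of_int D)\<^sup>2 \<le> 1024 * M ^ 4"
      proof -
        have "(of_int D)\<^sup>2 \<le> (32 * M\<^sup>2)\<^sup>2" using D D0 by (intro power_mono)
        then show ?thesis by (simp add: power_mult_distrib)
      qed
      \<comment> \<open>16409 is 16 * 1024 + 6 * 4 + 1. Below, 11 is the least integer whose eighth
        power exceeds 8 * 1024 * 16409, and 176 is 2 * 8 * 11.\<close>
      have "8 * (of_int D)\<^sup>2 * (16 * (of_int D)\<^sup>2 + 6 * N + 1) \<le> 8 * (1024 * M ^ 4) * (16409 * M ^ 4)"
        using D2 NM \<open>M ^ 2 \<le> M ^ 4\<close> \<open>1 \<le> M ^ 4\<close> N_pos by (intro mult_mono) auto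
      also have "\<dots> = 134422528 * (M ^ 4 * M ^ 4)" by simp
      also have "M ^ 4 * M ^ 4 = M ^ 8" by (simp add: power_add[symmetric])
      also have "134422528 * M ^ 8 \<le> (11 * M) ^ 8" using M1 by (simp add: power_mult_distrib)
      finally have "2 ^ (2 * m2) \<le> (11 * M) ^ 8" using m2 by linarith
      from exponent_le_log[OF this] show ?thesis using M1 by simp
    qed
    have "real k \<le> real (cp + cg + cn + cr + cx + co) + (real m1 + 1) * real (Suc ce) + (real m2 + 2) * real (Suc cs)"
      using of_nat_mono[OF k(2), where 'a = real] by (simp add: algebra_simps)
    also have "\<dots> \<le> real (cp + cg + cn + cr + cx + co) * (1 + ln M) + 37 * (1 + ln M) * real (Suc ce)
        + 178 * (1 + ln M) * real (Suc cs)"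
    proof (intro add_mono mult_right_mono)
      show "real (cp + cg + cn + cr + cx + co) \<le> real (cp + cg + cn + cr + cx + co) * (1 + ln M)"
        using L by (simp add: distrib_left)
      show "real m1 + 1 \<le> 37 * (1 + ln M)" using m1_bound L by (simp add: algebra_simps)
      show "real m2 + 2 \<le> 178 * (1 + ln M)" using m2_bound L by (simp add: algebra_simps)
    qed auto
    also have "\<dots> = C * (1 + ln M)" by (simp add: C_def algebra_simps)
    finally have k_bound: "real k \<le> C * (1 + ln M)" .
    have "w = (t 0, t 1)" if "next_vertex d (integer_hull H) v w" for w
    proof -
      have "w = (output_vertex s4 0, output_vertex s4 1)"
        by (rule output_vertex_correct[OF _ _ _ _ _ _ _ _ _ _ _ orient fin])
          (use s4_keep s0' search(1) that in \<open>simp_all add: s4_def[symmetric] H region vxy del: funpow.simps\<close>)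
      moreover have "t 0 = output_vertex s4 0" "t 1 = output_vertex s4 1"
        using k(3) by (simp_all add: agree_def cells_def)
      ultimately show ?thesis by simp
    qed
    then show "\<exists>k t. exec P (input_store [a, b, c, n, x0, y0, fst v, snd v]) k t \<and>
        real k \<le> C * (1 + ln (Max {\<bar>n\<bar>, \<bar>a\<bar>, \<bar>b\<bar>, \<bar>c\<bar>})) \<and>
        (\<forall>w. next_vertex d (integer_hull H) v w \<longrightarrow> w = (t 0, t 1))"
      using k(1) k_bound unfolding s_def M_def by blast
  qed
qed

end
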